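(* Let $(n_j)_{j\ge1}$ be a lacunary sequence of positive integers, i.e. there is $q>1$ with $n_{j+1}\ge q\,n_j$ for all $j\ge 1$. Then for every $f\in L^1(T)$, where $T=[-\pi,\pi)$, for almost every $y\in T$ \[ \lim_{N\to\infty}\frac1N\sum_{j=1}^{N}S_{n_j}f(y)=f(y). \]
   Context: $T=[-\pi,\pi)$ with Lebesgue measure. For $f\in L^1(T)$ and $k\in\mathbb Z$, $\hat f(k)=\frac1{2\pi}\int_T f(t)e^{-\imath kt}\,dt$, and $S_nf(y)=\sum_{k=-n}^{n}\hat f(k)e^{\imath ky}$ is the $n$th partial sum of the trigonometric Fourier series of $f$. *)

theory Defs
  imports "HOL-Analysis.Analysis"
begin

text \<open>The torus carries unnormalised Lebesgue measure; its total mass is \<open>2 * pi\<close>.\<close>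

definition torus :: "real set" where
  "torus = {-pi..<pi}"

definition fourier_coeff :: "(real \<Rightarrow> complex) \<Rightarrow> int \<Rightarrow> complex" where
  "fourier_coeff f k =
     1 / (2 * of_real pi) *
     (LINT t|lebesgue_on torus. f t * exp (- (\<i> * of_int k * of_real t)))"

definition fourier_partial_sum :: "nat \<Rightarrow> (real \<Rightarrow> complex) \<Rightarrow> real \<Rightarrow> complex" where
  "fourier_partial_sum n f y =
     (\<Sum>k = - int n..int n. fourier_coeff f k * exp (\<i> * of_int k * of_real y))"

text \<open>Sequences are indexed from 1, so the value at index 0 is unconstrained.\<close>

definition lacunary :: "(nat \<Rightarrow> nat) \<Rightarrow> bool" where
  "lacunary n \<longleftrightarrow> (\<exists>q::real. q > 1 \<and> (\<forall>j\<ge>1. real (n (j + 1)) \<ge> q * real (n j)))"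

end

theory Submission
  imports Defs
begin

text \<open>
  Fix \<open>f\<close> and a height \<open>lam\<close>, and let \<open>I\<close> run through the Calderon--Zygmund intervals of \<open>f\<close>, on which the mean
  of \<open>\<bar>f\<bar>\<close> lies between \<open>lam\<close> and \<open>2 * lam\<close>.  Up to a harmless truncation, \<open>S\<^sub>n\<close> is the difference of two
  one-sided projections onto the frequencies \<open>\<ge> m\<close>, for \<open>m = - n\<close> and \<open>m = n + 1\<close>.  Conjugation by
  \<open>e\<^sub>m\<close> turns each of them into a smoothed Cauchy projection, whose kernel is a standard singular kernel.
  So if, on each \<open>I\<close>, one subtracts from \<open>f\<close> a multiple of \<open>e\<^sub>m\<close> times a fixed bump such that the difference
  has vanishing \<open>m\<close>-th Fourier coefficient, then away from the intervals the projection of the difference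
  is bounded by an integrable function that does not depend on \<open>m\<close>.

  The subtracted parts are bounded by \<open>3 * lam\<close>.  On the intervals with \<open>n \<bar>I\<bar> \<le> 1\<close> they differ from
  the part independent of \<open>n\<close> by \<open>O(lam n \<bar>I\<bar>)\<close>, which is square summable over a lacunary sequence.  On the
  intervals with \<open>n \<bar>I\<bar> > 1\<close> they are concentrated near the frequency \<open>m\<close>, the rest being again square
  summable; what remains has pairwise disjoint spectra for different \<open>n\<^sub>j\<close>, so its averages obey an
  \<open>L\<^sup>2\<close> maximal inequality.  The partial sums of the bounded part itself differ from its Fejer means
  by a square summable sequence.  This gives a weak type (1,1) maximal inequality, and trigonometric
  polynomials are dense in \<open>L\<^sup>1\<close>.
\<close>

subsection \<open>Exponentials and Bessel's inequality\<close>

text \<open>No bound for the supremum of all |S_n f| can hold on L^1, since Kolmogorov's example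
  diverges almost everywhere; so averaging has to enter. It is used for one term only, the frequency
  blocks next to m left by the long intervals. All other terms are bounded, have a common integrable
  majorant, or are square summable in j. Subtracting plain means on the Calderon--Zygmund intervals
  gives no decay uniform in m: the kernel of the projection oscillates like e_m, so cancellation is
  needed against e_m. The corrections thus depend on m, and most of the work pays for this
  dependence. The bumps vanish at the endpoints, so they have bounded derivatives, and Bessel's
  inequality for the derivative gives the decay of their coefficients. The truncation length depends
  on sup |f| and on finitely many n_j, while no constant depends on it. The maximal inequality is
  therefore proved for continuous f and N at most J; density and the limit in J remove both
  restrictions.\<close>

abbreviation \<mu> :: "real measure" where
  "\<mu> \<equiv> lebesgue_on torus"

definition ek :: "int \<Rightarrow> real \<Rightarrow> complex" where
  "ek k x = cis (of_int k * x)"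

lemma norm_ek [simp]: "norm (ek k x) = 1"
  by (simp add: ek_def)

lemma ek_0 [simp]: "ek 0 x = 1"
  by (simp add: ek_def)

lemma ek_zero_right [simp]: "ek k 0 = 1"
  by (simp add: ek_def)

lemma ek_add: "ek (k + l) x = ek k x * ek l x"
  by (simp add: ek_def cis_mult distrib_right)

lemma ek_add_right: "ek k (x + y) = ek k x * ek k y"
  by (simp add: ek_def cis_mult distrib_left)

lemma ek_uminus: "ek (- k) x = cnj (ek k x)"
  by (simp add: ek_def cis_cnj)

lemma ek_minus_right: "ek k (- x) = cnj (ek k x)"
  by (simp add: ek_def cis_cnj)

lemma ek_diff_right: "ek k (x - y) = ek k x * cnj (ek k y)"
  using ek_add_right[of k x "- y"] by (simp add: ek_minus_right)

lemma ek_diff: "ek (k - l) x = ek k x * cnj (ek l x)"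
  using ek_add[of k "- l" x] by (simp add: ek_uminus)

lemma ek_power: "ek (int k) x = cis x ^ k"
  unfolding ek_def by (simp only: of_int_of_nat_eq Complex.DeMoivre)

lemma ek_mult_cnj [simp]: "ek k x * cnj (ek k x) = 1"
  by (simp flip: complex_norm_square)

lemma exp_eq_ek: "exp (\<i> * of_int k * of_real y) = ek k y"
  by (simp add: ek_def cis_conv_exp mult.assoc)

lemma exp_minus_eq_ek: "exp (- (\<i> * of_int k * of_real y)) = cnj (ek k y)"
  using exp_eq_ek[of "- k" y] by (simp add: ek_uminus)

lemma continuous_on_ek [continuous_intros]: "continuous_on S (ek k)"
  unfolding ek_def by (intro continuous_intros)

lemma ek_has_vector_derivative:
  "(ek k has_vector_derivative (\<i> * of_int k * ek k x)) (at x within S)"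
proof -
  have "((\<lambda>z. exp (\<i> * of_int k * z)) has_field_derivative (\<i> * of_int k * exp (\<i> * of_int k * of_real x))) (at (of_real x))"
    by (auto intro!: derivative_eq_intros)
  then have "((\<lambda>x. exp (\<i> * of_int k * of_real x)) has_vector_derivative
      (\<i> * of_int k * exp (\<i> * of_int k * of_real x))) (at x within S)"
    by (rule has_vector_derivative_real_field)
  then show ?thesis by (simp add: exp_eq_ek)
qed

section \<open>Lebesgue integration on the torus\<close>

lemma torus_lmeasurable [simp]: "torus \<in> lmeasurable"
  by (simp add: torus_def fmeasurable_def lmeasurable_iff_has_integral)

lemma torus_sets [simp, measurable]: "torus \<in> sets lebesgue"
  by (simp add: torus_def)

lemma measure_torus: "measure lebesgue torus = 2 * pi"
  by (simp add: torus_def)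

interpretation torus: finite_measure \<mu>
  by (rule finite_measure_lebesgue_on) simp

lemma measure_space_torus: "measure \<mu> torus = 2 * pi"
  by (simp add: measure_restrict_space measure_torus)

lemma integrable_torus_bounded:
  fixes g :: "real \<Rightarrow> 'a::{banach,second_countable_topology}"
  assumes "g \<in> borel_measurable \<mu>" "\<And>x. x \<in> torus \<Longrightarrow> norm (g x) \<le> B"
  shows "integrable \<mu> g"
  using assms by (intro torus.integrable_const_bound[of _ B]) auto

lemma borel_measurable_torus_continuous:
  fixes g :: "real \<Rightarrow> 'a::euclidean_space"
  assumes "continuous_on torus g"
  shows "g \<in> borel_measurable \<mu>"
  using assms continuous_imp_measurable_on_sets_lebesgue torus_sets by blast

lemma borel_measurable_ek [measurable]: "ek k \<in> borel_measurable \<mu>"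
  by (intro borel_measurable_torus_continuous continuous_intros)

lemma borel_measurable_torus_indicator_continuous:
  fixes g :: "real \<Rightarrow> 'a::euclidean_space"
  assumes "continuous_on {a..b} g"
  shows "(\<lambda>x. indicator {a..<b} x *\<^sub>R g x) \<in> borel_measurable \<mu>"
proof -
  have "continuous_on {a..<b} g" using assms continuous_on_subset[of _ _ "{a..<b}"] by force
  then have "g \<in> borel_measurable (lebesgue_on {a..<b})"
    by (intro continuous_imp_measurable_on_sets_lebesgue) auto
  then have "(\<lambda>x. indicator {a..<b} x *\<^sub>R g x) \<in> borel_measurable lebesgue"
    by (subst (asm) borel_measurable_restrict_space_iff) auto
  then show ?thesis by (rule measurable_restrict_space1)
qed

lemma integrable_torus_indicator_continuous:
  fixes g :: "real \<Rightarrow> 'a::euclidean_space"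
  assumes "continuous_on {a..b} g"
  shows "integrable \<mu> (\<lambda>x. indicator {a..<b} x *\<^sub>R g x)"
proof -
  have "compact (g ` {a..b})" using assms by (intro compact_continuous_image) auto
  then obtain B where B: "\<And>x. x \<in> {a..b} \<Longrightarrow> norm (g x) \<le> B"
    by (metis bounded_iff compact_imp_bounded imageI)
  then have "norm (indicator {a..<b} x *\<^sub>R g x) \<le> \<bar>B\<bar>" for x
    by (cases "x \<in> {a..<b}") (auto simp: indicator_def intro: order_trans[OF _ abs_ge_self])
  then show ?thesis
    using borel_measurable_torus_indicator_continuous[OF assms] integrable_torus_bounded by blast
qed

text \<open>The fundamental theorem of calculus is available for Henstock--Kurzweil integrals on
  closed intervals; passing to them costs only the endpoint \<open>b\<close>, a null set.\<close>

lemma integral_torus_interval: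
  fixes g :: "real \<Rightarrow> 'a::euclidean_space"
  assumes "- pi \<le> a" "b \<le> pi" "continuous_on {a..b} g"
  shows "(LINT x|\<mu>. indicator {a..<b} x *\<^sub>R g x) = integral {a..b} g"
proof -
  have sub: "{a..<b} \<inter> torus = {a..<b}" using assms by (auto simp: torus_def)
  have "continuous_on {a..<b} g" using assms(3) continuous_on_subset[of _ _ "{a..<b}"] by force
  have "integrable \<mu> (\<lambda>x. indicator {a..<b} x *\<^sub>R g x)"
    by (rule integrable_torus_indicator_continuous) fact
  then have "(LINT x|\<mu>. indicator {a..<b} x *\<^sub>R g x) =
      integral torus (\<lambda>x. indicator {a..<b} x *\<^sub>R g x)"
    by (intro lebesgue_integral_eq_integral) auto
  also have "\<dots> = integral torus (\<lambda>x. if x \<in> {a..<b} then g x else 0)"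
    by (intro integral_cong) (auto simp: indicator_def)
  also have "\<dots> = integral {a..<b} g"
    using integral_restrict_Int[of torus "{a..<b}" g] sub by simp
  also have "\<dots> = integral {a..b} g"
    by (intro integral_subset_negligible) (auto intro: negligible_subset[of "{b}"])
  finally show ?thesis .
qed

lemma integral_torus_continuous:
  fixes g :: "real \<Rightarrow> 'a::euclidean_space"
  assumes "continuous_on {-pi..pi} g"
  shows "(LINT x|\<mu>. g x) = integral {-pi..pi} g"
proof -
  have "(LINT x|\<mu>. g x) = (LINT x|\<mu>. indicator {-pi..<pi} x *\<^sub>R g x)"
    by (intro Bochner_Integration.integral_cong) (auto simp: torus_def)
  then show ?thesis using integral_torus_interval[of "-pi" pi g] assms by simp
qed

lemma integral_ek: "(LINT x|\<mu>. ek k x) = (if k = 0 then 2 * pi else 0)"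
proof (cases "k = 0")
  case False
  have "((\<lambda>x. \<i> * of_int k * ek k x) has_integral (ek k pi - ek k (-pi))) {-pi..pi}"
    by (intro fundamental_theorem_of_calculus ek_has_vector_derivative) auto
  moreover have "ek k pi = ek k (-pi)"
    by (simp add: ek_def complex_eq_iff sin_times_pi_eq_0)
  ultimately have "((\<lambda>x. \<i> * of_int k * ek k x) has_integral 0) {-pi..pi}" by simp
  then have "((\<lambda>x. (1 / (\<i> * of_int k)) * (\<i> * of_int k * ek k x)) has_integral (1 / (\<i> * of_int k)) * 0) {-pi..pi}"
    by (rule has_integral_mult_right)
  then have "integral {-pi..pi} (ek k) = 0"
    using False by (intro integral_unique) simp
  then show ?thesis using False
    by (simp add: integral_torus_continuous continuous_on_ek)
qed (simp add: measure_space_torus scaleR_conv_of_real)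

section \<open>Fourier coefficients, Parseval's identity and Bessel's inequality\<close>

lemma fourier_coeff_ek: "fourier_coeff f k = 1 / (2 * of_real pi) * (LINT t|\<mu>. f t * cnj (ek k t))"
  by (simp only: fourier_coeff_def exp_minus_eq_ek)

lemma fourier_partial_sum_ek: "fourier_partial_sum n f y = (\<Sum>k = - int n..int n. fourier_coeff f k * ek k y)"
  by (simp only: fourier_partial_sum_def exp_eq_ek)

lemma integrable_mult_bounded:
  fixes f g :: "real \<Rightarrow> complex"
  assumes "integrable \<mu> f" "g \<in> borel_measurable \<mu>" "\<And>x. x \<in> torus \<Longrightarrow> norm (g x) \<le> B"
  shows "integrable \<mu> (\<lambda>x. f x * g x)"
proof (rule Bochner_Integration.integrable_bound[of _ "\<lambda>x. B * norm (f x)"])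
  show "(\<lambda>x. f x * g x) \<in> borel_measurable \<mu>"
    using assms(1,2) borel_measurable_times borel_measurable_integrable by blast
  show "AE x in \<mu>. norm (f x * g x) \<le> norm (B * norm (f x))"
  proof (rule AE_I2)
    fix x assume "x \<in> space \<mu>"
    then have "norm (g x) \<le> \<bar>B\<bar>" using assms(3)[of x] by simp
    then have "norm (f x) * norm (g x) \<le> norm (f x) * \<bar>B\<bar>" by (intro mult_left_mono) auto
    then show "norm (f x * g x) \<le> norm (B * norm (f x))" by (simp add: norm_mult abs_mult mult.commute)
  qed
qed (use assms in auto)

lemma integrable_mult_cnj_ek:
  assumes "integrable \<mu> f"
  shows "integrable \<mu> (\<lambda>x. f x * cnj (ek k x))"
  using assms by (intro integrable_mult_bounded[where B = 1]) (auto simp flip: ek_uminus)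

lemma fourier_coeff_add:
  assumes "integrable \<mu> f" "integrable \<mu> g"
  shows "fourier_coeff (\<lambda>x. f x + g x) k = fourier_coeff f k + fourier_coeff g k"
  using integrable_mult_cnj_ek[OF assms(1)] integrable_mult_cnj_ek[OF assms(2)]
  by (simp add: fourier_coeff_ek distrib_right distrib_left)

lemma fourier_coeff_diff:
  assumes "integrable \<mu> f" "integrable \<mu> g"
  shows "fourier_coeff (\<lambda>x. f x - g x) k = fourier_coeff f k - fourier_coeff g k"
  using integrable_mult_cnj_ek[OF assms(1)] integrable_mult_cnj_ek[OF assms(2)]
  by (simp add: fourier_coeff_ek left_diff_distrib right_diff_distrib)

lemma norm_fourier_coeff_le:
  assumes "integrable \<mu> f"
  shows "norm (fourier_coeff f k) \<le> (LINT x|\<mu>. norm (f x)) / (2 * pi)"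
proof -
  have "norm (LINT t|\<mu>. f t * cnj (ek k t)) \<le> (LINT t|\<mu>. norm (f t * cnj (ek k t)))"
    by (rule integral_norm_bound)
  then show ?thesis by (simp add: fourier_coeff_ek norm_mult norm_divide divide_right_mono)
qed

lemma fourier_coeff_mult_ek: "fourier_coeff (\<lambda>x. ek m x * f x) (m + k) = fourier_coeff f k"
proof -
  have "ek m t * f t * cnj (ek (m + k) t) = f t * cnj (ek k t)" for t
  proof -
    have "ek m t * f t * cnj (ek (m + k) t) = (ek m t * cnj (ek m t)) * (f t * cnj (ek k t))"
      by (simp only: ek_add complex_cnj_mult mult.assoc mult.left_commute mult.commute)
    then show ?thesis by simp
  qed
  then show ?thesis by (simp only: fourier_coeff_ek)
qed

abbreviation energy :: "(real \<Rightarrow> complex) \<Rightarrow> real" where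
  "energy g \<equiv> LINT x|\<mu>. (norm (g x))^2"

abbreviation L1_norm :: "(real \<Rightarrow> complex) \<Rightarrow> real" where
  "L1_norm g \<equiv> LINT x|\<mu>. norm (g x)"

text \<open>The frequencies are given by an injective map so that families indexed by pairs are
  covered; injectivity on pairs will express that the spectra of different blocks are
  disjoint.\<close>

lemma parseval_finite:
  assumes "finite I" "inj_on \<kappa> I"
  shows "(LINT x|\<mu>. (norm (\<Sum>i\<in>I. c i * ek (\<kappa> i) x))^2) = 2 * pi * (\<Sum>i\<in>I. (norm (c i))^2)"
proof -
  have int: "integrable \<mu> (\<lambda>x. c i * cnj (c j) * ek (\<kappa> i - \<kappa> j) x)" for i j
    by (intro integrable_torus_bounded[where B = "norm (c i * cnj (c j))"]) (auto simp: norm_mult)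
  have "complex_of_real (LINT x|\<mu>. (norm (\<Sum>i\<in>I. c i * ek (\<kappa> i) x))^2)
    = (LINT x|\<mu>. complex_of_real ((norm (\<Sum>i\<in>I. c i * ek (\<kappa> i) x))^2))"
    by (rule integral_complex_of_real[symmetric])
  also have "\<dots> = (LINT x|\<mu>. (\<Sum>i\<in>I. \<Sum>j\<in>I. c i * cnj (c j) * ek (\<kappa> i - \<kappa> j) x))"
    by (intro Bochner_Integration.integral_cong refl)
      (simp only: complex_norm_square cnj_sum sum_product ek_diff complex_cnj_mult mult.assoc mult.left_commute)
  also have "\<dots> = (\<Sum>i\<in>I. \<Sum>j\<in>I. c i * cnj (c j) * (if \<kappa> i - \<kappa> j = 0 then 2 * pi else 0))"
    using int by (simp add: integral_ek)
  also have "\<dots> = (\<Sum>i\<in>I. \<Sum>j\<in>I. if j = i then 2 * pi * (c i * cnj (c i)) else 0)"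
    using assms(2) by (intro sum.cong refl) (auto simp: inj_on_def)
  also have "\<dots> = complex_of_real (2 * pi * (\<Sum>i\<in>I. (norm (c i))^2))"
    using assms(1) by (simp add: sum.delta sum_distrib_left flip: complex_norm_square)
  finally show ?thesis using of_real_eq_iff by blast
qed

lemma parseval_finite_id:
  assumes "finite K"
  shows "(LINT x|\<mu>. (norm (\<Sum>k\<in>K. c k * ek k x))^2) = 2 * pi * (\<Sum>k\<in>K. (norm (c k))^2)"
  using parseval_finite[of K "\<lambda>k. k" c] assms by simp

lemma borel_measurable_cnj [measurable (raw)]:
  "f \<in> borel_measurable M \<Longrightarrow> (\<lambda>x. cnj (f x)) \<in> borel_measurable M"
  by (rule borel_measurable_continuous_on[OF continuous_on_cnj[OF continuous_on_id]])

text \<open>The energy of \<open>g - P\<close> is nonnegative, where \<open>P\<close> is the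
  projection of \<open>g\<close> to the frequencies in \<open>K\<close>. The bound \<open>B\<close>
  supplies square integrability.\<close>

lemma bessel:
  assumes g: "g \<in> borel_measurable \<mu>" "\<And>x. x \<in> torus \<Longrightarrow> norm (g x) \<le> B" and K: "finite K"
  shows "2 * pi * (\<Sum>k\<in>K. (norm (fourier_coeff g k))^2) \<le> energy g"
proof -
  define c where "c = fourier_coeff g"
  define P where "P x = (\<Sum>k\<in>K. c k * ek k x)" for x
  have intg: "integrable \<mu> g" using g by (rule integrable_torus_bounded)
  have Pm [measurable]: "P \<in> borel_measurable \<mu>" unfolding P_def by measurable
  have PB: "norm (P x) \<le> (\<Sum>k\<in>K. norm (c k))" for x
    unfolding P_def by (rule order_trans[OF norm_sum]) (simp add: norm_mult)
  have i1: "integrable \<mu> (\<lambda>x. (norm (g x))^2)"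
    using g by (intro integrable_torus_bounded[where B = "B^2"]) (auto intro: power_mono)
  have i2: "integrable \<mu> (\<lambda>x. (norm (P x))^2)"
    using PB by (intro integrable_torus_bounded[where B = "(\<Sum>k\<in>K. norm (c k))^2"]) (auto intro: power_mono)
  have i3': "integrable \<mu> (\<lambda>x. g x * cnj (P x))"
    by (rule integrable_mult_bounded[OF intg, where B = "\<Sum>k\<in>K. norm (c k)"]) (use PB in auto)
  then have i3: "integrable \<mu> (\<lambda>x. 2 * Re (g x * cnj (P x)))"
    by (intro integrable_mult_right) (rule integrable_Re)
  have "(LINT x|\<mu>. g x * cnj (P x)) = (LINT x|\<mu>. (\<Sum>k\<in>K. cnj (c k) * (g x * cnj (ek k x))))"
    by (simp add: P_def sum_distrib_left mult.left_commute)
  also have "\<dots> = (\<Sum>k\<in>K. cnj (c k) * (LINT x|\<mu>. g x * cnj (ek k x)))"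
    using integrable_mult_cnj_ek[OF intg] by simp
  also have "\<dots> = (\<Sum>k\<in>K. cnj (c k) * (2 * pi * c k))"
    by (simp add: c_def fourier_coeff_ek)
  also have "\<dots> = complex_of_real (2 * pi * (\<Sum>k\<in>K. (norm (c k))^2))"
    by (simp only: of_real_mult of_real_sum complex_norm_square sum_distrib_left) (simp add: mult_ac)
  finally have cross: "(LINT x|\<mu>. 2 * Re (g x * cnj (P x))) = 2 * (2 * pi * (\<Sum>k\<in>K. (norm (c k))^2))"
    using i3' by (simp only: integral_mult_right_zero integral_Re Re_complex_of_real)
  have PP: "energy P = 2 * pi * (\<Sum>k\<in>K. (norm (c k))^2)"
    unfolding P_def by (rule parseval_finite_id) fact
  have "0 \<le> (LINT x|\<mu>. (norm (g x - P x))^2)" by (intro integral_nonneg_AE) auto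
  also have "\<dots> = (LINT x|\<mu>. ((norm (g x))^2 - 2 * Re (g x * cnj (P x))) + (norm (P x))^2)"
  proof (intro Bochner_Integration.integral_cong refl)
    fix x
    show "(norm (g x - P x))^2 = ((norm (g x))^2 - 2 * Re (g x * cnj (P x))) + (norm (P x))^2"
      unfolding cmod_power2 by (simp add: power2_eq_square algebra_simps)
  qed
  also have "\<dots> = energy g - 2 * (2 * pi * (\<Sum>k\<in>K. (norm (c k))^2)) + 2 * pi * (\<Sum>k\<in>K. (norm (c k))^2)"
    using i1 i2 i3 cross PP by simp
  finally show ?thesis by (simp add: c_def)
qed

subsection \<open>Fejer means and Cauchy projections\<close>

definition fejer_mean :: "nat \<Rightarrow> (real \<Rightarrow> complex) \<Rightarrow> real \<Rightarrow> complex" where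
  "fejer_mean n g y = (\<Sum>k = - int n..int n.
     of_real (1 - \<bar>of_int k\<bar> / (real n + 1)) * fourier_coeff g k * ek k y)"

lemma sum_int_symmetric_Suc:
  fixes F :: "int \<Rightarrow> 'a::comm_monoid_add"
  shows "(\<Sum>k = - int (Suc n)..int (Suc n). F k) = F (- int (Suc n)) + ((\<Sum>k = - int n..int n. F k) + F (int (Suc n)))"
proof -
  have eq: "{- int (Suc n)..int (Suc n)} = insert (- int (Suc n)) (insert (int (Suc n)) {- int n..int n})" by auto
  show ?thesis unfolding eq by (subst sum.insert; simp add: add_ac)
qed

text \<open>The difference k arises from n + 1 - |k| pairs. This count identifies the squared
  modulus of a one-sided Dirichlet sum with n + 1 times the Fejer kernel.\<close>

lemma sum_diff_pairs:
  fixes F :: "int \<Rightarrow> complex"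
  shows "(\<Sum>a\<le>n. \<Sum>b\<le>n. F (int a - int b)) = (\<Sum>k = - int n..int n. of_real (real n + 1 - \<bar>of_int k\<bar>) * F k)"
proof (induction n)
  case (Suc n)
  have pos: "(\<Sum>b\<le>n. F (int (Suc n) - int b)) = (\<Sum>k = 1..int (Suc n). F k)"
    by (intro sum.reindex_bij_witness[of _ "\<lambda>k. nat (int (Suc n) - k)" "\<lambda>b. int (Suc n) - int b"]) auto
  have neg: "(\<Sum>a\<le>n. F (int a - int (Suc n))) = (\<Sum>k = - int (Suc n)..- 1. F k)"
    by (intro sum.reindex_bij_witness[of _ "\<lambda>k. nat (int (Suc n) + k)" "\<lambda>b. int b - int (Suc n)"]) auto
  have split: "{- int (Suc n)..int (Suc n)} = {- int (Suc n)..- 1} \<union> (insert 0 {1..int (Suc n)})" by auto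
  have all: "(\<Sum>k = - int (Suc n)..- 1. F k) + (F 0 + (\<Sum>k = 1..int (Suc n). F k)) = (\<Sum>k = - int (Suc n)..int (Suc n). F k)"
    unfolding split by (subst sum.union_disjoint) auto
  have "(\<Sum>a\<le>Suc n. \<Sum>b\<le>Suc n. F (int a - int b)) = (\<Sum>a\<le>n. \<Sum>b\<le>n. F (int a - int b))
      + (\<Sum>k = - int (Suc n)..int (Suc n). F k)"
    using pos neg all by (simp add: sum.distrib add_ac)
  also have "\<dots> = (\<Sum>k = - int n..int n. of_real (real n + 1 - \<bar>of_int k\<bar>) * F k)
      + (F (- int (Suc n)) + ((\<Sum>k = - int n..int n. F k) + F (int (Suc n))))"
    unfolding Suc.IH sum_int_symmetric_Suc ..
  also have "\<dots> = F (- int (Suc n)) + ((\<Sum>k = - int n..int n. of_real (real n + 1 - \<bar>of_int k\<bar>) * F k + F k) + F (int (Suc n)))"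
    by (simp add: sum.distrib)
  also have "\<dots> = (\<Sum>k = - int (Suc n)..int (Suc n). of_real (real (Suc n) + 1 - \<bar>of_int k\<bar>) * F k)"
    unfolding sum_int_symmetric_Suc by (simp add: algebra_simps)
  finally show ?case .
qed simp

text \<open>The Fejer kernel is a squared modulus \<open>(norm (D x))^2\<close> divided by n + 1,
  hence nonnegative, and it has mean one; so the means do not increase the sup norm.\<close>

lemma norm_fejer_mean_le:
  assumes g: "g \<in> borel_measurable \<mu>" "\<And>x. x \<in> torus \<Longrightarrow> norm (g x) \<le> B"
  shows "norm (fejer_mean n g y) \<le> B"
proof -
  define D where "D x = (\<Sum>a\<le>n. ek (int a) y * ek (- int a) x)" for x
  have intg: "integrable \<mu> g" using g by (rule integrable_torus_bounded)
  have Dm [measurable]: "D \<in> borel_measurable \<mu>" unfolding D_def by measurable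
  have DB: "norm (D x) \<le> real n + 1" for x
    unfolding D_def by (rule order_trans[OF norm_sum]) (simp add: norm_mult)
  have DB2: "(norm (D x))^2 \<le> (real n + 1)^2" for x
    using DB by (intro power_mono) auto
  have D2: "complex_of_real ((norm (D x))^2) =
      (\<Sum>k = - int n..int n. of_real (real n + 1 - \<bar>of_int k\<bar>) * (ek k y * cnj (ek k x)))" for x
  proof -
    have "complex_of_real ((norm (D x))^2) = (\<Sum>a\<le>n. \<Sum>b\<le>n. ek (int a - int b) y * cnj (ek (int a - int b) x))"
      unfolding complex_norm_square D_def cnj_sum sum_product ek_uminus ek_diff by (simp add: mult_ac)
    then show ?thesis by (simp only: sum_diff_pairs[where F = "\<lambda>k. ek k y * cnj (ek k x)"])
  qed
  have "(LINT x|\<mu>. g x * complex_of_real ((norm (D x))^2)) =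
      (LINT x|\<mu>. (\<Sum>k = - int n..int n. of_real (real n + 1 - \<bar>of_int k\<bar>) * ek k y * (g x * cnj (ek k x))))"
    unfolding D2 by (simp add: sum_distrib_left mult_ac)
  also have "\<dots> = (\<Sum>k = - int n..int n. of_real (real n + 1 - \<bar>of_int k\<bar>) * ek k y * (2 * of_real pi * fourier_coeff g k))"
    using integrable_mult_cnj_ek[OF intg] by (simp add: fourier_coeff_ek)
  also have "\<dots> = of_real (2 * pi * (real n + 1)) * fejer_mean n g y"
    unfolding fejer_mean_def sum_distrib_left
  proof (intro sum.cong refl)
    fix k
    have "real n + 1 - \<bar>of_int k\<bar> = (real n + 1) * (1 - \<bar>of_int k\<bar> / (real n + 1))"
      by (simp add: field_simps)
    then have eq: "complex_of_real (real n + 1 - \<bar>of_int k\<bar>) =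
        of_real (real n + 1) * of_real (1 - \<bar>of_int k\<bar> / (real n + 1))" by (simp only: of_real_mult)
    show "of_real (real n + 1 - \<bar>of_int k\<bar>) * ek k y * (2 * of_real pi * fourier_coeff g k)
       = of_real (2 * pi * (real n + 1)) * (of_real (1 - \<bar>of_int k\<bar> / (real n + 1)) * fourier_coeff g k * ek k y)"
      unfolding eq by (simp only: of_real_mult of_real_numeral mult_ac)
  qed
  finally have eq: "of_real (2 * pi * (real n + 1)) * fejer_mean n g y = (LINT x|\<mu>. g x * complex_of_real ((norm (D x))^2))" ..
  have "2 * pi * (real n + 1) * norm (fejer_mean n g y) = norm (of_real (2 * pi * (real n + 1)) * fejer_mean n g y)"
    by (simp only: norm_mult norm_of_real) simp
  also have "\<dots> \<le> (LINT x|\<mu>. norm (g x * complex_of_real ((norm (D x))^2)))"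
    unfolding eq by (rule integral_norm_bound)
  also have "\<dots> \<le> (LINT x|\<mu>. B * (norm (D x))^2)"
  proof (rule integral_mono)
    show "integrable \<mu> (\<lambda>x. norm (g x * complex_of_real ((norm (D x))^2)))"
      using DB2 by (intro integrable_norm integrable_mult_bounded[OF intg, where B = "(real n + 1)^2"]) (auto simp: norm_power)
    show "integrable \<mu> (\<lambda>x. B * (norm (D x))^2)"
      using DB2 by (intro integrable_mult_right integrable_torus_bounded[where B = "(real n + 1)^2"]) (auto simp: norm_power)
    fix x assume "x \<in> space \<mu>"
    then show "norm (g x * complex_of_real ((norm (D x))^2)) \<le> B * (norm (D x))^2"
      using g(2)[of x] by (simp add: norm_mult norm_power mult_right_mono)
  qed
  \<comment> \<open>Parseval computes the total mass of the kernel.\<close>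
  also have "\<dots> = B * (2 * pi * (\<Sum>a\<le>n. (norm (ek (int a) y))^2))"
    unfolding D_def using parseval_finite[of "{..n}" "\<lambda>a. - int a" "\<lambda>a. ek (int a) y"]
    by (simp add: inj_on_def)
  also have "\<dots> = 2 * pi * (real n + 1) * B" by simp
  finally show ?thesis by (subst (asm) mult_le_cancel_left_pos) (auto simp: add_pos_nonneg)
qed

text \<open>Summation by parts with linearly decreasing weights. It is used with N = M, where the
  last term vanishes, once for powers of z and once for the terms of a Fourier series.\<close>

lemma weighted_difference_sum:
  fixes \<phi> :: "nat \<Rightarrow> complex"
  assumes "M > 0"
  shows "(\<Sum>k<N. of_real (1 - real k / real M) * \<phi> k) - (\<Sum>k<N. of_real (1 - real k / real M) * \<phi> (Suc k))
    = \<phi> 0 - (\<Sum>k<N. \<phi> (Suc k)) / of_nat M - of_real (1 - real N / real M) * \<phi> N"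
proof (induction N)
  case (Suc N)
  have M: "of_real (1 - real (Suc N) / real M) = complex_of_real (1 - real N / real M) - 1 / of_nat M"
    by (simp add: add_divide_distrib)
  show ?case using Suc.IH unfolding sum.lessThan_Suc M by (simp add: algebra_simps add_divide_distrib)
qed simp

text \<open>A Cesaro mean of the geometric series of 1 / (1 - z), that is, of the kernel of the
  projection to nonnegative frequencies.\<close>

definition cauchy_kernel :: "nat \<Rightarrow> complex \<Rightarrow> complex" where
  "cauchy_kernel M z = (\<Sum>k<M. of_real (1 - real k / real M) * z ^ k)"

definition cauchy_mean :: "nat \<Rightarrow> int \<Rightarrow> (real \<Rightarrow> complex) \<Rightarrow> real \<Rightarrow> complex" where
  "cauchy_mean M m g y =
     (\<Sum>k<M. of_real (1 - real k / real M) * fourier_coeff g (m + int k) * ek (m + int k) y)"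

text \<open>The kernel equals (1 - A) / (1 - z), where A is the mean of the powers z, ..., z^M, and
  A = P / (1 - z). The factor of order M lost in differencing the power in \<open>P\<close> is
  returned by the division by M, so \<open>P\<close> has Lipschitz constant 3, and the bound is the
  one for 1 / (1 - z), free of M.\<close>

lemma cauchy_kernel_lipschitz:
  assumes M: "M > 0" and n: "norm z = 1" "norm w = 1" and ne: "z \<noteq> 1" "w \<noteq> 1"
  shows "norm (cauchy_kernel M z - cauchy_kernel M w)
    \<le> 4 * norm (z - w) / (norm (1 - z))^2 + 2 * norm (z - w) / (norm (1 - z) * norm (1 - w))"
proof -
  define A where "A z = (\<Sum>k<M. z ^ Suc k) / of_nat M" for z :: complex
  define P where "P z = (z - z ^ Suc M) / of_nat M" for z :: complex
  have K: "(1 - z) * cauchy_kernel M z = 1 - A z" for z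
    using weighted_difference_sum[OF M, where N = M and \<phi> = "\<lambda>k. z ^ k"] M
    by (simp add: cauchy_kernel_def A_def left_diff_distrib sum_distrib_left sum_subtractf mult_ac)
  have AP: "(1 - z) * A z = P z" for z
  proof -
    have "(1 - z) * (\<Sum>k<M. z ^ Suc k) = z * ((1 - z) * (\<Sum>k<M. z ^ k))"
      by (simp add: sum_distrib_left mult_ac)
    also have "(1 - z) * (\<Sum>k<M. z ^ k) = 1 - z ^ M" by (rule one_diff_power_eq[symmetric])
    finally show ?thesis by (simp add: A_def P_def algebra_simps)
  qed
  have Aw: "norm (A w) \<le> 1"
  proof -
    have "norm (\<Sum>k<M. w ^ Suc k) \<le> (\<Sum>k<M. 1)"
      using n by (intro sum_norm_le) (simp add: norm_mult norm_power)
    then show ?thesis using M by (simp add: A_def norm_divide)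
  qed
  have Pw: "norm (P w) \<le> norm (1 - w)"
  proof -
    have "norm (1 ^ M - w ^ M) \<le> real M * norm (1 - w)" using n by (intro norm_power_diff) auto
    moreover have "P w = w * (1 - w ^ M) / of_nat M" by (simp add: P_def algebra_simps)
    ultimately show ?thesis using M n by (simp add: norm_divide norm_mult divide_le_eq mult.commute)
  qed
  have Pd: "norm (P z - P w) \<le> 3 * norm (z - w)"
  proof -
    have 1: "norm (z ^ Suc M - w ^ Suc M) \<le> real (Suc M) * norm (z - w)" using n by (intro norm_power_diff) auto
    have "norm ((z - w) - (z ^ Suc M - w ^ Suc M)) \<le> norm (z - w) + real (Suc M) * norm (z - w)"
      using 1 norm_triangle_ineq4[of "z - w" "z ^ Suc M - w ^ Suc M"] by linarith
    also have "\<dots> = real (M + 2) * norm (z - w)" by (simp add: algebra_simps)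
    also have "\<dots> \<le> real (3 * M) * norm (z - w)" using M by (intro mult_right_mono) auto
    finally have "norm ((z - w) - (z ^ Suc M - w ^ Suc M)) \<le> real (3 * M) * norm (z - w)" .
    moreover have "P z - P w = ((z - w) - (z ^ Suc M - w ^ Suc M)) / of_nat M"
      by (simp add: P_def diff_divide_distrib)
    ultimately show ?thesis using M by (simp add: norm_divide divide_le_eq mult_ac)
  qed
  have z1: "norm (1 - z) > 0" and w1: "norm (1 - w) > 0" using ne by auto
  have recip: "(z - w) / ((1 - z) * (1 - w)) = 1 / (1 - z) - 1 / (1 - w)"
    using ne by (simp add: divide_simps)
  have Ad: "norm (A z - A w) \<le> 4 * norm (z - w) / norm (1 - z)"
  proof -
    have "A z = P z / (1 - z)" "A w = P w / (1 - w)" using AP[of z] AP[of w] ne by (auto simp: field_simps)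
    then have "A z - A w = (P z - P w) / (1 - z) + P w * ((z - w) / ((1 - z) * (1 - w)))"
      unfolding recip by (simp add: right_diff_distrib diff_divide_distrib)
    then have "norm (A z - A w) \<le> norm (P z - P w) / norm (1 - z) + norm (P w) * (norm (z - w) / (norm (1 - z) * norm (1 - w)))"
      by (metis norm_triangle_ineq norm_divide norm_mult)
    also have "\<dots> \<le> 3 * norm (z - w) / norm (1 - z) + norm (1 - w) * (norm (z - w) / (norm (1 - z) * norm (1 - w)))"
      using Pd Pw by (intro add_mono divide_right_mono mult_right_mono) auto
    also have "\<dots> = 4 * norm (z - w) / norm (1 - z)" using w1 z1 by (simp add: field_simps)
    finally show ?thesis .
  qed
  have "cauchy_kernel M z = (1 - A z) / (1 - z)" "cauchy_kernel M w = (1 - A w) / (1 - w)"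
    using K[of z] K[of w] ne by (auto simp: field_simps)
  then have "cauchy_kernel M z - cauchy_kernel M w = (1 - A w) * ((z - w) / ((1 - z) * (1 - w))) - (A z - A w) / (1 - z)"
    unfolding recip by (simp add: left_diff_distrib right_diff_distrib diff_divide_distrib)
  then have "norm (cauchy_kernel M z - cauchy_kernel M w) \<le>
      norm (1 - A w) * (norm (z - w) / (norm (1 - z) * norm (1 - w))) + norm (A z - A w) / norm (1 - z)"
    by (metis norm_triangle_ineq4 norm_divide norm_mult)
  also have "\<dots> \<le> 2 * (norm (z - w) / (norm (1 - z) * norm (1 - w))) + (4 * norm (z - w) / norm (1 - z)) / norm (1 - z)"
    using Ad Aw norm_triangle_ineq4[of 1 "A w"] by (intro add_mono divide_right_mono mult_right_mono) auto
  also have "\<dots> = 4 * norm (z - w) / (norm (1 - z))^2 + 2 * norm (z - w) / (norm (1 - z) * norm (1 - w))"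
    by (simp add: power2_eq_square)
  finally show ?thesis .
qed

text \<open>The kernel is e_m(y - x) times a kernel independent of m; this makes the later estimates
  uniform in m.\<close>

lemma cauchy_mean_integral:
  assumes "integrable \<mu> g"
  shows "cauchy_mean M m g y =
    1 / (2 * of_real pi) * (LINT x|\<mu>. ek m y * (g x * cnj (ek m x)) * cauchy_kernel M (cis (y - x)))"
proof -
  have K: "cauchy_kernel M (cis (y - x)) = (\<Sum>k<M. of_real (1 - real k / real M) * (ek (int k) y * cnj (ek (int k) x)))" for x
    unfolding cauchy_kernel_def by (simp only: ek_power[symmetric] ek_diff_right)
  have "(LINT x|\<mu>. ek m y * (g x * cnj (ek m x)) * cauchy_kernel M (cis (y - x)))
      = (LINT x|\<mu>. (\<Sum>k<M. of_real (1 - real k / real M) * ek (m + int k) y * (g x * cnj (ek (m + int k) x))))"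
    unfolding K by (intro Bochner_Integration.integral_cong refl) (simp add: sum_distrib_left ek_add mult_ac)
  also have "\<dots> = (\<Sum>k<M. of_real (1 - real k / real M) * ek (m + int k) y * (2 * of_real pi * fourier_coeff g (m + int k)))"
    using integrable_mult_cnj_ek[OF assms] by (simp add: fourier_coeff_ek)
  also have "\<dots> = 2 * of_real pi * cauchy_mean M m g y"
    by (simp add: cauchy_mean_def sum_distrib_left mult_ac)
  finally show ?thesis by simp
qed

text \<open>Sharp projections starting at m and m + 1 differ by exactly one frequency; for the
  smoothed ones the error is an average of M Fourier terms.\<close>

lemma cauchy_mean_step:
  assumes "M > 0"
  shows "fourier_coeff g m * ek m y - (cauchy_mean M m g y - cauchy_mean M (m + 1) g y)
    = (\<Sum>k<M. fourier_coeff g (m + int (Suc k)) * ek (m + int (Suc k)) y) / of_nat M"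
proof -
  have "m + int (Suc k) = m + 1 + int k" for k by simp
  then show ?thesis
    using weighted_difference_sum[OF assms, where N = M and \<phi> = "\<lambda>k. fourier_coeff g (m + int k) * ek (m + int k) y"] assms
    by (simp add: cauchy_mean_def mult.assoc add.assoc)
qed

text \<open>By Bessel the M coefficients are square summable with sum at most B^2, so
  Cauchy--Schwarz bounds their sum by B times the root of M, and the average is small.\<close>

lemma cauchy_mean_step_bound:
  assumes "M > 0" and g: "g \<in> borel_measurable \<mu>" "\<And>x. x \<in> torus \<Longrightarrow> norm (g x) \<le> B"
  shows "norm (fourier_coeff g m * ek m y - (cauchy_mean M m g y - cauchy_mean M (m + 1) g y)) \<le> B / sqrt (real M)"
proof -
  have B0: "B \<ge> 0" using g(2)[of 0] by (auto simp: torus_def intro: order_trans[OF norm_ge_zero])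
  define c where "c k = norm (fourier_coeff g (m + int (Suc k)))" for k
  have "2 * pi * (\<Sum>k\<in>(\<lambda>k. m + int (Suc k)) ` {..<M}. (norm (fourier_coeff g k))^2) \<le> energy g"
    by (rule bessel) (use g in auto)
  also have "\<dots> \<le> (LINT x|\<mu>. B^2)"
    using g by (intro integral_mono integrable_torus_bounded[where B = "B^2"]) (auto intro: power_mono)
  also have "\<dots> = 2 * pi * B^2" by (simp add: measure_space_torus)
  finally have c2: "(\<Sum>k<M. (c k)^2) \<le> B^2"
    by (subst (asm) sum.reindex) (auto simp: inj_on_def c_def)
  have "(\<Sum>k<M. c k)^2 \<le> (\<Sum>k<M. (c k)^2) * (\<Sum>k<M. 1^2)"
    using Cauchy_Schwarz_ineq_sum[of c "\<lambda>_. 1" "{..<M}"] by simp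
  also have "\<dots> \<le> B^2 * real M" using c2 by (simp add: mult_right_mono)
  also have "\<dots> = (B * sqrt (real M))^2" by (simp add: power_mult_distrib)
  finally have "(\<Sum>k<M. c k) \<le> B * sqrt (real M)" by (rule power2_le_imp_le) (use B0 in auto)
  moreover have "norm (\<Sum>k<M. fourier_coeff g (m + int (Suc k)) * ek (m + int (Suc k)) y) \<le> (\<Sum>k<M. c k)"
    unfolding c_def by (intro sum_norm_le) (simp add: norm_mult)
  ultimately have "norm (\<Sum>k<M. fourier_coeff g (m + int (Suc k)) * ek (m + int (Suc k)) y) / real M \<le> B * sqrt (real M) / real M"
    by (intro divide_right_mono) auto
  also have "\<dots> = B / sqrt (real M)" using assms(1) by (simp add: field_simps)
  finally show ?thesis unfolding cauchy_mean_step[OF assms(1)] by (simp add: norm_divide)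
qed

lemma sum_int_telescope:
  fixes G :: "int \<Rightarrow> complex"
  shows "(\<Sum>m = - int n..int n. G m - G (m + 1)) = G (- int n) - G (int n + 1)"
proof (induction n)
  case (Suc n)
  show ?case unfolding sum_int_symmetric_Suc Suc.IH by (simp add: algebra_simps)
qed simp

text \<open>Passing from -n to n + 1 takes 2 n + 1 unit steps. The factor is harmless because M is
  chosen after n and B.\<close>

lemma partial_sum_cauchy_mean_error:
  assumes "M > 0" and g: "g \<in> borel_measurable \<mu>" "\<And>x. x \<in> torus \<Longrightarrow> norm (g x) \<le> B"
  shows "norm (fourier_partial_sum n g y - (cauchy_mean M (- int n) g y - cauchy_mean M (int n + 1) g y))
    \<le> (2 * real n + 1) * (B / sqrt (real M))"
proof -
  have "fourier_partial_sum n g y - (cauchy_mean M (- int n) g y - cauchy_mean M (int n + 1) g y)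
    = (\<Sum>m = - int n..int n. fourier_coeff g m * ek m y - (cauchy_mean M m g y - cauchy_mean M (m + 1) g y))"
    using sum_int_telescope[where G = "\<lambda>m. cauchy_mean M m g y"]
    by (simp add: fourier_partial_sum_ek sum_subtractf)
  also have "norm \<dots> \<le> (\<Sum>m = - int n..int n. B / sqrt (real M))"
    by (intro sum_norm_le cauchy_mean_step_bound assms)
  also have "\<dots> = (2 * real n + 1) * (B / sqrt (real M))" by simp
  finally show ?thesis .
qed

subsection \<open>Maximal averages and lacunary sums\<close>

lemma sum_power_le_geometric:
  fixes r :: real
  assumes "finite A" "inj_on g A" "0 \<le> r" "r < 1"
  shows "(\<Sum>j\<in>A. r ^ g j) \<le> 1 / (1 - r)"
proof -
  have "(\<Sum>j\<in>A. r ^ g j) = (\<Sum>l\<in>g ` A. r ^ l)" using assms by (simp add: sum.reindex)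
  also have "\<dots> \<le> (\<Sum>l. r ^ l)" using assms by (intro sum_le_suminf) (auto intro: summable_geometric)
  also have "\<dots> = 1 / (1 - r)" using assms by (intro suminf_geometric) auto
  finally show ?thesis .
qed

lemma inverse_squares_sum_le: "(\<Sum>m = 1..J. 1 / (real m)^2) \<le> 2"
proof -
  \<comment> \<open>The sharper bound is the one that telescopes.\<close>
  have "(\<Sum>m = 1..J. 1 / (real m)^2) \<le> 2 - 1 / real J" if "J \<ge> 1"
    using that
  proof (induction J rule: dec_induct)
    case (step J)
    then have J: "real J > 0" by simp
    have "1 / (real J + 1)^2 \<le> 1 / (real J * (real J + 1))"
      using J by (intro divide_left_mono mult_pos_pos zero_less_power) (auto simp: power2_eq_square algebra_simps)
    also have "\<dots> = 1 / real J - 1 / (real J + 1)" using J by (simp add: divide_simps)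
    finally show ?case using step.IH by (simp add: add.commute)
  qed simp
  then show ?thesis by (cases "J \<ge> 1") (auto intro: order_trans)
qed

lemma norm_add_square_le: "(norm (a + b))^2 \<le> 2 * (norm a)^2 + 2 * (norm (b :: 'a::real_normed_vector))^2"
proof -
  have "(norm (a + b))^2 \<le> (norm a + norm b)^2" by (intro power_mono norm_triangle_ineq) auto
  also have "\<dots> \<le> 2 * (norm a)^2 + 2 * (norm b)^2"
    using zero_le_power2[of "norm a - norm b"] by (simp add: power2_eq_square algebra_simps)
  finally show ?thesis .
qed

lemma norm_sum_square_le: "(norm (\<Sum>i\<in>I. a i))^2 \<le> real (card I) * (\<Sum>i\<in>I. (norm (a i :: 'a::real_normed_vector))^2)"
proof -
  have "(norm (\<Sum>i\<in>I. a i))^2 \<le> (\<Sum>i\<in>I. norm (a i))^2" by (intro power_mono norm_sum) auto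
  also have "\<dots> \<le> (\<Sum>i\<in>I. (norm (a i))^2) * (\<Sum>i\<in>I. 1^2)"
    using Cauchy_Schwarz_ineq_sum[of "\<lambda>i. norm (a i)" "\<lambda>_. 1" I] by simp
  finally show ?thesis by (simp add: mult.commute)
qed

text \<open>The averages are controlled along the squares \<open>m^2\<close>, and the gap between consecutive
  squares is short enough to be estimated trivially.\<close>

lemma maximal_average_square:
  fixes Y :: "nat \<Rightarrow> 'a \<Rightarrow> complex"
  assumes int: "\<And>F. finite F \<Longrightarrow> F \<subseteq> {1..} \<Longrightarrow> integrable M (\<lambda>x. (norm (\<Sum>j\<in>F. Y j x))^2)"
    and bound: "\<And>F. finite F \<Longrightarrow> F \<subseteq> {1..} \<Longrightarrow> (LINT x|M. (norm (\<Sum>j\<in>F. Y j x))^2) \<le> A * real (card F)"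
  obtains D where "integrable M D" "\<And>x. 0 \<le> D x" "(LINT x|M. D x) \<le> 20 * A"
    "\<And>x N. 1 \<le> N \<Longrightarrow> N \<le> J \<Longrightarrow> (norm ((\<Sum>j = 1..N. Y j x) / of_nat N))^2 \<le> D x"
proof -
  \<comment> \<open>For m^2 <= N <= m^2 + 2 m the numerator dominates the squared sum up to N: the
    sum up to m^2 is kept, and the at most 2 m further terms are treated by Cauchy--Schwarz. The
    denominator is at most N^2.\<close>
  define d where "d m x = (2 * (norm (\<Sum>j = 1..m^2. Y j x))^2
      + 4 * real m * (\<Sum>j = m^2 + 1..m^2 + 2 * m. (norm (Y j x))^2)) / (real m) ^ 4" for m x
  define D where "D x = (\<Sum>m = 1..J. d m x)" for x
  have A0: "0 \<le> A"
  proof -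
    have "0 \<le> (LINT x|M. (norm (\<Sum>j\<in>{1}. Y j x))^2)" by (intro integral_nonneg_AE) auto
    also have "\<dots> \<le> A" using bound[of "{1}"] by simp
    finally show ?thesis .
  qed
  have int1: "integrable M (\<lambda>x. (norm (Y j x))^2)" and bound1: "(LINT x|M. (norm (Y j x))^2) \<le> A" if "j \<ge> 1" for j
    using int[of "{j}"] bound[of "{j}"] that by auto
  have int2: "integrable M (\<lambda>x. (norm (\<Sum>j = 1..N. Y j x))^2)" for N by (intro int) auto
  have intm: "integrable M (\<lambda>x. d m x)" for m
    unfolding d_def using int1 int2 by (intro Bochner_Integration.integrable_add integrable_mult_right Bochner_Integration.integrable_sum integrable_divide) auto
  have "integrable M D" unfolding D_def using intm by (rule Bochner_Integration.integrable_sum)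
  moreover have "0 \<le> D x" for x unfolding D_def d_def by (intro sum_nonneg divide_nonneg_nonneg add_nonneg_nonneg mult_nonneg_nonneg) auto
  moreover have "(LINT x|M. D x) \<le> 20 * A"
  proof -
    have "(LINT x|M. D x) = (\<Sum>m = 1..J. (LINT x|M. d m x))"
      unfolding D_def using intm by (rule Bochner_Integration.integral_sum)
    \<comment> \<open>The constant is 10 = 2 + 4 * 2; summing the inverse squares doubles
      it.\<close>
    also have "\<dots> \<le> (\<Sum>m = 1..J. 10 * A * (1 / (real m)^2))"
    proof (intro sum_mono)
      fix m assume "m \<in> {1..J}"
      then have m: "real m > 0" by auto
      have "(LINT x|M. d m x)
        = (2 * (LINT x|M. (norm (\<Sum>j = 1..m^2. Y j x))^2)
          + 4 * real m * (\<Sum>j = m^2 + 1..m^2 + 2 * m. (LINT x|M. (norm (Y j x))^2))) / (real m) ^ 4"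
        unfolding d_def using int1 int2 by (subst integral_divide_zero, subst Bochner_Integration.integral_add) auto
      also have "\<dots> \<le> (2 * (A * (real m)^2) + 4 * real m * (\<Sum>j = m^2 + 1..m^2 + 2 * m. A)) / (real m) ^ 4"
        using bound[of "{1..m^2}"] bound1 m
        by (intro divide_right_mono add_mono mult_left_mono sum_mono) auto
      also have "\<dots> = 10 * A * (1 / (real m)^2)"
        using m by (simp add: divide_simps) (simp add: power2_eq_square power4_eq_xxxx algebra_simps)
      finally show "(LINT x|M. d m x) \<le> 10 * A * (1 / (real m)^2)" .
    qed
    also have "\<dots> = 10 * A * (\<Sum>m = 1..J. 1 / (real m)^2)" by (simp only: sum_distrib_left)
    also have "\<dots> \<le> 10 * A * 2" using A0 by (intro mult_left_mono inverse_squares_sum_le) auto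
    finally show ?thesis by simp
  qed
  moreover have "(norm ((\<Sum>j = 1..N. Y j x) / of_nat N))^2 \<le> D x" if N: "1 \<le> N" "N \<le> J" for x N
  proof -
    define m where "m = floor_sqrt N"
    have mN: "m^2 \<le> N" "N < (Suc m)^2" unfolding m_def by (rule floor_sqrt_power2_le, rule Suc_floor_sqrt_power2_gt)
    have m1: "m \<ge> 1" using mN N by (cases m) auto
    have mJ: "m \<le> J" using mN(1) N power2_nat_le_imp_le by (meson le_trans)
    have Nm: "N \<le> m^2 + 2 * m" using mN(2) by (simp add: power2_eq_square)
    have m0: "real m > 0" using m1 by simp
    have m2N: "(real m)^2 \<le> real N" using mN(1) by (metis of_nat_le_iff of_nat_power)
    have split: "{1..N} = {1..m^2} \<union> {m^2 + 1..N}" using mN by auto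
    have "(norm (\<Sum>j = 1..N. Y j x))^2 \<le> 2 * (norm (\<Sum>j = 1..m^2. Y j x))^2 + 2 * (norm (\<Sum>j = m^2 + 1..N. Y j x))^2"
      unfolding split by (subst sum.union_disjoint) (auto intro: norm_add_square_le)
    also have "\<dots> \<le> 2 * (norm (\<Sum>j = 1..m^2. Y j x))^2 + 2 * (real (2 * m) * (\<Sum>j = m^2 + 1..m^2 + 2 * m. (norm (Y j x))^2))"
    proof (intro add_left_mono mult_left_mono)
      have "(norm (\<Sum>j = m^2 + 1..N. Y j x))^2 \<le> real (card {m^2 + 1..N}) * (\<Sum>j = m^2 + 1..N. (norm (Y j x))^2)"
        by (rule norm_sum_square_le)
      also have "\<dots> \<le> real (2 * m) * (\<Sum>j = m^2 + 1..m^2 + 2 * m. (norm (Y j x))^2)"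
        using Nm by (intro mult_mono sum_mono2) (auto intro: sum_nonneg)
      finally show "(norm (\<Sum>j = m^2 + 1..N. Y j x))^2 \<le> real (2 * m) * (\<Sum>j = m^2 + 1..m^2 + 2 * m. (norm (Y j x))^2)" .
    qed auto
    finally have 1: "(norm (\<Sum>j = 1..N. Y j x))^2 \<le> 2 * (norm (\<Sum>j = 1..m^2. Y j x))^2
        + 4 * real m * (\<Sum>j = m^2 + 1..m^2 + 2 * m. (norm (Y j x))^2)" by simp
    have "(real m) ^ 4 = ((real m)^2)^2" by simp
    also have "\<dots> \<le> (real N)^2" using m2N by (intro power_mono) auto
    finally have 2: "(real m) ^ 4 \<le> (real N)^2" .
    have "(norm ((\<Sum>j = 1..N. Y j x) / of_nat N))^2 = (norm (\<Sum>j = 1..N. Y j x))^2 / (real N)^2"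
      by (simp add: norm_divide power_divide)
    also have "\<dots> \<le> d m x"
      unfolding d_def using 1 2 m0 by (intro frac_le) (auto intro!: add_nonneg_nonneg mult_nonneg_nonneg sum_nonneg)
    also have "\<dots> \<le> D x"
      unfolding D_def d_def using m1 mJ
      by (intro member_le_sum divide_nonneg_nonneg add_nonneg_nonneg mult_nonneg_nonneg sum_nonneg) auto
    finally show ?thesis .
  qed
  ultimately show ?thesis using that by blast
qed

section \<open>Geometric sums along a lacunary sequence\<close>

locale lacunary_sequence =
  fixes n :: "nat \<Rightarrow> nat" and q :: real
  assumes q: "q > 1" and step: "\<And>j. j \<ge> 1 \<Longrightarrow> real (n (j + 1)) \<ge> q * real (n j)"
    and pos: "\<And>j. j \<ge> 1 \<Longrightarrow> n j > 0"
begin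

text \<open>The sum of the geometric series with ratio 1 / q.\<close>

definition ratio_sum :: real where "ratio_sum = q / (q - 1)"

text \<open>Length, relative to n_j, of the frequency blocks in \<open>low_part\<close>: short
  enough for the blocks of different j to be disjoint.\<close>

definition gap :: real where "gap = 1 - 1 / q"

text \<open>Here 372 = 12 + 180 + 180 stems from the neighbourhoods of the intervals and the two
  averaged low parts, 96 pi from \<open>far\<close>, and 238 = 22 + 144 + 36 + 36 and 288 = 144 +
  144 from the square summable errors.\<close>

definition weak_const :: real where
  "weak_const = 372 + 96 * pi + (238 + 288 / gap^2) * ratio_sum"

lemma ratio_sum_pos: "ratio_sum > 0" and gap_pos: "gap > 0"
  using q by (simp_all add: ratio_sum_def gap_def)

lemma power_growth:
  assumes "1 \<le> i" "i \<le> j"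
  shows "q ^ (j - i) * real (n i) \<le> real (n j)"
  using assms(2)
proof (induction j rule: dec_induct)
  case (step k)
  have "q ^ (Suc k - i) * real (n i) = q * (q ^ (k - i) * real (n i))"
    using step by (simp add: Suc_diff_le)
  also have "\<dots> \<le> q * real (n k)" using step q by simp
  also have "\<dots> \<le> real (n (Suc k))" using lacunary_sequence.step[OF lacunary_sequence_axioms, of k] step assms(1) by simp
  finally show ?case .
qed simp

lemma growth:
  assumes "1 \<le> i" "i < j"
  shows "q * real (n i) \<le> real (n j)"
proof -
  have "q ^ 1 \<le> q ^ (j - i)" using assms q by (intro power_increasing) auto
  then have "q * real (n i) \<le> q ^ (j - i) * real (n i)" by (intro mult_right_mono) auto
  also have "\<dots> \<le> real (n j)" using power_growth[OF assms(1)] assms(2) by simp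
  finally show ?thesis .
qed

text \<open>If i is the first index with n_i >= x, then x / n_j is at most q^-(j - i); being at most
  1, it dominates its square. It will be used with x a frequency and with x = 1 / |I|.\<close>

lemma sum_above:
  assumes x: "x \<ge> 0"
  shows "(\<Sum>j | j \<in> {1..J} \<and> x \<le> real (n j). (x / real (n j))^2) \<le> ratio_sum"
proof -
  define A where "A = {j \<in> {1..J}. x \<le> real (n j)}"
  have fin: "finite A" unfolding A_def by auto
  show ?thesis
  proof (cases "A = {}")
    case True
    then show ?thesis using ratio_sum_pos unfolding A_def[symmetric] by simp
  next
    case False
    define i where "i = Min A"
    have iA: "i \<in> A" unfolding i_def using fin False by simp
    have ile: "i \<le> j" if "j \<in> A" for j unfolding i_def using fin that by simp
    have "(x / real (n j))^2 \<le> (1 / q) ^ (j - i)" if j: "j \<in> A" for j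
    proof -
      have g: "q ^ (j - i) * real (n i) \<le> real (n j)"
        using power_growth iA ile[OF j] unfolding A_def by auto
      have nj: "real (n j) > 0" using pos j unfolding A_def by auto
      have "x * q ^ (j - i) \<le> real (n i) * q ^ (j - i)" using iA q unfolding A_def by (intro mult_right_mono) auto
      with g have "x * q ^ (j - i) \<le> real (n j)" by (simp add: mult.commute)
      then have 1: "x / real (n j) \<le> (1 / q) ^ (j - i)" using nj q by (simp add: field_simps power_one_over)
      have 2: "x / real (n j) \<le> 1" using j nj unfolding A_def by simp
      have "(x / real (n j))^2 \<le> x / real (n j) * 1"
        unfolding power2_eq_square using 2 x by (intro mult_left_mono) auto
      then show ?thesis using 1 by simp
    qed
    then have "(\<Sum>j\<in>A. (x / real (n j))^2) \<le> (\<Sum>j\<in>A. (1 / q) ^ (j - i))" by (rule sum_mono)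
    also have "\<dots> \<le> 1 / (1 - 1 / q)"
      using q ile by (intro sum_power_le_geometric fin) (auto simp: inj_on_def dest!: ile)
    also have "\<dots> = ratio_sum" using q by (simp add: ratio_sum_def field_simps)
    finally show ?thesis unfolding A_def by simp
  qed
qed

text \<open>The mirror image: the ratios decrease geometrically downwards from the last admissible
  index.\<close>

lemma sum_below:
  assumes s: "s \<ge> 0"
  shows "(\<Sum>j | j \<in> {1..J} \<and> real (n j) * s \<le> 1. (real (n j) * s)^2) \<le> ratio_sum"
proof -
  define A where "A = {j \<in> {1..J}. real (n j) * s \<le> 1}"
  have fin: "finite A" unfolding A_def by auto
  show ?thesis
  proof (cases "A = {}")
    case True
    then show ?thesis using ratio_sum_pos unfolding A_def[symmetric] by simp
  next
    case False
    define i where "i = Max A"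
    have iA: "i \<in> A" unfolding i_def using fin False by simp
    have ile: "j \<le> i" if "j \<in> A" for j unfolding i_def using fin that by simp
    have "(real (n j) * s)^2 \<le> (1 / q) ^ (i - j)" if j: "j \<in> A" for j
    proof -
      have g: "q ^ (i - j) * real (n j) \<le> real (n i)"
        using power_growth j ile[OF j] unfolding A_def by auto
      have "q ^ (i - j) * real (n j) * s \<le> real (n i) * s" using g s by (rule mult_right_mono)
      also have "\<dots> \<le> 1" using iA unfolding A_def by simp
      finally have 1: "real (n j) * s \<le> (1 / q) ^ (i - j)" using q by (simp add: field_simps power_one_over)
      have 2: "real (n j) * s \<le> 1" using j unfolding A_def by simp
      have "(real (n j) * s)^2 \<le> real (n j) * s * 1"
        unfolding power2_eq_square using 2 s by (intro mult_left_mono) auto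
      then show ?thesis using 1 by simp
    qed
    then have "(\<Sum>j\<in>A. (real (n j) * s)^2) \<le> (\<Sum>j\<in>A. (1 / q) ^ (i - j))" by (rule sum_mono)
    also have "\<dots> \<le> 1 / (1 - 1 / q)"
      using q ile by (intro sum_power_le_geometric fin) (auto simp: inj_on_def dest!: ile)
    also have "\<dots> = ratio_sum" using q by (simp add: ratio_sum_def field_simps)
    finally show ?thesis unfolding A_def by simp
  qed
qed

end

subsection \<open>Bumps and Calderon--Zygmund intervals\<close>

text \<open>Half-open, so that the two halves of a bisected interval are disjoint.\<close>

definition ivl :: "real \<times> real \<Rightarrow> real set" where
  "ivl I = {fst I..<snd I}"

definition len :: "real \<times> real \<Rightarrow> real" where
  "len I = snd I - fst I"

text \<open>The parabola over I that vanishes at both endpoints and has mean one over I; its maximum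
  is 3/2.\<close>

definition bump :: "real \<times> real \<Rightarrow> real \<Rightarrow> real" where
  "bump I x = indicator (ivl I) x * (6 * (x - fst I) * (snd I - x) / (len I)^2)"

definition bump_deriv :: "real \<times> real \<Rightarrow> real \<Rightarrow> real" where
  "bump_deriv I x = indicator (ivl I) x * (6 * (fst I + snd I - 2 * x) / (len I)^2)"

definition torus_interval :: "real \<times> real \<Rightarrow> bool" where
  "torus_interval I \<longleftrightarrow> - pi \<le> fst I \<and> fst I < snd I \<and> snd I \<le> pi"

lemma torus_intervalD:
  assumes "torus_interval I"
  shows "- pi \<le> fst I" "fst I < snd I" "snd I \<le> pi" "len I > 0" "ivl I \<subseteq> torus"
  using assms by (auto simp: torus_interval_def len_def ivl_def torus_def)

lemma bump_outside [simp]: "x \<notin> ivl I \<Longrightarrow> bump I x = 0"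
  and bump_deriv_outside [simp]: "x \<notin> ivl I \<Longrightarrow> bump_deriv I x = 0"
  by (simp_all add: bump_def bump_deriv_def)

lemma bump_bounds:
  assumes "torus_interval I"
  shows "0 \<le> bump I x" "bump I x \<le> 3 / 2"
proof -
  have l: "len I > 0" using torus_intervalD[OF assms] by simp
  show "0 \<le> bump I x" by (auto simp: bump_def ivl_def indicator_def)
  have "4 * ((x - fst I) * (snd I - x)) \<le> (len I)^2"
    using zero_le_power2[of "(x - fst I) - (snd I - x)"] by (simp add: len_def power2_eq_square algebra_simps)
  then have "6 * (x - fst I) * (snd I - x) \<le> 3 / 2 * (len I)^2"
    unfolding mult.assoc by linarith
  then have "6 * (x - fst I) * (snd I - x) / (len I)^2 \<le> 3 / 2"
    using l by (simp add: pos_divide_le_eq)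
  then show "bump I x \<le> 3 / 2"
    by (cases "x \<in> ivl I") (simp_all add: bump_def)
qed

lemma bump_deriv_bound:
  assumes "torus_interval I"
  shows "\<bar>bump_deriv I x\<bar> \<le> 6 / len I"
proof (cases "x \<in> ivl I")
  case True
  have l: "len I > 0" using torus_intervalD[OF assms] by simp
  have "\<bar>fst I + snd I - 2 * x\<bar> \<le> len I" using True by (auto simp: ivl_def len_def)
  then show ?thesis using True l by (simp add: bump_deriv_def abs_mult divide_simps power2_eq_square)
qed (use torus_intervalD[OF assms] in simp)

lemma borel_measurable_bump [measurable]: "bump I \<in> borel_measurable \<mu>"
proof -
  have "(\<lambda>x. indicator {fst I..<snd I} x *\<^sub>R (6 * (x - fst I) * (snd I - x) / (len I)^2)) \<in> borel_measurable \<mu>"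
    by (rule borel_measurable_torus_indicator_continuous) (cases "len I = 0"; auto intro!: continuous_intros)
  then show ?thesis by (simp add: bump_def[abs_def] ivl_def)
qed

lemma borel_measurable_bump_deriv [measurable]: "bump_deriv I \<in> borel_measurable \<mu>"
proof -
  have "(\<lambda>x. indicator {fst I..<snd I} x *\<^sub>R (6 * (fst I + snd I - 2 * x) / (len I)^2)) \<in> borel_measurable \<mu>"
    by (rule borel_measurable_torus_indicator_continuous) (cases "len I = 0"; auto intro!: continuous_intros)
  then show ?thesis by (simp add: bump_deriv_def[abs_def] ivl_def)
qed

lemma borel_measurable_indicator_ivl [measurable]: "(indicator (ivl I) :: real \<Rightarrow> real) \<in> borel_measurable \<mu>"
  using borel_measurable_torus_indicator_continuous[of "fst I" "snd I" "\<lambda>_. 1 :: real"] by (simp add: ivl_def)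

lemma integral_indicator_ivl:
  assumes "torus_interval I"
  shows "(LINT x|\<mu>. indicator (ivl I) x :: real) = len I"
  using integral_torus_interval[of "fst I" "snd I" "\<lambda>_. 1 :: real"] torus_intervalD[OF assms]
  by (simp add: ivl_def len_def)

lemma integrable_indicator_ivl: "integrable \<mu> (indicator (ivl I) :: real \<Rightarrow> real)"
  by (intro integrable_torus_bounded[where B = 1]) auto

lemma integral_bump:
  assumes "torus_interval I"
  shows "(LINT x|\<mu>. bump I x) = len I"
proof -
  define a b L where "a = fst I" and "b = snd I" and "L = len I"
  have I: "- pi \<le> a" "a < b" "b \<le> pi" "L > 0" "L = b - a"
    using torus_intervalD[OF assms] by (auto simp: a_def b_def L_def len_def)
  have "(LINT x|\<mu>. bump I x) = (LINT x|\<mu>. indicator {a..<b} x *\<^sub>R (6 * (x - a) * (b - x) / L^2))"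
    by (simp add: bump_def ivl_def a_def b_def L_def)
  also have "\<dots> = integral {a..b} (\<lambda>x. 6 * (x - a) * (b - x) / L^2)"
    using I by (intro integral_torus_interval) (auto intro!: continuous_intros)
  also have "\<dots> = L"
  proof (rule integral_unique)
    define F where "F x = (3 * L * (x - a)^2 - 2 * (x - a) ^ 3) / L^2" for x
    have "((\<lambda>x. 6 * (x - a) * (b - x) / L^2) has_integral (F b - F a)) {a..b}"
    proof (rule fundamental_theorem_of_calculus)
      fix x assume "x \<in> {a..b}"
      have b: "b = a + L" using I by simp
      have "(F has_real_derivative (6 * (x - a) * (b - x) / L^2)) (at x within {a..b})"
        unfolding F_def using I(4)
        by (auto intro!: derivative_eq_intros simp: b power2_eq_square divide_simps) (simp add: algebra_simps)
      then show "(F has_vector_derivative (6 * (x - a) * (b - x) / L^2)) (at x within {a..b})"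
        by (simp add: has_real_derivative_iff_has_vector_derivative)
    qed (use I in auto)
    moreover have "F b - F a = L"
    proof -
      have bL: "b - a = L" using I by simp
      have "F b = (3 * L * L^2 - 2 * L ^ 3) / L^2" unfolding F_def bL ..
      also have "\<dots> = L" using I(4) by (simp add: power2_eq_square power3_eq_cube)
      finally show ?thesis by (simp add: F_def)
    qed
    ultimately show "((\<lambda>x. 6 * (x - a) * (b - x) / L^2) has_integral L) {a..b}" by simp
  qed
  finally show ?thesis by (simp add: L_def)
qed

text \<open>Integration by parts; the boundary terms vanish because the bump is zero at both ends of
  I.\<close>

lemma fourier_coeff_bump_deriv:
  assumes "torus_interval I"
  shows "fourier_coeff (\<lambda>x. of_real (bump_deriv I x)) k = \<i> * of_int k * fourier_coeff (\<lambda>x. of_real (bump I x)) k"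
proof -
  define a b L where "a = fst I" and "b = snd I" and "L = len I"
  have I: "- pi \<le> a" "a < b" "b \<le> pi" "L > 0" "L = b - a"
    using torus_intervalD[OF assms] by (auto simp: a_def b_def L_def len_def)
  define t where "t x = 6 * (x - a) * (b - x) / L^2" for x
  define t' where "t' x = 6 * (a + b - 2 * x) / L^2" for x
  have tab: "t a = 0" "t b = 0" by (simp_all add: t_def)
  have c1: "continuous_on {a..b} (\<lambda>x. of_real (t x) * cnj (ek k x))"
    and c2: "continuous_on {a..b} (\<lambda>x. of_real (t' x) * cnj (ek k x))"
    using I unfolding t_def t'_def by (auto intro!: continuous_intros)
  have "(t has_real_derivative t' x) (at x within {a..b})" for x
    unfolding t_def t'_def using I(4) by (auto intro!: derivative_eq_intros simp: field_simps)
  then have td: "((\<lambda>x. complex_of_real (t x)) has_vector_derivative of_real (t' x)) (at x within {a..b})" for x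
    by (intro has_vector_derivative_of_real) (simp add: has_real_derivative_iff_has_vector_derivative)
  have "((\<lambda>x. of_real (t x) * ek (- k) x) has_vector_derivative
      (of_real (t x) * (\<i> * of_int (- k) * ek (- k) x) + of_real (t' x) * ek (- k) x)) (at x within {a..b})" for x
    by (rule has_vector_derivative_mult[OF td ek_has_vector_derivative])
  then have "((\<lambda>x. of_real (t x) * (\<i> * of_int (- k) * ek (- k) x) + of_real (t' x) * ek (- k) x)
      has_integral (of_real (t b) * ek (- k) b - of_real (t a) * ek (- k) a)) {a..b}"
    using I by (intro fundamental_theorem_of_calculus) auto
  then have "((\<lambda>x. of_real (t' x) * cnj (ek k x) - \<i> * of_int k * (of_real (t x) * cnj (ek k x)))
      has_integral 0) {a..b}"
    by (simp add: tab ek_uminus algebra_simps)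
  then have "integral {a..b} (\<lambda>x. of_real (t' x) * cnj (ek k x) - \<i> * of_int k * (of_real (t x) * cnj (ek k x))) = 0"
    by (rule integral_unique)
  then have eq: "integral {a..b} (\<lambda>x. of_real (t' x) * cnj (ek k x)) = \<i> * of_int k * integral {a..b} (\<lambda>x. of_real (t x) * cnj (ek k x))"
    using integrable_continuous_interval[OF c1] integrable_continuous_interval[OF c2]
    by (subst (asm) Henstock_Kurzweil_Integration.integral_diff) (auto intro: integrable_on_mult_right)
  have "(LINT x|\<mu>. of_real (bump I x) * cnj (ek k x)) = integral {a..b} (\<lambda>x. of_real (t x) * cnj (ek k x))"
    using integral_torus_interval[OF I(1,3) c1]
    by (simp add: bump_def t_def ivl_def a_def b_def L_def scaleR_conv_of_real of_real_indicator mult_ac)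
  moreover have "(LINT x|\<mu>. of_real (bump_deriv I x) * cnj (ek k x)) = integral {a..b} (\<lambda>x. of_real (t' x) * cnj (ek k x))"
    using integral_torus_interval[OF I(1,3) c2]
    by (simp add: bump_deriv_def t'_def ivl_def a_def b_def L_def scaleR_conv_of_real of_real_indicator mult_ac)
  ultimately show ?thesis using eq by (simp add: fourier_coeff_ek)
qed

text \<open>At each point at most one summand survives. The elimination form hands the two cases to
  the lemmas on disjoint sums below.\<close>

lemma sum_disjoint_support:
  fixes \<phi> :: "real \<times> real \<Rightarrow> real \<Rightarrow> 'a::real_normed_vector"
  assumes "finite S" "disjoint_family_on ivl S" "\<And>I x. I \<in> S \<Longrightarrow> x \<notin> ivl I \<Longrightarrow> \<phi> I x = 0"
  obtains "\<And>I. I \<in> S \<Longrightarrow> \<phi> I x = 0" | I where "I \<in> S" "x \<in> ivl I" "\<And>J. J \<in> S \<Longrightarrow> J \<noteq> I \<Longrightarrow> \<phi> J x = 0"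
    "\<And>J. J \<in> S \<Longrightarrow> J \<noteq> I \<Longrightarrow> x \<notin> ivl J"
proof (cases "\<exists>I\<in>S. x \<in> ivl I")
  case True
  then obtain I where I: "I \<in> S" "x \<in> ivl I" by blast
  then have "x \<notin> ivl J" if "J \<in> S" "J \<noteq> I" for J
    using that assms(2) by (auto simp: disjoint_family_on_def)
  then show ?thesis using I assms(3) that(2) by blast
next
  case False
  then show ?thesis using assms(3) that(1) by blast
qed

lemma norm_disjoint_sum_square:
  fixes \<phi> :: "real \<times> real \<Rightarrow> real \<Rightarrow> 'a::real_normed_vector"
  assumes "finite S" "disjoint_family_on ivl S" "\<And>I x. I \<in> S \<Longrightarrow> x \<notin> ivl I \<Longrightarrow> \<phi> I x = 0"
  shows "(norm (\<Sum>I\<in>S. \<phi> I x))^2 = (\<Sum>I\<in>S. (norm (\<phi> I x))^2)"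
proof (rule sum_disjoint_support[where x = x, OF assms])
  fix I assume I: "I \<in> S" and z: "\<And>J. J \<in> S \<Longrightarrow> J \<noteq> I \<Longrightarrow> \<phi> J x = 0"
  have "(\<Sum>I\<in>S. \<phi> I x) = \<phi> I x" "(\<Sum>I\<in>S. (norm (\<phi> I x))^2) = (norm (\<phi> I x))^2"
    using z by (auto simp: sum.remove[OF assms(1) I])
  then show ?thesis by simp
next
  assume "\<And>I. I \<in> S \<Longrightarrow> \<phi> I x = 0"
  then have "\<forall>I\<in>S. \<phi> I x = 0" by blast
  then show ?thesis by simp
qed

lemma norm_disjoint_sum_le:
  fixes \<phi> :: "real \<times> real \<Rightarrow> real \<Rightarrow> 'a::real_normed_vector"
  assumes "finite S" "disjoint_family_on ivl S" "\<And>I x. I \<in> S \<Longrightarrow> x \<notin> ivl I \<Longrightarrow> \<phi> I x = 0"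
    and "0 \<le> B" "\<And>I. I \<in> S \<Longrightarrow> norm (\<phi> I x) \<le> B"
  shows "norm (\<Sum>I\<in>S. \<phi> I x) \<le> B"
proof (rule sum_disjoint_support[where x = x, OF assms(1-3)])
  fix I assume I: "I \<in> S" and z: "\<And>J. J \<in> S \<Longrightarrow> J \<noteq> I \<Longrightarrow> \<phi> J x = 0"
  have "(\<Sum>I\<in>S. \<phi> I x) = \<phi> I x" using z by (auto simp: sum.remove[OF assms(1) I])
  then show ?thesis using assms(5)[OF I] by simp
qed (use assms(4) in auto)

text \<open>Disjoint supports leave no cross terms.\<close>

lemma integral_disjoint_sum_square_le:
  fixes \<phi> :: "real \<times> real \<Rightarrow> real \<Rightarrow> complex"
  assumes "finite S" "disjoint_family_on ivl S" "\<And>I. I \<in> S \<Longrightarrow> torus_interval I"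
    and "\<And>I x. I \<in> S \<Longrightarrow> x \<notin> ivl I \<Longrightarrow> \<phi> I x = 0" "\<And>I. I \<in> S \<Longrightarrow> \<phi> I \<in> borel_measurable \<mu>"
    and B: "\<And>I x. I \<in> S \<Longrightarrow> x \<in> ivl I \<Longrightarrow> norm (\<phi> I x) \<le> B I"
  shows "(LINT x|\<mu>. (norm (\<Sum>I\<in>S. \<phi> I x))^2) \<le> (\<Sum>I\<in>S. (B I)^2 * len I)"
proof -
  have ptw: "(norm (\<phi> I x))^2 \<le> (B I)^2 * indicator (ivl I) x" if "I \<in> S" for I x
  proof (cases "x \<in> ivl I")
    case True
    then show ?thesis using B[OF that True] by (simp add: power_mono)
  qed (use assms(4)[OF that] in simp)
  have ptw': "norm ((norm (\<phi> I x))^2) \<le> (B I)^2" if "I \<in> S" for I x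
    using ptw[OF that, of x] assms(4)[OF that, of x] by (cases "x \<in> ivl I") auto
  have int: "integrable \<mu> (\<lambda>x. (norm (\<phi> I x))^2)" if "I \<in> S" for I
    using assms(5)[OF that] ptw'[OF that] by (intro integrable_torus_bounded[where B = "(B I)^2"]) auto
  have "(LINT x|\<mu>. (norm (\<Sum>I\<in>S. \<phi> I x))^2) = (LINT x|\<mu>. (\<Sum>I\<in>S. (norm (\<phi> I x))^2))"
    by (subst norm_disjoint_sum_square[OF assms(1,2,4)]) auto
  also have "\<dots> = (\<Sum>I\<in>S. energy (\<phi> I))"
    using int by (rule Bochner_Integration.integral_sum)
  also have "\<dots> \<le> (\<Sum>I\<in>S. (LINT x|\<mu>. (B I)^2 * indicator (ivl I) x))"
    using int ptw by (intro sum_mono integral_mono integrable_mult_right integrable_indicator_ivl) auto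
  also have "\<dots> = (\<Sum>I\<in>S. (B I)^2 * len I)"
    using assms(3) by (intro sum.cong refl) (simp only: integral_mult_right_zero integral_indicator_ivl)
  finally show ?thesis .
qed

lemma fourier_coeff_sum:
  assumes "\<And>i. i \<in> S \<Longrightarrow> integrable \<mu> (g i)"
  shows "fourier_coeff (\<lambda>x. \<Sum>i\<in>S. c i * g i x) k = (\<Sum>i\<in>S. c i * fourier_coeff (g i) k)"
proof -
  have "(LINT x|\<mu>. (\<Sum>i\<in>S. c i * g i x) * cnj (ek k x)) = (LINT x|\<mu>. (\<Sum>i\<in>S. c i * (g i x * cnj (ek k x))))"
    unfolding sum_distrib_right by (simp only: mult.assoc)
  also have "\<dots> = (\<Sum>i\<in>S. c i * (LINT x|\<mu>. g i x * cnj (ek k x)))"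
    using assms by (subst Bochner_Integration.integral_sum) (auto intro!: integrable_mult_right integrable_mult_cnj_ek)
  finally show ?thesis by (simp add: fourier_coeff_ek sum_distrib_left mult_ac)
qed

text \<open>Bessel's inequality for the derivative of the sum. Each summand contributes (6 / |I|)^2
  |I| = 36 / |I| times the squared coefficient.\<close>

lemma bump_sum_fourier_bound:
  assumes S: "finite S" "disjoint_family_on ivl S" "\<And>I. I \<in> S \<Longrightarrow> torus_interval I" and K: "finite K"
  shows "2 * pi * (\<Sum>k\<in>K. (of_int k)^2 * (norm (fourier_coeff (\<lambda>x. \<Sum>I\<in>S. c I * of_real (bump I x)) k))^2)
    \<le> (\<Sum>I\<in>S. 36 * (norm (c I))^2 / len I)"
proof -
  define g where "g x = (\<Sum>I\<in>S. c I * complex_of_real (bump_deriv I x))" for x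
  have b1: "norm (complex_of_real (bump I x)) \<le> 3 / 2" if "I \<in> S" for I x
    using bump_bounds[OF S(3)[OF that], of x] by simp
  have b2: "norm (complex_of_real (bump_deriv I x)) \<le> 6 / len I" if "I \<in> S" for I x
    using bump_deriv_bound[OF S(3)[OF that], of x] by simp
  have i1: "integrable \<mu> (\<lambda>x. complex_of_real (bump I x))" if "I \<in> S" for I
    using b1[OF that] by (intro integrable_torus_bounded[where B = "3 / 2"]) auto
  have i2: "integrable \<mu> (\<lambda>x. complex_of_real (bump_deriv I x))" if "I \<in> S" for I
    using b2[OF that] by (intro integrable_torus_bounded[where B = "6 / len I"]) auto
  have "fourier_coeff g k = \<i> * of_int k * fourier_coeff (\<lambda>x. \<Sum>I\<in>S. c I * of_real (bump I x)) k" for k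
    unfolding g_def using i1 i2 fourier_coeff_bump_deriv[OF S(3)]
    by (simp add: fourier_coeff_sum sum_distrib_left mult_ac)
  then have "2 * pi * (\<Sum>k\<in>K. (of_int k)^2 * (norm (fourier_coeff (\<lambda>x. \<Sum>I\<in>S. c I * of_real (bump I x)) k))^2)
      = 2 * pi * (\<Sum>k\<in>K. (norm (fourier_coeff g k))^2)"
    by (simp add: norm_mult power_mult_distrib)
  also have "\<dots> \<le> energy g"
  proof (rule bessel[OF _ _ K])
    show "g \<in> borel_measurable \<mu>" unfolding g_def by measurable
    show "norm (g x) \<le> (\<Sum>I\<in>S. norm (c I) * (6 / len I))" for x
      unfolding g_def by (intro sum_norm_le) (simp only: norm_mult, rule mult_left_mono[OF b2], auto)
  qed
  also have "\<dots> \<le> (\<Sum>I\<in>S. (norm (c I) * (6 / len I))^2 * len I)"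
    unfolding g_def using b2
    by (intro integral_disjoint_sum_square_le S) (auto simp: norm_mult simp del: norm_of_real times_divide_eq_right intro!: mult_left_mono)
  also have "\<dots> = (\<Sum>I\<in>S. 36 * (norm (c I))^2 / len I)"
    using torus_intervalD(4)[OF S(3)] by (intro sum.cong refl) (auto simp: power2_eq_square divide_simps)
  finally show ?thesis .
qed

text \<open>Bisection keeps the mean over the current interval at most \<open>lam\<close>. A half
  with larger mean is selected; its mean is at most \<open>2 * lam\<close> because its parent has
  twice its length. \<open>L\<close> counts the remaining bisections: at \<open>L = 0\<close> the
  interval is so short that \<open>\<phi>\<close> varies by at most \<open>lam\<close>, so the bound
  on the mean becomes a pointwise bound by \<open>2 * lam\<close>. Continuity thus makes the
  selection finite and replaces Lebesgue's differentiation theorem.\<close>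

lemma calderon_zygmund_step:
  fixes \<phi> :: "real \<Rightarrow> real"
  assumes cont: "continuous_on {-pi..pi} \<phi>" and "lam > 0" and nonneg: "\<And>x. x \<in> {-pi..pi} \<Longrightarrow> 0 \<le> \<phi> x"
    and osc: "\<And>x y. x \<in> {-pi..pi} \<Longrightarrow> y \<in> {-pi..pi} \<Longrightarrow> \<bar>x - y\<bar> \<le> \<delta> \<Longrightarrow> \<bar>\<phi> x - \<phi> y\<bar> \<le> lam"
  shows "- pi \<le> a \<Longrightarrow> a < b \<Longrightarrow> b \<le> pi \<Longrightarrow> b - a \<le> 2 ^ L * \<delta> \<Longrightarrow> integral {a..b} \<phi> \<le> lam * (b - a) \<Longrightarrow>
    \<exists>S. finite S \<and> disjoint_family_on ivl S \<and>
      (\<forall>I\<in>S. a \<le> fst I \<and> fst I < snd I \<and> snd I \<le> b \<and> lam * len I \<le> integral {fst I..snd I} \<phi> \<and>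
         integral {fst I..snd I} \<phi> \<le> 2 * lam * len I) \<and>
      (\<forall>x\<in>{a..<b}. x \<notin> (\<Union>I\<in>S. ivl I) \<longrightarrow> \<phi> x \<le> 2 * lam)"
proof (induction L arbitrary: a b)
  case 0
  have "\<phi> x \<le> 2 * lam" if x: "x \<in> {a..<b}" for x
  proof -
    have "integral {a..b} (\<lambda>_. \<phi> x - lam) \<le> integral {a..b} \<phi>"
    proof (rule integral_le)
      show "\<phi> integrable_on {a..b}"
        using 0 by (intro integrable_continuous_interval continuous_on_subset[OF cont]) auto
      fix y assume "y \<in> {a..b}"
      moreover from this have "\<bar>x - y\<bar> \<le> b - a" using x by auto
      ultimately show "\<phi> x - lam \<le> \<phi> y" using osc[of x y] 0 x by auto
    qed auto
    then have "(b - a) * (\<phi> x - lam) \<le> integral {a..b} \<phi>" using 0 by simp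
    also have "\<dots> \<le> (b - a) * lam" using 0(5) by (simp add: mult.commute)
    finally show ?thesis using 0 by simp
  qed
  then show ?case by (intro exI[of _ "{}"]) (auto simp: disjoint_family_on_def)
next
  case (Suc L)
  define P where "P a b S \<longleftrightarrow> finite S \<and> disjoint_family_on ivl S \<and>
      (\<forall>I\<in>S. a \<le> fst I \<and> fst I < snd I \<and> snd I \<le> b \<and> lam * len I \<le> integral {fst I..snd I} \<phi> \<and>
         integral {fst I..snd I} \<phi> \<le> 2 * lam * len I) \<and>
      (\<forall>x\<in>{a..<b}. x \<notin> (\<Union>I\<in>S. ivl I) \<longrightarrow> \<phi> x \<le> 2 * lam)" for a b S
  have half: "\<exists>S. P a' b' S" if h: "a \<le> a'" "b' \<le> b" "b' - a' = (b - a) / 2" for a' b'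
  proof (cases "integral {a'..b'} \<phi> \<le> lam * (b' - a')")
    case True
    have "- pi \<le> a'" "a' < b'" "b' \<le> pi" "b' - a' \<le> 2 ^ L * \<delta>" using h Suc.prems by auto
    from Suc.IH[OF this True] show ?thesis unfolding P_def .
  next
    case False
    have "integral {a'..b'} \<phi> \<le> integral {a..b} \<phi>"
      using h Suc.prems nonneg
      by (intro integral_subset_le integrable_continuous_interval continuous_on_subset[OF cont]) auto
    also have "\<dots> \<le> lam * (b - a)" by (rule Suc.prems(5))
    also have "\<dots> = 2 * lam * (b' - a')" unfolding h(3) by simp
    finally have "integral {a'..b'} \<phi> \<le> 2 * lam * (b' - a')" .
    moreover have "lam * (b' - a') \<le> integral {a'..b'} \<phi>" using False by linarith
    moreover have "a' < b'" using h(3) Suc.prems(2) by simp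
    ultimately have "P a' b' {(a', b')}"
      unfolding P_def by (auto simp: len_def ivl_def disjoint_family_on_def)
    then show ?thesis by blast
  qed
  define c where "c = (a + b) / 2"
  have c: "a < c" "c < b" using Suc.prems by (auto simp: c_def)
  obtain S where S: "P a c S" using half[of a c] c by (auto simp: c_def field_simps)
  obtain T where T: "P c b T" using half[of c b] c by (auto simp: c_def field_simps)
  have "ivl I \<inter> ivl J = {}" if "I \<in> S" "J \<in> T" for I J
    using that S T unfolding P_def ivl_def by force
  then have "disjoint_family_on ivl (S \<union> T)"
    using S T unfolding P_def disjoint_family_on_def by blast
  moreover have "\<phi> x \<le> 2 * lam" if "x \<in> {a..<b}" "x \<notin> (\<Union>I\<in>S \<union> T. ivl I)" for x
    using that S T unfolding P_def by (cases "x < c") auto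
  ultimately have "P a b (S \<union> T)" using S T c unfolding P_def by (auto intro: less_imp_le order_trans)
  then show ?case unfolding P_def by blast
qed

lemma calderon_zygmund:
  fixes \<phi> :: "real \<Rightarrow> real"
  assumes cont: "continuous_on {-pi..pi} \<phi>" and lam: "lam > 0" and nonneg: "\<And>x. x \<in> {-pi..pi} \<Longrightarrow> 0 \<le> \<phi> x"
    and avg: "integral {-pi..pi} \<phi> \<le> lam * (2 * pi)"
  obtains S where "finite S" "disjoint_family_on ivl S" "\<And>I. I \<in> S \<Longrightarrow> torus_interval I"
    "\<And>I. I \<in> S \<Longrightarrow> lam * len I \<le> integral {fst I..snd I} \<phi>"
    "\<And>I. I \<in> S \<Longrightarrow> integral {fst I..snd I} \<phi> \<le> 2 * lam * len I"
    "\<And>x. x \<in> torus \<Longrightarrow> x \<notin> (\<Union>I\<in>S. ivl I) \<Longrightarrow> \<phi> x \<le> 2 * lam"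
proof -
  have "uniformly_continuous_on {-pi..pi} \<phi>" using cont by (intro compact_uniformly_continuous) auto
  then obtain d where d: "d > 0" "\<And>x y. x \<in> {-pi..pi} \<Longrightarrow> y \<in> {-pi..pi} \<Longrightarrow> dist y x < d \<Longrightarrow> dist (\<phi> y) (\<phi> x) < lam"
    unfolding uniformly_continuous_on_def using lam by metis
  define \<delta> where "\<delta> = d / 2"
  have osc: "\<bar>\<phi> x - \<phi> y\<bar> \<le> lam" if "x \<in> {-pi..pi}" "y \<in> {-pi..pi}" "\<bar>x - y\<bar> \<le> \<delta>" for x y
    using d(1) d(2)[of y x] that by (simp add: \<delta>_def dist_real_def)
  obtain L where L: "2 * pi / \<delta> < 2 ^ L" using real_arch_pow[of 2 "2 * pi / \<delta>"] by auto
  then have "pi - (- pi) \<le> 2 ^ L * \<delta>" using d(1) by (simp add: \<delta>_def divide_simps)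
  then obtain S where "finite S" "disjoint_family_on ivl S"
      "\<forall>I\<in>S. - pi \<le> fst I \<and> fst I < snd I \<and> snd I \<le> pi \<and> lam * len I \<le> integral {fst I..snd I} \<phi> \<and>
         integral {fst I..snd I} \<phi> \<le> 2 * lam * len I"
      "\<forall>x\<in>{-pi..<pi}. x \<notin> (\<Union>I\<in>S. ivl I) \<longrightarrow> \<phi> x \<le> 2 * lam"
    using calderon_zygmund_step[where a = "-pi" and b = pi and L = L and \<delta> = \<delta>, OF cont lam nonneg osc] avg by auto
  then show ?thesis by (intro that[of S]) (auto simp: torus_interval_def torus_def)
qed

subsection \<open>Decay away from an interval\<close>

lemma norm_one_minus_cis: "norm (1 - cis t) = 2 * \<bar>sin (t / 2)\<bar>"
proof -
  have "(norm (1 - cis t))^2 = (2 * \<bar>sin (t / 2)\<bar>)^2"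
  proof -
    have "(norm (1 - cis t))^2 = (1 - cos t)^2 + (sin t)^2" by (simp add: cmod_power2)
    also have "\<dots> = 2 - 2 * cos t"
      using sin_cos_squared_add[of t] by (simp add: power2_eq_square algebra_simps)
    also have "cos t = 1 - 2 * (sin (t / 2))^2" using cos_double_sin[of "t / 2"] by simp
    finally show ?thesis by (simp add: power_mult_distrib)
  qed
  then show ?thesis by (rule power2_eq_imp_eq) auto
qed

lemma norm_cis_diff_le: "norm (cis s - cis t) \<le> \<bar>s - t\<bar>"
proof -
  have "cis s - cis t = cis s * (1 - cis (t - s))" by (simp add: algebra_simps cis_mult)
  then have "norm (cis s - cis t) = norm (1 - cis (t - s))" by (simp add: norm_mult)
  also have "\<dots> \<le> 2 * \<bar>(t - s) / 2\<bar>" unfolding norm_one_minus_cis by (intro mult_left_mono abs_sin_x_le_abs_x) auto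
  finally show ?thesis by simp
qed

lemma norm_ek_diff_le: "norm (ek m s - ek m t) \<le> \<bar>of_int m\<bar> * \<bar>s - t\<bar>"
  using norm_cis_diff_le[of "of_int m * s" "of_int m * t"] by (simp add: ek_def abs_mult flip: right_diff_distrib)

lemma sin_ge_mult_cos:
  fixes x :: real
  assumes "0 \<le> x" "x \<le> pi"
  shows "x * cos x \<le> sin x"
proof -
  have "sin 0 - 0 * cos 0 \<le> sin x - x * cos x"
  proof (rule DERIV_nonneg_imp_nondecreasing[OF assms(1)])
    fix t assume "0 \<le> t" "t \<le> x"
    then have "0 \<le> t * sin t" using assms by (simp add: sin_ge_zero)
    moreover have "((\<lambda>x. sin x - x * cos x) has_real_derivative t * sin t) (at t)"
      by (auto intro!: derivative_eq_intros)
    ultimately show "\<exists>y. ((\<lambda>x. sin x - x * cos x) has_real_derivative y) (at t) \<and> 0 \<le> y" by blast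
  qed
  then show ?thesis by simp
qed

text \<open>Since cos y >= 0, y / 2 <= y cos^2 (y / 2); apply x cos x <= sin x at y / 2 and double
  the angle.\<close>

lemma half_abs_le_abs_sin:
  fixes x :: real
  assumes "\<bar>x\<bar> \<le> pi / 2"
  shows "\<bar>x\<bar> / 2 \<le> \<bar>sin x\<bar>"
proof -
  have *: "y / 2 \<le> sin y" if "0 \<le> y" "y \<le> pi / 2" for y :: real
  proof -
    have c: "0 \<le> cos y" "0 \<le> cos (y / 2)" using that by (auto intro!: cos_ge_zero)
    have "y / 2 \<le> y * (1 + cos y) / 2" using c that by (simp add: mult_left_mono algebra_simps)
    also have "1 + cos y = 2 * (cos (y / 2))^2" using cos_double_cos[of "y / 2"] by simp
    also have "y * (2 * (cos (y / 2))^2) / 2 = 2 * (y / 2 * cos (y / 2)) * cos (y / 2)" by (simp add: power2_eq_square)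
    also have "\<dots> \<le> 2 * sin (y / 2) * cos (y / 2)"
      using c that by (intro mult_right_mono mult_left_mono sin_ge_mult_cos) auto
    also have "\<dots> = sin y" using sin_double[of "y / 2"] by simp
    finally show ?thesis .
  qed
  show ?thesis
  proof (cases "x \<ge> 0")
    case True
    then show ?thesis using *[of x] assms by auto
  next
    case False
    then show ?thesis using *[of "- x"] assms by auto
  qed
qed

text \<open>The shift by 2 pi l brings t into [-pi, pi], where chord and arc are comparable. Three
  values of l suffice for differences of two points of [-pi, pi].\<close>

lemma norm_one_minus_cis_ge:
  assumes "\<bar>t\<bar> \<le> 2 * pi"
  obtains l where "l \<in> {- 1, 0, 1 :: real}" "\<bar>t - 2 * pi * l\<bar> / 2 \<le> norm (1 - cis t)" "norm (1 - cis t) \<le> \<bar>t - 2 * pi * l\<bar>"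
proof -
  obtain l where l: "l \<in> {- 1, 0, 1 :: real}" "\<bar>t - 2 * pi * l\<bar> \<le> pi"
  proof (cases "t > pi")
    case True
    then show ?thesis using assms by (intro that[of 1]) auto
  next
    case F: False
    show ?thesis
    proof (cases "t < - pi")
      case True
      then show ?thesis using assms by (intro that[of "- 1"]) auto
    next
      case False
      then show ?thesis using F by (intro that[of 0]) auto
    qed
  qed
  have "\<bar>sin (t / 2)\<bar> = \<bar>sin ((t - 2 * pi * l) / 2)\<bar>"
  proof -
    have "(t - 2 * pi * l) / 2 = t / 2 - pi * l" by (simp add: field_simps)
    show ?thesis unfolding \<open>(t - 2 * pi * l) / 2 = t / 2 - pi * l\<close> using l(1) by (auto simp: sin_diff)
  qed
  then have eq: "norm (1 - cis t) = 2 * \<bar>sin ((t - 2 * pi * l) / 2)\<bar>" by (simp add: norm_one_minus_cis)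
  show ?thesis
  proof (rule that[OF l(1)])
    show "\<bar>t - 2 * pi * l\<bar> / 2 \<le> norm (1 - cis t)"
      using half_abs_le_abs_sin[of "(t - 2 * pi * l) / 2"] l(2) unfolding eq by simp
    show "norm (1 - cis t) \<le> \<bar>t - 2 * pi * l\<bar>"
      using abs_sin_x_le_abs_x[of "(t - 2 * pi * l) / 2"] unfolding eq by simp
  qed
qed

section \<open>Chordal distance to an interval and the integrable majorant\<close>

definition centre :: "real \<times> real \<Rightarrow> real" where
  "centre I = (fst I + snd I) / 2"

text \<open>Distance measured on the unit circle, so that an interval near pi counts as close to
  points near -pi.\<close>

definition chord :: "real \<times> real \<Rightarrow> real \<Rightarrow> real" where
  "chord I y = norm (1 - cis (y - centre I))"

text \<open>The size |I| / distance^2 of the kernel differences away from I, cut off near I. Its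
  integral is bounded uniformly in I.\<close>

definition far_kernel :: "real \<times> real \<Rightarrow> real \<Rightarrow> real" where
  "far_kernel I y = (if len I \<le> chord I y then len I / (chord I y)^2 else 0)"

lemma borel_measurable_chord [measurable]: "chord I \<in> borel_measurable \<mu>"
  unfolding chord_def[abs_def] cis_conv_exp by (intro borel_measurable_torus_continuous continuous_intros)

lemma borel_measurable_far_kernel [measurable]: "far_kernel I \<in> borel_measurable \<mu>"
  unfolding far_kernel_def[abs_def] by measurable

lemma chord_shift:
  assumes "torus_interval I" "y \<in> torus"
  obtains l where "l \<in> {- 1, 0, 1 :: real}" "\<bar>y - (centre I + 2 * pi * l)\<bar> / 2 \<le> chord I y"
    "chord I y \<le> \<bar>y - (centre I + 2 * pi * l)\<bar>"
proof -
  have "- pi \<le> centre I" "centre I \<le> pi"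
    using torus_intervalD[OF assms(1)] by (simp_all add: centre_def)
  then have "\<bar>y - centre I\<bar> \<le> 2 * pi"
    using assms(2) by (auto simp: torus_def)
  then show ?thesis
    using norm_one_minus_cis_ge[of "y - centre I"] that unfolding chord_def by (metis diff_diff_eq)
qed

lemma integral_poisson_le:
  assumes "s > 0"
  shows "(LINT y|\<mu>. 2 * s / (s^2 + (y - e)^2)) \<le> 2 * pi"
proof -
  define F where "F y = 2 * arctan ((y - e) / s)" for y
  have "s^2 + (y - e)^2 \<noteq> 0" for y using assms by (simp add: sum_power2_eq_zero_iff)
  then have "(LINT y|\<mu>. 2 * s / (s^2 + (y - e)^2)) = integral {-pi..pi} (\<lambda>y. 2 * s / (s^2 + (y - e)^2))"
    by (intro integral_torus_continuous continuous_intros) auto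
  also have "\<dots> = F pi - F (- pi)"
  proof (rule integral_unique, rule fundamental_theorem_of_calculus)
    fix y assume "y \<in> {- pi..pi}"
    have "(F has_real_derivative (2 * s / (s^2 + (y - e)^2))) (at y within {-pi..pi})"
      unfolding F_def using assms
      by (auto intro!: derivative_eq_intros simp: divide_simps) (simp add: power2_eq_square algebra_simps)
    then show "(F has_vector_derivative (2 * s / (s^2 + (y - e)^2))) (at y within {-pi..pi})"
      by (simp add: has_real_derivative_iff_has_vector_derivative)
  qed auto
  also have "\<dots> \<le> 2 * (pi / 2) - 2 * (- (pi / 2))"
    unfolding F_def by (intro diff_mono mult_left_mono less_imp_le arctan_ubound arctan_lbound) auto
  finally show ?thesis by simp
qed

lemma far_kernel_nonneg: "torus_interval I \<Longrightarrow> 0 \<le> far_kernel I y"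
  using torus_intervalD(4)[of I] by (simp add: far_kernel_def)

lemma far_kernel_le:
  assumes "torus_interval I"
  shows "far_kernel I y \<le> 1 / len I"
proof -
  have l: "len I > 0" using torus_intervalD[OF assms] by simp
  have "len I / (chord I y)^2 \<le> 1 / len I" if "len I \<le> chord I y"
  proof -
    have "(len I)^2 \<le> (chord I y)^2" using that l by (intro power_mono) auto
    then have "len I / (chord I y)^2 \<le> len I / (len I)^2" using l that by (intro divide_left_mono) (auto intro!: mult_pos_pos zero_less_power)
    then show ?thesis using l by (simp add: power2_eq_square)
  qed
  then show ?thesis using l by (simp add: far_kernel_def)
qed

lemma integrable_far_kernel: "torus_interval I \<Longrightarrow> integrable \<mu> (far_kernel I)"
  using far_kernel_nonneg[of I] far_kernel_le[of I]
  by (intro integrable_torus_bounded[where B = "1 / len I"]) auto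

text \<open>Where the distance r to a translate of the centre is at least s = |I|, s / (r / 2)^2 is
  at most four times the Poisson-type kernel 2 s / (s^2 + r^2), whose integral is at most 2 pi.
  Three translates give 24 pi.\<close>

lemma integral_far_kernel_le:
  assumes "torus_interval I"
  shows "(LINT y|\<mu>. far_kernel I y) \<le> 24 * pi"
proof -
  define s where "s = len I"
  have s: "s > 0" using torus_intervalD[OF assms] by (simp add: s_def)
  define p where "p l y = 2 * s / (s^2 + (y - (centre I + 2 * pi * l))^2)" for l y
  have nz: "s^2 + x^2 > 0" for x using s by (simp add: add_pos_nonneg)
  have p0: "0 \<le> p l y" for l y using s unfolding p_def by simp
  have pb: "p l y \<le> 2 * s / s^2" for l y unfolding p_def using s by (intro divide_left_mono) (auto intro!: mult_pos_pos nz)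
  have pint: "integrable \<mu> (p l)" for l
  proof (rule integrable_torus_bounded[where B = "2 * s / s^2"])
    show "p l \<in> borel_measurable \<mu>"
      unfolding p_def using s by (intro borel_measurable_torus_continuous continuous_intros) (auto simp: sum_power2_eq_zero_iff)
    show "norm (p l x) \<le> 2 * s / s^2" for x using p0 pb by simp
  qed
  have ptw: "far_kernel I y \<le> 4 * (\<Sum>l\<in>{- 1, 0, 1}. p l y)" if y: "y \<in> torus" for y
  proof (cases "s \<le> chord I y")
    case True
    obtain l where l: "l \<in> {- 1, 0, 1 :: real}" "\<bar>y - (centre I + 2 * pi * l)\<bar> / 2 \<le> chord I y"
        "chord I y \<le> \<bar>y - (centre I + 2 * pi * l)\<bar>"
      using chord_shift[OF assms y] by blast
    define r where "r = \<bar>y - (centre I + 2 * pi * l)\<bar>"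
    have r: "r > 0" "s \<le> r" "r / 2 \<le> chord I y" using l True s by (auto simp: r_def)
    have "far_kernel I y = s / (chord I y)^2" using True by (simp add: far_kernel_def s_def)
    also have "\<dots> \<le> s / (r / 2)^2" using r s by (intro divide_left_mono power_mono mult_pos_pos zero_less_power) auto
    also have "\<dots> = 4 * (2 * s / (r^2 + r^2))" using r by (simp add: field_simps power2_eq_square)
    also have "\<dots> \<le> 4 * (2 * s / (s^2 + r^2))"
      using r s nz by (intro mult_left_mono divide_left_mono add_mono power_mono mult_pos_pos) auto
    also have "\<dots> = 4 * p l y" by (simp add: p_def r_def)
    also have "\<dots> \<le> 4 * (\<Sum>l\<in>{- 1, 0, 1}. p l y)"
      using l(1) p0 by (intro mult_left_mono member_le_sum) auto
    finally show ?thesis .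
  next
    case False
    then show ?thesis using p0 by (simp add: far_kernel_def s_def)
  qed
  have "(LINT y|\<mu>. far_kernel I y) \<le> (LINT y|\<mu>. 4 * (\<Sum>l\<in>{- 1, 0, 1}. p l y))"
    using ptw pint by (intro integral_mono integrable_far_kernel assms integrable_mult_right Bochner_Integration.integrable_sum) auto
  also have "\<dots> = 4 * (\<Sum>l\<in>{- 1, 0, 1}. (LINT y|\<mu>. p l y))"
    using pint by (simp only: integral_mult_right_zero Bochner_Integration.integral_sum)
  also have "\<dots> \<le> 4 * (\<Sum>l\<in>{- 1, 0, 1 :: real}. 2 * pi)"
    unfolding p_def using s by (intro mult_left_mono sum_mono integral_poisson_le) auto
  also have "\<dots> = 24 * pi" by simp
  finally show ?thesis .
qed

definition near :: "real \<times> real \<Rightarrow> real set" where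
  "near I = {y \<in> torus. chord I y < len I}"

lemma sets_near [measurable]: "near I \<in> sets \<mu>"
proof -
  have "{y \<in> space \<mu>. chord I y < len I} \<in> sets \<mu>" by measurable
  then show ?thesis by (simp add: near_def)
qed

text \<open>A chord shorter than |I| forces an arc shorter than 2 |I|, up to three translates: three
  intervals of length 4 |I|.\<close>

lemma measure_near_le:
  assumes "torus_interval I"
  shows "measure \<mu> (near I) \<le> 12 * len I"
proof -
  define s where "s = len I"
  have s: "s > 0" using torus_intervalD[OF assms] by (simp add: s_def)
  define e where "e l = centre I + 2 * pi * l" for l
  have sub: "near I \<subseteq> (\<Union>l\<in>{- 1, 0, 1}. {e l - 2 * s..e l + 2 * s})"
  proof
    fix y assume "y \<in> near I"
    then have y: "y \<in> torus" "chord I y < s" by (auto simp: near_def s_def)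
    obtain l where l: "l \<in> {- 1, 0, 1 :: real}" "\<bar>y - e l\<bar> / 2 \<le> chord I y"
      using chord_shift[OF assms y(1)] unfolding e_def by blast
    then have "y \<in> {e l - 2 * s..e l + 2 * s}" using y by (auto simp: abs_if split: if_splits)
    then show "y \<in> (\<Union>l\<in>{- 1, 0, 1}. {e l - 2 * s..e l + 2 * s})" using l(1) by blast
  qed
  have "measure \<mu> (near I) = measure lebesgue (near I)"
    by (rule measure_restrict_space) (auto simp: near_def)
  also have "\<dots> \<le> measure lebesgue (\<Union>l\<in>{- 1, 0, 1}. {e l - 2 * s..e l + 2 * s})"
  proof (rule measure_mono_fmeasurable[OF sub])
    show "near I \<in> sets lebesgue" using sets_near[of I] by (simp add: sets_restrict_space_iff)
  qed auto
  also have "\<dots> \<le> (\<Sum>l\<in>{- 1, 0, 1}. measure lebesgue {e l - 2 * s..e l + 2 * s})"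
    by (intro measure_UNION_le) auto
  also have "\<dots> = (\<Sum>l\<in>{- 1, 0, 1 :: real}. 4 * s)" using s by (intro sum.cong refl) auto
  also have "\<dots> = 12 * s" by simp
  finally show ?thesis by (simp add: s_def)
qed

text \<open>After conjugation by e_m the vanishing m-th coefficient is a vanishing integral. So the
  kernel may be replaced by its difference from the value at the centre of I, and the Lipschitz
  bound gives the decay.\<close>

lemma cauchy_mean_far_bound:
  assumes M: "M > 0" and I: "torus_interval I" and b: "integrable \<mu> b"
    and supp: "\<And>x. x \<notin> ivl I \<Longrightarrow> b x = 0" and mean: "fourier_coeff b m = 0" and y: "len I \<le> chord I y"
  shows "norm (cauchy_mean M m b y) \<le> L1_norm b * far_kernel I y"
proof -
  define c where "c = centre I"
  define d where "d = chord I y"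
  define z where "z = cis (y - c)"
  have l: "len I > 0" using torus_intervalD[OF I] by simp
  have d: "len I \<le> d" "d = norm (1 - z)" "d > 0" using y l by (auto simp: d_def chord_def z_def c_def)
  define B where "B x = ek m y * (b x * cnj (ek m x))" for x
  have Bint: "integrable \<mu> B" unfolding B_def using integrable_mult_cnj_ek[OF b] by simp
  have B0: "(LINT x|\<mu>. B x) = 0" using mean by (simp add: B_def fourier_coeff_ek)
  have nB: "norm (B x) = norm (b x)" for x by (simp add: B_def norm_mult)
  have Km: "(\<lambda>x. cauchy_kernel M (cis (y - x))) \<in> borel_measurable \<mu>"
    unfolding cauchy_kernel_def cis_conv_exp by (intro borel_measurable_torus_continuous continuous_intros)
  have KB: "norm (cauchy_kernel M (cis (y - x))) \<le> real M" for x
  proof -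
    have "norm (cauchy_kernel M (cis (y - x))) \<le> (\<Sum>k<M. 1)"
      unfolding cauchy_kernel_def by (intro sum_norm_le) (auto simp: norm_mult norm_power simp del: of_real_diff of_real_divide)
    then show ?thesis by simp
  qed
  have i1: "integrable \<mu> (\<lambda>x. B x * cauchy_kernel M (cis (y - x)))"
    by (rule integrable_mult_bounded[OF Bint Km KB])
  have i2: "integrable \<mu> (\<lambda>x. B x * cauchy_kernel M z)" using Bint by simp
  have "2 * of_real pi * cauchy_mean M m b y = (LINT x|\<mu>. B x * cauchy_kernel M (cis (y - x))) - (LINT x|\<mu>. B x * cauchy_kernel M z)"
    using B0 by (simp add: cauchy_mean_integral[OF b] B_def)
  also have "\<dots> = (LINT x|\<mu>. B x * cauchy_kernel M (cis (y - x)) - B x * cauchy_kernel M z)"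
    using i1 i2 by simp
  finally have eq: "2 * of_real pi * cauchy_mean M m b y = (LINT x|\<mu>. B x * cauchy_kernel M (cis (y - x)) - B x * cauchy_kernel M z)" .
  have ptw: "norm (B x * cauchy_kernel M (cis (y - x)) - B x * cauchy_kernel M z) \<le> norm (b x) * (4 * len I / d^2)" for x
  proof (cases "x \<in> ivl I")
    case True
    define w where "w = cis (y - x)"
    have xc: "\<bar>x - c\<bar> \<le> len I / 2" using True by (auto simp: ivl_def c_def centre_def len_def abs_if field_simps)
    have zw: "norm (z - w) \<le> len I / 2"
      using norm_cis_diff_le[of "y - c" "y - x"] xc by (simp add: z_def w_def)
    have "norm (1 - z) \<le> norm (1 - w) + norm (z - w)"
      using norm_triangle_ineq[of "1 - w" "w - z"] by (simp add: norm_minus_commute)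
    \<comment> \<open>Moving inside I changes the point by at most |I| / 2, which is at most d / 2
      by the hypothesis on y.\<close>
    then have w: "d / 2 \<le> norm (1 - w)" using zw d by simp
    have ne: "z \<noteq> 1" "w \<noteq> 1" using d w by auto
    have "norm (cauchy_kernel M w - cauchy_kernel M z) = norm (cauchy_kernel M z - cauchy_kernel M w)"
      by (rule norm_minus_commute)
    also have "\<dots> \<le> 4 * norm (z - w) / (norm (1 - z))^2 + 2 * norm (z - w) / (norm (1 - z) * norm (1 - w))"
      by (rule cauchy_kernel_lipschitz[OF M _ _ ne]) (auto simp: z_def w_def)
    also have "\<dots> \<le> 4 * (len I / 2) / d^2 + 2 * (len I / 2) / (d * (d / 2))"
      using zw w d l by (intro add_mono frac_le mult_mono mult_left_mono) auto
    also have "\<dots> = 4 * len I / d^2" using d by (simp add: field_simps power2_eq_square)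
    finally have K: "norm (cauchy_kernel M w - cauchy_kernel M z) \<le> 4 * len I / d^2" .
    have "norm (B x * cauchy_kernel M w - B x * cauchy_kernel M z) = norm (b x) * norm (cauchy_kernel M w - cauchy_kernel M z)"
      by (simp add: norm_mult nB flip: right_diff_distrib)
    also have "\<dots> \<le> norm (b x) * (4 * len I / d^2)" using K by (intro mult_left_mono) auto
    finally show ?thesis by (simp add: w_def)
  next
    case False
    then show ?thesis by (simp add: B_def supp)
  qed
  have "2 * pi * norm (cauchy_mean M m b y) = norm (2 * of_real pi * cauchy_mean M m b y)"
    by (simp add: norm_mult)
  also have "\<dots> \<le> (LINT x|\<mu>. norm (B x * cauchy_kernel M (cis (y - x)) - B x * cauchy_kernel M z))"
    unfolding eq by (rule integral_norm_bound)
  also have "\<dots> \<le> (LINT x|\<mu>. norm (b x) * (4 * len I / d^2))"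
    using i1 i2 b ptw by (intro integral_mono) auto
  also have "\<dots> = 4 * (L1_norm b * (len I / d^2))" by simp
  \<comment> \<open>The constant 4 is absorbed by the factor 2 pi of the normalisation.\<close>
  also have "\<dots> \<le> 2 * pi * (L1_norm b * (len I / d^2))"
    using l pi_ge_two by (intro mult_right_mono mult_nonneg_nonneg) (auto intro: integral_nonneg_AE)
  finally have "norm (cauchy_mean M m b y) \<le> L1_norm b * (len I / d^2)"
    by (subst (asm) mult_le_cancel_left_pos) auto
  then show ?thesis using y by (simp add: far_kernel_def d_def)
qed

section \<open>Linearity and energy of the means\<close>

lemma fourier_coeff_setsum:
  assumes "\<And>i. i \<in> S \<Longrightarrow> integrable \<mu> (g i)"
  shows "fourier_coeff (\<lambda>x. \<Sum>i\<in>S. g i x) k = (\<Sum>i\<in>S. fourier_coeff (g i) k)"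
  using fourier_coeff_sum[OF assms, where c = "\<lambda>_. 1"] by simp

lemma cauchy_mean_add:
  assumes "integrable \<mu> f" "integrable \<mu> g"
  shows "cauchy_mean M m (\<lambda>x. f x + g x) y = cauchy_mean M m f y + cauchy_mean M m g y"
  by (simp only: cauchy_mean_def fourier_coeff_add[OF assms] distrib_left distrib_right sum.distrib)

lemma cauchy_mean_sum:
  assumes "\<And>i. i \<in> S \<Longrightarrow> integrable \<mu> (g i)"
  shows "cauchy_mean M m (\<lambda>x. \<Sum>i\<in>S. g i x) y = (\<Sum>i\<in>S. cauchy_mean M m (g i) y)"
  unfolding cauchy_mean_def
  by (subst sum.swap) (simp add: fourier_coeff_setsum[OF assms] sum_distrib_left sum_distrib_right)

text \<open>The weights lie between 0 and 1, so Parseval followed by Bessel suffices.\<close>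

lemma integral_cauchy_mean_square_le:
  assumes g: "g \<in> borel_measurable \<mu>" "\<And>x. x \<in> torus \<Longrightarrow> norm (g x) \<le> B"
  shows "energy (cauchy_mean M m g) \<le> energy g"
proof -
  have "energy (cauchy_mean M m g)
    = 2 * pi * (\<Sum>k<M. (norm (of_real (1 - real k / real M) * fourier_coeff g (m + int k)))^2)"
    unfolding cauchy_mean_def by (rule parseval_finite) (auto simp: inj_on_def)
  also have "\<dots> \<le> 2 * pi * (\<Sum>k<M. (norm (fourier_coeff g (m + int k)))^2)"
  proof (intro mult_left_mono sum_mono power_mono)
    fix k assume "k \<in> {..<M}"
    then have "\<bar>1 - real k / real M\<bar> \<le> 1" by (auto simp: abs_if field_simps)
    then show "norm (of_real (1 - real k / real M) * fourier_coeff g (m + int k)) \<le> norm (fourier_coeff g (m + int k))"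
      unfolding norm_mult norm_of_real by (simp add: mult_left_le_one_le)
  qed auto
  also have "\<dots> = 2 * pi * (\<Sum>k\<in>(\<lambda>k. m + int k) ` {..<M}. (norm (fourier_coeff g k))^2)"
    by (subst sum.reindex) (auto simp: inj_on_def)
  also have "\<dots> \<le> energy g" by (rule bessel) (use g in auto)
  finally show ?thesis .
qed

text \<open>Partial sum minus Fejer mean. The factor |k| / (n + 1) acts as a derivative divided by n
  + 1, which is the source of square summability along lacunary n.\<close>

definition fejer_defect :: "nat \<Rightarrow> (real \<Rightarrow> complex) \<Rightarrow> real \<Rightarrow> complex" where
  "fejer_defect n g y = (\<Sum>k = - int n..int n. of_real (\<bar>of_int k\<bar> / (real n + 1)) * fourier_coeff g k * ek k y)"

lemma partial_sum_eq_fejer_defect: "fourier_partial_sum n g y = fejer_mean n g y + fejer_defect n g y"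
  by (simp add: fourier_partial_sum_ek fejer_mean_def fejer_defect_def left_diff_distrib flip: sum.distrib)

lemma fejer_defect_diff:
  assumes "integrable \<mu> f" "integrable \<mu> g"
  shows "fejer_defect n (\<lambda>x. f x - g x) y = fejer_defect n f y - fejer_defect n g y"
  by (simp only: fejer_defect_def fourier_coeff_diff[OF assms] right_diff_distrib left_diff_distrib sum_subtractf)

lemma integral_fejer_defect_square:
  "energy (fejer_defect n g)
    = 2 * pi * (\<Sum>k = - int n..int n. (of_int k / (real n + 1))^2 * (norm (fourier_coeff g k))^2)"
proof -
  have "energy (fejer_defect n g)
    = 2 * pi * (\<Sum>k = - int n..int n. (norm (of_real (\<bar>of_int k\<bar> / (real n + 1)) * fourier_coeff g k))^2)"
    unfolding fejer_defect_def by (rule parseval_finite_id) auto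
  then show ?thesis by (simp add: norm_mult power_mult_distrib power_divide del: of_real_divide)
qed

lemma integrable_trig_square:
  assumes "\<And>y. P y = (\<Sum>i\<in>I. c i * ek (\<kappa> i) y)"
  shows "integrable \<mu> (\<lambda>y. (norm (P y))^2)"
proof (rule integrable_torus_bounded[where B = "(\<Sum>i\<in>I. norm (c i))^2"])
  show "(\<lambda>y. (norm (P y))^2) \<in> borel_measurable \<mu>" unfolding assms by measurable
  have "norm (P x) \<le> (\<Sum>i\<in>I. norm (c i))" for x
    unfolding assms by (rule order_trans[OF norm_sum]) (simp add: norm_mult)
  then show "norm ((norm (P x))^2) \<le> (\<Sum>i\<in>I. norm (c i))^2" for x by (simp add: power_mono)
qed

lemma integrable_cauchy_mean_square: "integrable \<mu> (\<lambda>y. (norm (cauchy_mean M m g y))^2)"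
  by (rule integrable_trig_square[OF cauchy_mean_def])

lemma integrable_fejer_defect_square: "integrable \<mu> (\<lambda>y. (norm (fejer_defect n g y))^2)"
  by (rule integrable_trig_square[OF fejer_defect_def])

subsection \<open>The decomposition at a fixed height\<close>

text \<open>The bound \<open>B\<close> is qualitative: it gives integrability and enters the choice
  of the truncation length, but none of the constants.\<close>

locale cz_decomposition =
  fixes f :: "real \<Rightarrow> complex" and lam :: real and S :: "(real \<times> real) set" and B :: real
  assumes f_meas [measurable]: "f \<in> borel_measurable \<mu>"
    and f_bound: "\<And>x. x \<in> torus \<Longrightarrow> norm (f x) \<le> B"
    and lam: "lam > 0"
    and fin: "finite S" and disj: "disjoint_family_on ivl S" and ti: "\<And>I. I \<in> S \<Longrightarrow> torus_interval I"
    and lower: "\<And>I. I \<in> S \<Longrightarrow> lam * len I \<le> (LINT x|\<mu>. indicator (ivl I) x * norm (f x))"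
    and upper: "\<And>I. I \<in> S \<Longrightarrow> (LINT x|\<mu>. indicator (ivl I) x * norm (f x)) \<le> 2 * lam * len I"
    and off_bound: "\<And>x. x \<in> torus \<Longrightarrow> x \<notin> (\<Union>I\<in>S. ivl I) \<Longrightarrow> norm (f x) \<le> 2 * lam"
begin

definition norm1 :: real where "norm1 = L1_norm f"

definition piece :: "real \<times> real \<Rightarrow> real \<Rightarrow> complex" where
  "piece I x = of_real (indicator (ivl I) x) * f x"

text \<open>The mean over I of f times the conjugate of e_m; for m = 0 the usual mean.\<close>

definition local_mean :: "int \<Rightarrow> real \<times> real \<Rightarrow> complex" where
  "local_mean m I = of_real (2 * pi / len I) * fourier_coeff (piece I) m"

definition off :: "real \<Rightarrow> complex" where
  "off x = (if x \<in> (\<Union>I\<in>S. ivl I) then 0 else f x)"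

text \<open>The threshold separates two regimes. If n |I| <= 1, characters of frequency of order n
  hardly vary on I. If n |I| > 1, the bump is smooth at scale 1 / n, so that its spectrum lies
  mainly below n.\<close>

definition big :: "nat \<Rightarrow> (real \<times> real) set" where
  "big n = {I \<in> S. real n * len I > 1}"

definition small :: "nat \<Rightarrow> (real \<times> real) set" where
  "small n = {I \<in> S. real n * len I \<le> 1}"

definition bumps :: "(real \<times> real) set \<Rightarrow> int \<Rightarrow> real \<Rightarrow> complex" where
  "bumps T m x = (\<Sum>I\<in>T. local_mean m I * of_real (bump I x))"

text \<open>On short intervals the modulated correction at m is exchanged for the one at 0; this is
  the cost.\<close>

definition small_error :: "nat \<Rightarrow> int \<Rightarrow> real \<Rightarrow> complex" where
  "small_error n m x = (\<Sum>I\<in>small n. (local_mean m I * ek m x - local_mean 0 I) * of_real (bump I x))"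

definition bad :: "int \<Rightarrow> real \<times> real \<Rightarrow> real \<Rightarrow> complex" where
  "bad m I x = piece I x - local_mean m I * (ek m x * of_real (bump I x))"

text \<open>Depends on n only through the set of short intervals, and serves both ends m = -n and m
  = n + 1.\<close>

definition good :: "nat \<Rightarrow> real \<Rightarrow> complex" where
  "good n x = off x + bumps (small n) 0 x"

text \<open>One majorant for all m and all truncation lengths, hence for all n_j
  simultaneously.\<close>

definition far :: "real \<Rightarrow> real" where
  "far y = (\<Sum>I\<in>S. 4 * lam * len I * far_kernel I y)"

lemma len_pos: "I \<in> S \<Longrightarrow> len I > 0"
  using torus_intervalD(4) ti by blast

lemma big_small: "big n \<union> small n = S" "big n \<inter> small n = {}" "big n \<subseteq> S" "small n \<subseteq> S"
  by (auto simp: big_def small_def)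

lemma fin_sub: "T \<subseteq> S \<Longrightarrow> finite T" and disj_sub: "T \<subseteq> S \<Longrightarrow> disjoint_family_on ivl T"
  using fin disj finite_subset disjoint_family_on_mono by blast+

lemma integrable_f: "integrable \<mu> f"
  by (rule integrable_torus_bounded[OF f_meas f_bound])

lemma piece_meas [measurable]: "piece I \<in> borel_measurable \<mu>"
  unfolding piece_def[abs_def] by measurable

lemma integrable_piece: "integrable \<mu> (piece I)"
  unfolding piece_def[abs_def] using integrable_mult_bounded[OF integrable_f, of "\<lambda>x. of_real (indicator (ivl I) x)" 1]
  by (simp add: mult.commute)

lemma norm_piece: "norm (piece I x) = indicator (ivl I) x * norm (f x)"
  by (simp add: piece_def norm_mult)

lemma sum_len_le: "lam * (\<Sum>I\<in>S. len I) \<le> norm1"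
proof -
  have "lam * (\<Sum>I\<in>S. len I) \<le> (\<Sum>I\<in>S. L1_norm (piece I))"
    using lower by (simp add: sum_distrib_left norm_piece sum_mono)
  also have "\<dots> = (LINT x|\<mu>. (\<Sum>I\<in>S. norm (piece I x)))"
    using integrable_piece by simp
  also have "\<dots> \<le> norm1"
    unfolding norm1_def
  proof (rule integral_mono)
    fix x
    have "norm (\<Sum>I\<in>S. norm (piece I x)) \<le> norm (f x)"
      by (rule norm_disjoint_sum_le[where \<phi> = "\<lambda>I x. norm (piece I x)", OF fin disj]) (auto simp: norm_piece indicator_def)
    then show "(\<Sum>I\<in>S. norm (piece I x)) \<le> norm (f x)" by simp
  qed (use integrable_piece integrable_f in auto)
  finally show ?thesis .
qed

lemma local_mean_eq: "local_mean m I = (LINT x|\<mu>. piece I x * cnj (ek m x)) / of_real (len I)"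
  by (simp add: local_mean_def fourier_coeff_ek)

lemma norm_local_mean_le:
  assumes "I \<in> S"
  shows "norm (local_mean m I) \<le> 2 * lam"
proof -
  have "norm (LINT x|\<mu>. piece I x * cnj (ek m x)) \<le> (LINT x|\<mu>. norm (piece I x * cnj (ek m x)))"
    by (rule integral_norm_bound)
  also have "\<dots> \<le> 2 * lam * len I" using upper[OF assms] by (simp add: norm_mult norm_piece)
  finally show ?thesis using len_pos[OF assms] by (simp add: local_mean_eq norm_divide divide_le_eq)
qed

text \<open>The difference is the mean over I of f(x) (e_m(y - x) - 1), and the second factor is at
  most |m| |I| since x and y both lie in I.\<close>

lemma local_mean_variation:
  assumes I: "I \<in> S" and y: "y \<in> ivl I"
  shows "norm (local_mean m I * ek m y - local_mean 0 I) \<le> 2 * lam * (\<bar>of_int m\<bar> * len I)"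
proof -
  have l: "len I > 0" by (rule len_pos[OF I])
  have i1: "integrable \<mu> (\<lambda>x. piece I x * cnj (ek m x) * ek m y)"
    using integrable_mult_cnj_ek[OF integrable_piece] by simp
  have "of_real (len I) * (local_mean m I * ek m y - local_mean 0 I)
      = (LINT x|\<mu>. piece I x * cnj (ek m x) * ek m y - piece I x)"
    using l i1 integrable_piece by (simp add: local_mean_eq right_diff_distrib)
  then have "len I * norm (local_mean m I * ek m y - local_mean 0 I)
      = norm (LINT x|\<mu>. piece I x * cnj (ek m x) * ek m y - piece I x)"
    using l by (metis abs_of_pos norm_mult norm_of_real)
  also have "\<dots> \<le> (LINT x|\<mu>. norm (piece I x * cnj (ek m x) * ek m y - piece I x))"
    by (rule integral_norm_bound)
  also have "\<dots> \<le> (LINT x|\<mu>. norm (piece I x) * (\<bar>of_int m\<bar> * len I))"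
  proof (rule integral_mono)
    show "integrable \<mu> (\<lambda>x. norm (piece I x * cnj (ek m x) * ek m y - piece I x))"
      using i1 integrable_piece by auto
    fix x
    show "norm (piece I x * cnj (ek m x) * ek m y - piece I x) \<le> norm (piece I x) * (\<bar>of_int m\<bar> * len I)"
    proof (cases "x \<in> ivl I")
      case True
      have "piece I x * cnj (ek m x) * ek m y - piece I x = piece I x * (ek m (y - x) - ek m 0)"
        by (simp add: ek_diff_right algebra_simps)
      then have "norm (piece I x * cnj (ek m x) * ek m y - piece I x) = norm (piece I x) * norm (ek m (y - x) - ek m 0)"
        by (simp only: norm_mult)
      also have "\<dots> \<le> norm (piece I x) * (\<bar>of_int m\<bar> * \<bar>(y - x) - 0\<bar>)"
        by (intro mult_left_mono norm_ek_diff_le) auto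
      also have "\<dots> \<le> norm (piece I x) * (\<bar>of_int m\<bar> * len I)"
        using True y by (intro mult_left_mono) (auto simp: ivl_def len_def)
      finally show ?thesis .
    qed (simp add: piece_def)
  qed (use integrable_piece in auto)
  also have "\<dots> \<le> (2 * lam * len I) * (\<bar>of_int m\<bar> * len I)"
    using upper[OF I] l by (simp add: norm_piece mult_right_mono)
  finally have "len I * norm (local_mean m I * ek m y - local_mean 0 I) \<le> len I * (2 * lam * (\<bar>of_int m\<bar> * len I))"
    by (simp add: mult_ac)
  then show ?thesis using l by (simp only: mult_le_cancel_left_pos)
qed

lemma bumps_meas [measurable]: "bumps T m \<in> borel_measurable \<mu>"
  unfolding bumps_def[abs_def] by measurable

lemma norm_local_mean_bump_le: "I \<in> S \<Longrightarrow> norm (local_mean m I * of_real (bump I x)) \<le> 3 * lam"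
proof -
  assume I: "I \<in> S"
  have "norm (local_mean m I * of_real (bump I x)) = norm (local_mean m I) * \<bar>bump I x\<bar>" by (simp add: norm_mult)
  also have "\<dots> \<le> (2 * lam) * (3 / 2)"
    using norm_local_mean_le[OF I, of m] bump_bounds[OF ti[OF I], of x] lam by (intro mult_mono) auto
  finally show ?thesis by simp
qed

lemma norm_bumps_le: "T \<subseteq> S \<Longrightarrow> norm (bumps T m x) \<le> 3 * lam"
  unfolding bumps_def using lam
  by (intro norm_disjoint_sum_le[where \<phi> = "\<lambda>I x. local_mean m I * of_real (bump I x)"] fin_sub disj_sub)
    (auto intro!: norm_local_mean_bump_le)

lemma integrable_bumps: "T \<subseteq> S \<Longrightarrow> integrable \<mu> (bumps T m)"
  using norm_bumps_le by (intro integrable_torus_bounded[where B = "3 * lam"]) auto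

lemma integral_bumps_square_le:
  assumes "T \<subseteq> S"
  shows "energy (bumps T m) \<le> 9 * lam * norm1"
proof -
  have "energy (bumps T m) \<le> (\<Sum>I\<in>T. (3 * lam)^2 * len I)"
    unfolding bumps_def using assms ti norm_local_mean_bump_le
    by (intro integral_disjoint_sum_square_le fin_sub disj_sub) auto
  also have "\<dots> \<le> (\<Sum>I\<in>S. (3 * lam)^2 * len I)"
    using assms fin len_pos by (intro sum_mono2 mult_nonneg_nonneg) (auto intro: less_imp_le)
  also have "\<dots> = 9 * lam * (lam * (\<Sum>I\<in>S. len I))" by (simp add: sum_distrib_left power2_eq_square mult_ac)
  also have "\<dots> \<le> 9 * lam * norm1" using sum_len_le lam by (intro mult_left_mono) auto
  finally show ?thesis .
qed

text \<open>This is where smoothness of the bumps enters: 144 = 36 * 2^2, the local means being at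
  most \<open>2 * lam\<close>.\<close>

lemma bumps_derivative_bound:
  assumes "finite K"
  shows "2 * pi * (\<Sum>k\<in>K. (of_int k)^2 * (norm (fourier_coeff (bumps (big n) m) k))^2) \<le> (\<Sum>I\<in>big n. 144 * lam^2 / len I)"
proof -
  have bt: "torus_interval I" if "I \<in> big n" for I using that big_small(3) ti by blast
  have "2 * pi * (\<Sum>k\<in>K. (of_int k)^2 * (norm (fourier_coeff (bumps (big n) m) k))^2)
      \<le> (\<Sum>I\<in>big n. 36 * (norm (local_mean m I))^2 / len I)"
    unfolding bumps_def[abs_def]
    by (intro bump_sum_fourier_bound fin_sub disj_sub big_small(3) assms bt)
  also have "\<dots> \<le> (\<Sum>I\<in>big n. 36 * (2 * lam)^2 / len I)"
    using big_small(3)[of n] len_pos norm_local_mean_le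
    by (intro sum_mono divide_right_mono mult_left_mono power_mono) (auto intro: less_imp_le)
  also have "\<dots> = (\<Sum>I\<in>big n. 144 * lam^2 / len I)" by (simp add: power_mult_distrib)
  finally show ?thesis .
qed

lemma f_eq_off_pieces: "f x = off x + (\<Sum>I\<in>S. piece I x)"
proof (rule sum_disjoint_support[where x = x and \<phi> = piece, OF fin disj])
  fix I assume I: "I \<in> S" "x \<in> ivl I" "\<And>J. J \<in> S \<Longrightarrow> J \<noteq> I \<Longrightarrow> piece J x = 0"
  have "(\<Sum>I\<in>S. piece I x) = piece I x" using I by (auto simp: sum.remove[OF fin I(1)])
  then show ?thesis using I by (auto simp: off_def piece_def)
next
  assume z: "\<And>I. I \<in> S \<Longrightarrow> piece I x = 0"
  then have "(\<Sum>I\<in>S. piece I x) = 0" by simp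
  moreover have "off x = f x"
  proof (cases "x \<in> (\<Union>I\<in>S. ivl I)")
    case True
    then obtain I where "I \<in> S" "x \<in> ivl I" by blast
    then show ?thesis using z[of I] by (simp add: off_def piece_def)
  qed (simp add: off_def)
  ultimately show ?thesis by simp
qed (simp add: piece_def)

lemma off_meas [measurable]: "off \<in> borel_measurable \<mu>"
proof -
  have "off x = f x - (\<Sum>I\<in>S. piece I x)" for x by (simp add: f_eq_off_pieces[of x])
  then have "off = (\<lambda>x. f x - (\<Sum>I\<in>S. piece I x))" by blast
  then show ?thesis by simp
qed

lemma norm_off_le: "x \<in> torus \<Longrightarrow> norm (off x) \<le> 2 * lam"
  using off_bound[of x] lam by (auto simp: off_def)

lemma good_meas [measurable]: "good n \<in> borel_measurable \<mu>"
  unfolding good_def[abs_def] by measurable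

lemma norm_off_bumps_le:
  assumes T: "T \<subseteq> S" and x: "x \<in> torus"
  shows "norm (off x + bumps T m x) \<le> 3 * lam"
proof (cases "x \<in> (\<Union>I\<in>S. ivl I)")
  case True
  then show ?thesis using norm_bumps_le[OF T, of m x] by (simp add: off_def)
next
  case False
  then have "bumps T m x = 0" using T unfolding bumps_def by (intro sum.neutral) auto
  then show ?thesis using norm_off_le[OF x] lam by simp
qed

lemma norm_good_le: "x \<in> torus \<Longrightarrow> norm (good n x) \<le> 3 * lam"
  unfolding good_def by (rule norm_off_bumps_le) (use big_small in auto)

text \<open>The n-independent function from which \<open>good n\<close> arises by removing the bumps
  of the long intervals. The Fejer defects of \<open>whole\<close> are summed over j by
  orthogonality, those of the removed bumps by smoothness.\<close>

definition whole :: "real \<Rightarrow> complex" where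
  "whole x = off x + bumps S 0 x"

lemma whole_meas [measurable]: "whole \<in> borel_measurable \<mu>"
  unfolding whole_def[abs_def] by measurable

lemma norm_whole_le: "x \<in> torus \<Longrightarrow> norm (whole x) \<le> 3 * lam"
  unfolding whole_def by (rule norm_off_bumps_le) auto

lemma bumps_split: "bumps S m x = bumps (small n) m x + bumps (big n) m x"
proof -
  have "bumps (big n \<union> small n) m x = bumps (big n) m x + bumps (small n) m x"
    unfolding bumps_def by (intro sum.union_disjoint fin_sub big_small)
  then show ?thesis by (simp add: big_small(1) add.commute)
qed

lemma good_eq: "good n x = whole x - bumps (big n) 0 x"
  by (simp add: good_def whole_def bumps_split[of 0 x n])

lemma integrable_good: "integrable \<mu> (good n)"
  by (rule integrable_torus_bounded[where B = "3 * lam"]) (auto intro: norm_good_le)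

lemma integrable_whole: "integrable \<mu> whole"
  by (rule integrable_torus_bounded[where B = "3 * lam"]) (auto intro: norm_whole_le)

text \<open>The constant is 22 = 2 * 2 + 2 * 9: off the intervals |f|^2 <= 2 lam |f|, and the bumps
  have energy at most 9 lam times the L^1 norm.\<close>

lemma integral_whole_square_le: "energy whole \<le> 22 * lam * norm1"
proof -
  have i1: "integrable \<mu> (\<lambda>x. (norm (bumps S 0 x))^2)"
    using norm_bumps_le[of S 0] power_mono[of "norm (bumps S 0 _)" "3 * lam" 2]
    by (intro integrable_torus_bounded[where B = "(3 * lam)^2"]) auto
  have i2: "integrable \<mu> (\<lambda>x. (norm (whole x))^2)"
    using norm_whole_le power_mono[of "norm (whole _)" "3 * lam" 2]
    by (intro integrable_torus_bounded[where B = "(3 * lam)^2"]) auto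
  have "energy whole \<le> (LINT x|\<mu>. 4 * lam * norm (f x) + 2 * (norm (bumps S 0 x))^2)"
  proof (rule integral_mono)
    fix x assume "x \<in> space \<mu>"
    then have x: "x \<in> torus" by simp
    have "(norm (off x))^2 \<le> (2 * lam) * norm (f x)"
      unfolding power2_eq_square using norm_off_le[OF x] lam by (intro mult_mono) (auto simp: off_def)
    then show "(norm (whole x))^2 \<le> 4 * lam * norm (f x) + 2 * (norm (bumps S 0 x))^2"
      using norm_add_square_le[of "off x" "bumps S 0 x"] by (simp add: whole_def)
  qed (use i1 i2 integrable_f in auto)
  also have "\<dots> = 4 * lam * norm1 + 2 * energy (bumps S 0)"
    using i1 integrable_f by (simp add: norm1_def)
  also have "\<dots> \<le> 22 * lam * norm1" using integral_bumps_square_le[of S 0] by simp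
  finally show ?thesis .
qed

lemma small_error_meas [measurable]: "small_error n m \<in> borel_measurable \<mu>"
  unfolding small_error_def[abs_def] by measurable

text \<open>The hypothesis on m admits both -n and n + 1 when n >= 1.\<close>

lemma norm_small_error_term_le:
  assumes I: "I \<in> S" and m: "\<bar>of_int m\<bar> \<le> 2 * real n"
  shows "norm ((local_mean m I * ek m x - local_mean 0 I) * of_real (bump I x)) \<le> 6 * lam * (real n * len I)"
proof (cases "x \<in> ivl I")
  case True
  have l: "len I > 0" by (rule len_pos[OF I])
  have "norm ((local_mean m I * ek m x - local_mean 0 I) * of_real (bump I x))
      = norm (local_mean m I * ek m x - local_mean 0 I) * \<bar>bump I x\<bar>" by (simp add: norm_mult)
  also have "\<dots> \<le> (2 * lam * (\<bar>of_int m\<bar> * len I)) * (3 / 2)"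
    using local_mean_variation[OF I True, of m] bump_bounds[OF ti[OF I], of x] lam l by (intro mult_mono) auto
  also have "\<dots> \<le> (2 * lam * (2 * real n * len I)) * (3 / 2)"
    using m lam l by (intro mult_right_mono mult_left_mono) auto
  finally show ?thesis by simp
qed (use lam len_pos[OF I] in simp)

lemma norm_small_error_le:
  assumes m: "\<bar>of_int m\<bar> \<le> 2 * real n"
  shows "norm (small_error n m x) \<le> 6 * lam"
  unfolding small_error_def
proof (rule norm_disjoint_sum_le[where \<phi> = "\<lambda>I x. (local_mean m I * ek m x - local_mean 0 I) * of_real (bump I x)"])
  fix I assume I: "I \<in> small n"
  then have "6 * lam * (real n * len I) \<le> 6 * lam * 1" using lam by (intro mult_left_mono) (auto simp: small_def)
  then show "norm ((local_mean m I * ek m x - local_mean 0 I) * of_real (bump I x)) \<le> 6 * lam"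
    using norm_small_error_term_le[OF _ m, of I x] I big_small by fastforce
qed (use big_small fin_sub disj_sub lam in auto)

lemma integral_small_error_square_le:
  assumes m: "\<bar>of_int m\<bar> \<le> 2 * real n"
  shows "energy (small_error n m) \<le> (\<Sum>I\<in>small n. 36 * lam^2 * len I * (real n * len I)^2)"
proof -
  have "energy (small_error n m) \<le> (\<Sum>I\<in>small n. (6 * lam * (real n * len I))^2 * len I)"
    unfolding small_error_def using big_small(4)[of n] ti m
    by (intro integral_disjoint_sum_square_le fin_sub disj_sub) (auto intro!: norm_small_error_term_le)
  also have "\<dots> = (\<Sum>I\<in>small n. 36 * lam^2 * len I * (real n * len I)^2)"
    by (simp add: power_mult_distrib mult_ac)
  finally show ?thesis .
qed

lemma bad_meas [measurable]: "bad m I \<in> borel_measurable \<mu>"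
  unfolding bad_def[abs_def] by measurable

lemma integrable_ek_bump:
  assumes "I \<in> S"
  shows "integrable \<mu> (\<lambda>x. ek m x * of_real (bump I x))"
  using bump_bounds[OF ti[OF assms]] by (intro integrable_torus_bounded[where B = "3 / 2"]) (auto simp: norm_mult)

lemma integrable_bad: "I \<in> S \<Longrightarrow> integrable \<mu> (bad m I)"
  unfolding bad_def[abs_def] using integrable_piece integrable_ek_bump by simp

text \<open>The bump has mean one, so e_m times the bump has m-th coefficient |I| / (2 pi); the
  factor in \<open>local_mean\<close> is chosen to match this. It is the cancellation that the decay
  estimate requires.\<close>

lemma fourier_coeff_bad:
  assumes I: "I \<in> S"
  shows "fourier_coeff (bad m I) m = 0"
proof -
  have "fourier_coeff (\<lambda>x. ek m x * of_real (bump I x)) m = fourier_coeff (\<lambda>x. of_real (bump I x)) 0"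
    using fourier_coeff_mult_ek[of m "\<lambda>x. of_real (bump I x)" 0] by simp
  also have "\<dots> = of_real (len I) / (2 * of_real pi)"
    using integral_bump[OF ti[OF I]] by (simp add: fourier_coeff_ek)
  finally have 1: "fourier_coeff (\<lambda>x. ek m x * of_real (bump I x)) m = of_real (len I) / (2 * of_real pi)" .
  have "fourier_coeff (\<lambda>x. local_mean m I * (ek m x * of_real (bump I x))) m = local_mean m I * (of_real (len I) / (2 * of_real pi))"
    using fourier_coeff_sum[of "{0::nat}" "\<lambda>_ x. ek m x * of_real (bump I x)" "\<lambda>_. local_mean m I" m] integrable_ek_bump[OF I] 1 by simp
  then show ?thesis unfolding bad_def[abs_def]
    using integrable_piece integrable_ek_bump[OF I] len_pos[OF I]
    by (subst fourier_coeff_diff) (auto simp: local_mean_def)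
qed

lemma integral_norm_bad_le:
  assumes I: "I \<in> S"
  shows "L1_norm (bad m I) \<le> 4 * lam * len I"
proof -
  have "L1_norm (bad m I) \<le> (LINT x|\<mu>. norm (piece I x) + 2 * lam * bump I x)"
  proof (rule integral_mono)
    show "integrable \<mu> (\<lambda>x. norm (piece I x) + 2 * lam * bump I x)"
      using bump_bounds[OF ti[OF I]] integrable_torus_bounded[of "bump I" "3 / 2"]
      by (intro Bochner_Integration.integrable_add integrable_norm[OF integrable_piece] integrable_mult_right) auto
    fix x
    have "norm (bad m I x) \<le> norm (piece I x) + norm (local_mean m I * (ek m x * of_real (bump I x)))"
      unfolding bad_def by (rule norm_triangle_ineq4)
    also have "norm (local_mean m I * (ek m x * of_real (bump I x))) = norm (local_mean m I) * bump I x"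
      using bump_bounds[OF ti[OF I], of x] by (simp add: norm_mult)
    also have "\<dots> \<le> 2 * lam * bump I x"
      using norm_local_mean_le[OF I] bump_bounds[OF ti[OF I], of x] by (intro mult_right_mono) auto
    finally show "norm (bad m I x) \<le> norm (piece I x) + 2 * lam * bump I x" by simp
  qed (use integrable_bad[OF I] in auto)
  also have "\<dots> = L1_norm (piece I) + 2 * lam * (LINT x|\<mu>. bump I x)"
    using integrable_piece bump_bounds[OF ti[OF I]]
    by (subst Bochner_Integration.integral_add) (auto intro!: integrable_torus_bounded[where B = "3 / 2"])
  also have "\<dots> \<le> 2 * lam * len I + 2 * lam * len I"
    using upper[OF I] integral_bump[OF ti[OF I]] by (simp add: norm_piece)
  finally show ?thesis by simp
qed

lemma norm_cauchy_mean_bad_le: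
  assumes "M > 0" "y \<in> torus" "y \<notin> (\<Union>I\<in>S. near I)"
  shows "norm (\<Sum>I\<in>S. cauchy_mean M m (bad m I) y) \<le> far y"
  unfolding far_def
proof (rule sum_norm_le)
  fix I assume I: "I \<in> S"
  have "norm (cauchy_mean M m (bad m I) y) \<le> L1_norm (bad m I) * far_kernel I y"
  proof (rule cauchy_mean_far_bound[OF assms(1) ti[OF I] integrable_bad[OF I] _ fourier_coeff_bad[OF I]])
    show "x \<notin> ivl I \<Longrightarrow> bad m I x = 0" for x by (simp add: bad_def piece_def)
    show "len I \<le> chord I y" using assms(2,3) I by (auto simp: near_def)
  qed
  also have "\<dots> \<le> 4 * lam * len I * far_kernel I y"
    using integral_norm_bad_le[OF I] far_kernel_nonneg[OF ti[OF I]] by (intro mult_right_mono) auto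
  finally show "norm (cauchy_mean M m (bad m I) y) \<le> 4 * lam * len I * far_kernel I y" .
qed

lemma integrable_far: "integrable \<mu> far"
  unfolding far_def[abs_def] using integrable_far_kernel ti by (intro Bochner_Integration.integrable_sum integrable_mult_right) auto

lemma far_nonneg: "0 \<le> far y"
  unfolding far_def using lam len_pos far_kernel_nonneg ti
  by (intro sum_nonneg mult_nonneg_nonneg) (auto intro: less_imp_le)

lemma integral_far_le: "(LINT y|\<mu>. far y) \<le> 96 * pi * norm1"
proof -
  have "(LINT y|\<mu>. far y) = (\<Sum>I\<in>S. 4 * lam * len I * (LINT y|\<mu>. far_kernel I y))"
    unfolding far_def using integrable_far_kernel ti by (subst Bochner_Integration.integral_sum) auto
  also have "\<dots> \<le> (\<Sum>I\<in>S. 4 * lam * len I * (24 * pi))"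
    using lam len_pos integral_far_kernel_le ti by (intro sum_mono mult_left_mono mult_nonneg_nonneg) (auto intro: less_imp_le)
  also have "\<dots> = 96 * pi * (lam * (\<Sum>I\<in>S. len I))"
    unfolding sum_distrib_left by (intro sum.cong refl) simp
  also have "\<dots> \<le> 96 * pi * norm1" using sum_len_le by (intro mult_left_mono) auto
  finally show ?thesis .
qed

text \<open>Each piece of f is its bad part plus a modulated bump. On short intervals that bump is
  traded for the one at frequency 0, which belongs to \<open>good n\<close>; on long ones it stays
  as the last term. The identity holds for every m.\<close>

lemma f_minus_good: "f x - good n x = (\<Sum>I\<in>S. bad m I x) + small_error n m x + ek m x * bumps (big n) m x"
proof -
  have bad: "(\<Sum>I\<in>S. bad m I x) = (\<Sum>I\<in>S. piece I x) - ek m x * bumps S m x"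
    by (simp add: bad_def sum_subtractf bumps_def sum_distrib_left mult_ac)
  have err: "small_error n m x = ek m x * bumps (small n) m x - bumps (small n) 0 x"
    unfolding small_error_def bumps_def sum_distrib_left sum_subtractf[symmetric]
    by (intro sum.cong refl) (simp add: algebra_simps)
  show ?thesis
    unfolding bad err f_eq_off_pieces[of x] good_def bumps_split[of m x n] by (simp add: algebra_simps)
qed

end

definition average :: "(nat \<Rightarrow> nat) \<Rightarrow> (real \<Rightarrow> complex) \<Rightarrow> nat \<Rightarrow> real \<Rightarrow> complex" where
  "average n f N y = (\<Sum>j = 1..N. fourier_partial_sum (n j) f y) / of_nat N"

text \<open>A weak type (1,1) bound at one height for the supremum over N in J. Giving an
  exceptional set as witness avoids working with the supremum itself.\<close>

definition maximal_bound :: "(nat \<Rightarrow> nat) \<Rightarrow> real \<Rightarrow> real \<Rightarrow> nat set \<Rightarrow> (real \<Rightarrow> complex) \<Rightarrow> real \<Rightarrow> bool" where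
  "maximal_bound n C K J f lam \<longleftrightarrow> (\<exists>E\<in>sets \<mu>. measure \<mu> E \<le> C * L1_norm f / lam \<and>
     (\<forall>y\<in>torus - E. \<forall>N\<in>J. norm (average n f N y) \<le> K * lam))"

subsection \<open>The maximal inequality\<close>

locale cz_lacunary = cz_decomposition f lam S B + lacunary_sequence n q for f lam S B n q
begin

section \<open>Square summable error terms\<close>

lemma sum_small_le:
  assumes "\<And>I. I \<in> S \<Longrightarrow> a I \<ge> 0"
  shows "(\<Sum>j = 1..J. \<Sum>I\<in>small (n j). a I * (real (n j) * len I)^2) \<le> ratio_sum * (\<Sum>I\<in>S. a I)"
proof -
  have "(\<Sum>j = 1..J. \<Sum>I\<in>small (n j). a I * (real (n j) * len I)^2)
      = (\<Sum>j = 1..J. \<Sum>I\<in>S. if real (n j) * len I \<le> 1 then a I * (real (n j) * len I)^2 else 0)"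
    unfolding small_def using fin by (intro sum.cong refl sum.inter_filter) auto
  \<comment> \<open>After the exchange each interval faces one geometric series in j.\<close>
  also have "\<dots> = (\<Sum>I\<in>S. \<Sum>j = 1..J. if real (n j) * len I \<le> 1 then a I * (real (n j) * len I)^2 else 0)"
    by (rule sum.swap)
  also have "\<dots> = (\<Sum>I\<in>S. a I * (\<Sum>j | j \<in> {1..J} \<and> real (n j) * len I \<le> 1. (real (n j) * len I)^2))"
    unfolding sum_distrib_left by (intro sum.cong refl sum.inter_filter[symmetric]) auto
  also have "\<dots> \<le> (\<Sum>I\<in>S. a I * ratio_sum)"
    using assms len_pos by (intro sum_mono mult_left_mono sum_below) (auto intro: less_imp_le)
  finally show ?thesis by (simp add: sum_distrib_left mult.commute)
qed

lemma sum_big_le: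
  assumes "\<And>I. I \<in> S \<Longrightarrow> a I \<ge> 0"
  shows "(\<Sum>j = 1..J. \<Sum>I\<in>big (n j). a I * (1 / len I / real (n j))^2) \<le> ratio_sum * (\<Sum>I\<in>S. a I)"
proof -
  have eq: "1 < real k * len I \<longleftrightarrow> 1 / len I < real k" if "I \<in> S" for I k
    using len_pos[OF that] by (simp add: field_simps)
  have "(\<Sum>j = 1..J. \<Sum>I\<in>big (n j). a I * (1 / len I / real (n j))^2)
      = (\<Sum>j = 1..J. \<Sum>I\<in>S. if real (n j) * len I > 1 then a I * (1 / len I / real (n j))^2 else 0)"
    unfolding big_def using fin by (intro sum.cong refl sum.inter_filter) auto
  also have "\<dots> = (\<Sum>I\<in>S. \<Sum>j = 1..J. if real (n j) * len I > 1 then a I * (1 / len I / real (n j))^2 else 0)"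
    by (rule sum.swap)
  \<comment> \<open>Relaxing the strict inequality adds nonnegative terms and gives the range
    required by \<open>sum_above\<close>.\<close>
  also have "\<dots> \<le> (\<Sum>I\<in>S. \<Sum>j = 1..J. if 1 / len I \<le> real (n j) then a I * (1 / len I / real (n j))^2 else 0)"
    using assms by (intro sum_mono) (auto simp: eq)
  also have "\<dots> = (\<Sum>I\<in>S. a I * (\<Sum>j | j \<in> {1..J} \<and> 1 / len I \<le> real (n j). (1 / len I / real (n j))^2))"
    unfolding sum_distrib_left by (intro sum.cong refl sum.inter_filter[symmetric]) auto
  also have "\<dots> \<le> (\<Sum>I\<in>S. a I * ratio_sum)"
    using assms len_pos by (intro sum_mono mult_left_mono sum_above) (auto intro: less_imp_le)
  finally show ?thesis by (simp add: sum_distrib_left mult.commute)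
qed

lemma ratio_sum_len_le:
  assumes "c \<ge> 0"
  shows "ratio_sum * (\<Sum>I\<in>S. c * lam^2 * len I) \<le> c * ratio_sum * lam * norm1"
proof -
  have "ratio_sum * (\<Sum>I\<in>S. c * lam^2 * len I) = c * ratio_sum * lam * (lam * (\<Sum>I\<in>S. len I))"
    unfolding sum_distrib_left by (intro sum.cong refl) (simp add: power2_eq_square)
  also have "\<dots> \<le> c * ratio_sum * lam * norm1"
    using sum_len_le lam ratio_sum_pos assms by (intro mult_left_mono) auto
  finally show ?thesis .
qed

lemma sum_integral_small_error:
  assumes "\<And>j. j \<ge> 1 \<Longrightarrow> \<bar>of_int (m j)\<bar> \<le> 2 * real (n j)"
  shows "(\<Sum>j = 1..J. energy (cauchy_mean M (m j) (small_error (n j) (m j))))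
    \<le> 36 * ratio_sum * lam * norm1"
proof -
  have "(\<Sum>j = 1..J. energy (cauchy_mean M (m j) (small_error (n j) (m j))))
    \<le> (\<Sum>j = 1..J. \<Sum>I\<in>small (n j). 36 * lam^2 * len I * (real (n j) * len I)^2)"
  proof (rule sum_mono)
    fix j assume "j \<in> {1..J}"
    then have m: "\<bar>of_int (m j)\<bar> \<le> 2 * real (n j)" using assms by simp
    show "energy (cauchy_mean M (m j) (small_error (n j) (m j)))
      \<le> (\<Sum>I\<in>small (n j). 36 * lam^2 * len I * (real (n j) * len I)^2)"
      using integral_cauchy_mean_square_le[OF small_error_meas norm_small_error_le[OF m]]
        integral_small_error_square_le[OF m] by (rule order_trans)
  qed
  also have "\<dots> \<le> ratio_sum * (\<Sum>I\<in>S. 36 * lam^2 * len I)"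
    by (intro sum_small_le mult_nonneg_nonneg less_imp_le[OF len_pos]) auto
  also have "\<dots> \<le> 36 * ratio_sum * lam * norm1" by (rule ratio_sum_len_le) simp
  finally show ?thesis .
qed

text \<open>The derivative has energy at most the sum of 144 lam^2 / |I|; division by n_j^2 leaves
  lam^2 |I| / (n_j |I|)^2 for each long interval, which sums geometrically in j.\<close>

lemma sum_integral_defect_bumps:
  "(\<Sum>j = 1..J. energy (fejer_defect (n j) (bumps (big (n j)) 0)))
    \<le> 144 * ratio_sum * lam * norm1"
proof -
  have "(\<Sum>j = 1..J. energy (fejer_defect (n j) (bumps (big (n j)) 0)))
    \<le> (\<Sum>j = 1..J. \<Sum>I\<in>big (n j). 144 * lam^2 * len I * (1 / len I / real (n j))^2)"
  proof (rule sum_mono)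
    fix j assume "j \<in> {1..J}"
    then have n0: "real (n j) > 0" using pos by simp
    have "energy (fejer_defect (n j) (bumps (big (n j)) 0))
      \<le> 2 * pi * (\<Sum>k = - int (n j)..int (n j). (of_int k / real (n j))^2 * (norm (fourier_coeff (bumps (big (n j)) 0) k))^2)"
      unfolding integral_fejer_defect_square power_divide using n0
      by (intro mult_left_mono sum_mono mult_right_mono divide_left_mono power_mono mult_pos_pos zero_less_power) auto
    also have "\<dots> = 1 / (real (n j))^2 * (2 * pi * (\<Sum>k = - int (n j)..int (n j). (of_int k)^2 * (norm (fourier_coeff (bumps (big (n j)) 0) k))^2))"
      unfolding sum_distrib_left by (intro sum.cong refl) (simp add: power_divide)
    also have "\<dots> \<le> 1 / (real (n j))^2 * (\<Sum>I\<in>big (n j). 144 * lam^2 / len I)"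
      by (intro mult_left_mono bumps_derivative_bound) auto
    also have "\<dots> = (\<Sum>I\<in>big (n j). 144 * lam^2 * len I * (1 / len I / real (n j))^2)"
      unfolding sum_distrib_left
      using len_pos big_small(3) by (intro sum.cong refl) (auto simp: power_divide power2_eq_square)
    finally show "energy (fejer_defect (n j) (bumps (big (n j)) 0))
      \<le> (\<Sum>I\<in>big (n j). 144 * lam^2 * len I * (1 / len I / real (n j))^2)" .
  qed
  also have "\<dots> \<le> ratio_sum * (\<Sum>I\<in>S. 144 * lam^2 * len I)"
    by (intro sum_big_le mult_nonneg_nonneg less_imp_le[OF len_pos]) auto
  also have "\<dots> \<le> 144 * ratio_sum * lam * norm1" by (rule ratio_sum_len_le) simp
  finally show ?thesis .
qed

text \<open>The function does not depend on j, so the sum over j is taken at each frequency: the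
  squares (k / n_j)^2 with n_j >= |k| add up to at most \<open>ratio_sum\<close>, and Bessel does
  the rest.\<close>

lemma sum_integral_defect_whole:
  "(\<Sum>j = 1..J. energy (fejer_defect (n j) whole)) \<le> 22 * ratio_sum * lam * norm1"
proof -
  \<comment> \<open>A common range of frequencies, needed to exchange the sums. For J = 0 its value
    is immaterial.\<close>
  define L where "L = Max (n ` {1..J})"
  have L: "n j \<le> L" if "j \<in> {1..J}" for j unfolding L_def using that by (intro Max_ge) auto
  define v where "v j k = (if \<bar>of_int k\<bar> \<le> real (n j) then (\<bar>of_int k\<bar> / real (n j))^2 else 0)" for j and k :: int
  define c where "c k = (norm (fourier_coeff whole k))^2" for k
  have "(\<Sum>j = 1..J. energy (fejer_defect (n j) whole))
    \<le> (\<Sum>j = 1..J. \<Sum>k = - int L..int L. 2 * pi * c k * v j k)"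
  proof (rule sum_mono)
    fix j assume j: "j \<in> {1..J}"
    then have n0: "real (n j) > 0" using pos by simp
    have "energy (fejer_defect (n j) whole)
      \<le> 2 * pi * (\<Sum>k = - int (n j)..int (n j). (of_int k / real (n j))^2 * c k)"
      unfolding integral_fejer_defect_square power_divide c_def using n0
      by (intro mult_left_mono sum_mono mult_right_mono divide_left_mono power_mono mult_pos_pos zero_less_power) auto
    also have "\<dots> = (\<Sum>k = - int (n j)..int (n j). 2 * pi * c k * v j k)"
      unfolding sum_distrib_left
    proof (intro sum.cong refl)
      fix k assume "k \<in> {- int (n j)..int (n j)}"
      then have "\<bar>k\<bar> \<le> int (n j)" by auto
      then have "\<bar>real_of_int k\<bar> \<le> real (n j)" by linarith
      then show "2 * pi * ((of_int k / real (n j))^2 * c k)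
          = 2 * pi * c k * v j k"
        by (simp add: v_def power_divide)
    qed
    also have "\<dots> \<le> (\<Sum>k = - int L..int L. 2 * pi * c k * v j k)"
      using L[OF j] by (intro sum_mono2) (auto simp: c_def v_def)
    finally show "energy (fejer_defect (n j) whole)
      \<le> (\<Sum>k = - int L..int L. 2 * pi * c k * v j k)" .
  qed
  also have "\<dots> = (\<Sum>k = - int L..int L. 2 * pi * c k * (\<Sum>j = 1..J. v j k))"
    by (subst sum.swap) (simp only: sum_distrib_left)
  also have "\<dots> = (\<Sum>k = - int L..int L. 2 * pi * c k * (\<Sum>j | j \<in> {1..J} \<and> \<bar>of_int k\<bar> \<le> real (n j). (\<bar>of_int k\<bar> / real (n j))^2))"
    unfolding v_def by (intro sum.cong refl arg_cong2[where f = "(*)"] sum.inter_filter[symmetric]) auto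
  also have "\<dots> \<le> (\<Sum>k = - int L..int L. 2 * pi * c k * ratio_sum)"
    by (intro sum_mono mult_left_mono sum_above) (auto simp: c_def)
  also have "\<dots> = ratio_sum * (2 * pi * (\<Sum>k = - int L..int L. c k))" by (simp add: sum_distrib_left mult_ac)
  also have "\<dots> \<le> ratio_sum * energy whole"
    unfolding c_def using ratio_sum_pos by (intro mult_left_mono bessel[where B = "3 * lam"] norm_whole_le) auto
  also have "\<dots> \<le> ratio_sum * (22 * lam * norm1)"
    using ratio_sum_pos integral_whole_square_le by (intro mult_left_mono) auto
  finally show ?thesis by (simp add: mult_ac)
qed

section \<open>Bumps of the long intervals: frequencies close to m and far from m\<close>

definition low_part :: "nat \<Rightarrow> nat \<Rightarrow> int \<Rightarrow> real \<Rightarrow> complex" where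
  "low_part M N m y = (\<Sum>k\<in>{k. k < M \<and> real k < gap * real N}.
     of_real (1 - real k / real M) * fourier_coeff (bumps (big N) m) (int k) * ek (m + int k) y)"

definition high_part :: "nat \<Rightarrow> nat \<Rightarrow> int \<Rightarrow> real \<Rightarrow> complex" where
  "high_part M N m y = (\<Sum>k\<in>{k. k < M \<and> \<not> real k < gap * real N}.
     of_real (1 - real k / real M) * fourier_coeff (bumps (big N) m) (int k) * ek (m + int k) y)"

lemma cauchy_mean_big: "cauchy_mean M m (\<lambda>x. ek m x * bumps (big N) m x) y = low_part M N m y + high_part M N m y"
proof -
  have "{..<M} = {k. k < M \<and> real k < gap * real N} \<union> {k. k < M \<and> \<not> real k < gap * real N}" by auto
  then show ?thesis
    unfolding cauchy_mean_def low_part_def high_part_def fourier_coeff_mult_ek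
    by (simp only:) (rule sum.union_disjoint, auto)
qed

lemma weight_le: "k < M \<Longrightarrow> norm (of_real (1 - real k / real M) * z :: complex) \<le> norm z"
  unfolding norm_mult norm_of_real by (intro mult_left_le_one_le) (auto simp: abs_if field_simps)

text \<open>At distance k >= gap N from m one may insert the factor (k / (gap N))^2 >= 1, which
  turns the energy into that of the derivative.\<close>

lemma integral_high_part_le:
  assumes "N > 0"
  shows "energy (high_part M N m) \<le> (\<Sum>I\<in>big N. 144 * lam^2 / gap^2 * len I * (1 / len I / real N)^2)"
proof -
  define K where "K = {k. k < M \<and> \<not> real k < gap * real N}"
  have finK: "finite K" unfolding K_def by auto
  have gN: "gap * real N > 0" using gap_pos assms by simp
  have "energy (high_part M N m)
     = 2 * pi * (\<Sum>k\<in>K. (norm (of_real (1 - real k / real M) * fourier_coeff (bumps (big N) m) (int k)))^2)"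
    unfolding high_part_def K_def by (rule parseval_finite) (auto simp: inj_on_def)
  also have "\<dots> \<le> 2 * pi * (\<Sum>k\<in>K. (1 / (gap * real N))^2 * ((real k)^2 * (norm (fourier_coeff (bumps (big N) m) (int k)))^2))"
  proof (intro mult_left_mono sum_mono)
    fix k assume k: "k \<in> K"
    have "1^2 \<le> (real k / (gap * real N))^2" using k gN by (intro power_mono) (auto simp: K_def)
    then have 1: "1 \<le> (1 / (gap * real N))^2 * (real k)^2" by (simp add: power_divide)
    have "(norm (of_real (1 - real k / real M) * fourier_coeff (bumps (big N) m) (int k)))^2
        \<le> (norm (fourier_coeff (bumps (big N) m) (int k)))^2"
      using k by (intro power_mono weight_le) (auto simp: K_def)
    also have "\<dots> \<le> ((1 / (gap * real N))^2 * (real k)^2) * (norm (fourier_coeff (bumps (big N) m) (int k)))^2"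
      using mult_right_mono[OF 1, of "(norm (fourier_coeff (bumps (big N) m) (int k)))^2"] by simp
    finally show "(norm (of_real (1 - real k / real M) * fourier_coeff (bumps (big N) m) (int k)))^2
       \<le> (1 / (gap * real N))^2 * ((real k)^2 * (norm (fourier_coeff (bumps (big N) m) (int k)))^2)" by (simp only: mult.assoc)
  qed auto
  also have "\<dots> = (1 / (gap * real N))^2 * (2 * pi * (\<Sum>k\<in>int ` K. (of_int k)^2 * (norm (fourier_coeff (bumps (big N) m) k))^2))"
    by (subst sum.reindex) (auto simp: sum_distrib_left mult_ac)
  also have "\<dots> \<le> (1 / (gap * real N))^2 * (\<Sum>I\<in>big N. 144 * lam^2 / len I)"
    using finK by (intro mult_left_mono bumps_derivative_bound) auto
  also have "\<dots> = (\<Sum>I\<in>big N. 144 * lam^2 / gap^2 * len I * (1 / len I / real N)^2)"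
    unfolding sum_distrib_left
    using len_pos big_small(3) by (intro sum.cong refl) (auto simp: power_divide power_mult_distrib power2_eq_square)
  finally show ?thesis .
qed

lemma sum_integral_high_part:
  "(\<Sum>j = 1..J. energy (high_part M (n j) (m j))) \<le> 144 / gap^2 * ratio_sum * lam * norm1"
proof -
  have "(\<Sum>j = 1..J. energy (high_part M (n j) (m j)))
      \<le> (\<Sum>j = 1..J. \<Sum>I\<in>big (n j). 144 * lam^2 / gap^2 * len I * (1 / len I / real (n j))^2)"
    using pos by (intro sum_mono integral_high_part_le) auto
  also have "\<dots> \<le> ratio_sum * (\<Sum>I\<in>S. 144 * lam^2 / gap^2 * len I)"
    by (intro sum_big_le mult_nonneg_nonneg divide_nonneg_nonneg less_imp_le[OF len_pos]) auto
  also have "\<dots> \<le> 144 / gap^2 * ratio_sum * lam * norm1"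
    using ratio_sum_len_le[of "144 / gap^2"] by simp
  finally show ?thesis .
qed

text \<open>Injectivity makes the blocks orthogonal, so the energy of a sum of blocks is at most 9
  lam times the L^1 norm for each index; the maximal lemma for averages multiplies this by 20. No
  decay in j is available here, and this is why the theorem concerns averages.\<close>

lemma maximal_low_part:
  assumes inj: "\<And>F. F \<subseteq> {1..} \<Longrightarrow> inj_on (\<lambda>(j, k). m j + int k) (SIGMA j:F. {k. k < M \<and> real k < gap * real (n j)})"
  obtains D where "integrable \<mu> D" "\<And>x. 0 \<le> D x" "(LINT x|\<mu>. D x) \<le> 180 * lam * norm1"
    "\<And>x N. 1 \<le> N \<Longrightarrow> N \<le> J \<Longrightarrow> (norm ((\<Sum>j = 1..N. low_part M (n j) (m j) x) / of_nat N))^2 \<le> D x"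
proof -
  define c where "c j k = of_real (1 - real k / real M) * fourier_coeff (bumps (big (n j)) (m j)) (int k)" for j k
  define K where "K j = {k. k < M \<and> real k < gap * real (n j)}" for j
  have finK: "finite (K j)" for j unfolding K_def by auto
  have eq: "(\<Sum>j\<in>F. low_part M (n j) (m j) y) = (\<Sum>p\<in>Sigma F K. (case p of (j, k) \<Rightarrow> c j k) * ek (case p of (j, k) \<Rightarrow> m j + int k) y)"
    if "finite F" for F y
  proof -
    have "(\<Sum>j\<in>F. low_part M (n j) (m j) y) = (\<Sum>j\<in>F. \<Sum>k\<in>K j. c j k * ek (m j + int k) y)"
      by (simp add: low_part_def c_def K_def)
    also have "\<dots> = (\<Sum>(j, k)\<in>Sigma F K. c j k * ek (m j + int k) y)"
      using that finK by (intro sum.Sigma) auto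
    finally show ?thesis by (simp add: case_prod_beta)
  qed
  have bound: "(LINT y|\<mu>. (norm (\<Sum>j\<in>F. low_part M (n j) (m j) y))^2) \<le> 9 * lam * norm1 * real (card F)"
    if F: "finite F" "F \<subseteq> {1..}" for F
  proof -
    have "(LINT y|\<mu>. (norm (\<Sum>j\<in>F. low_part M (n j) (m j) y))^2)
        = 2 * pi * (\<Sum>p\<in>Sigma F K. (norm (case p of (j, k) \<Rightarrow> c j k))^2)"
      unfolding eq[OF F(1)] using F finK inj[OF F(2)] by (intro parseval_finite) (auto simp: K_def[abs_def])
    also have "\<dots> = 2 * pi * (\<Sum>j\<in>F. \<Sum>k\<in>K j. (norm (c j k))^2)"
      using F finK by (subst sum.Sigma) (auto simp: case_prod_beta)
    also have "\<dots> = (\<Sum>j\<in>F. 2 * pi * (\<Sum>k\<in>K j. (norm (c j k))^2))" by (rule sum_distrib_left)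
    also have "\<dots> \<le> (\<Sum>j\<in>F. 9 * lam * norm1)"
    proof (rule sum_mono)
      fix j
      have "2 * pi * (\<Sum>k\<in>K j. (norm (c j k))^2) \<le> 2 * pi * (\<Sum>k\<in>K j. (norm (fourier_coeff (bumps (big (n j)) (m j)) (int k)))^2)"
        unfolding c_def by (intro mult_left_mono sum_mono power_mono weight_le) (auto simp: K_def)
      also have "\<dots> = 2 * pi * (\<Sum>k\<in>int ` K j. (norm (fourier_coeff (bumps (big (n j)) (m j)) k))^2)"
        by (subst sum.reindex) auto
      also have "\<dots> \<le> energy (bumps (big (n j)) (m j))"
        using finK by (intro bessel[where B = "3 * lam"] norm_bumps_le big_small) auto
      also have "\<dots> \<le> 9 * lam * norm1" by (intro integral_bumps_square_le big_small)
      finally show "2 * pi * (\<Sum>k\<in>K j. (norm (c j k))^2) \<le> 9 * lam * norm1" .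
    qed
    finally show ?thesis by (simp add: mult.commute)
  qed
  have int: "integrable \<mu> (\<lambda>y. (norm (\<Sum>j\<in>F. low_part M (n j) (m j) y))^2)" if "finite F" "F \<subseteq> {1..}" for F
    by (rule integrable_trig_square[OF eq[OF that(1)]])
  obtain D where "integrable \<mu> D" "\<And>x. 0 \<le> D x" "(LINT x|\<mu>. D x) \<le> 20 * (9 * lam * norm1)"
    "\<And>x N. 1 \<le> N \<Longrightarrow> N \<le> J \<Longrightarrow> (norm ((\<Sum>j = 1..N. low_part M (n j) (m j) x) / of_nat N))^2 \<le> D x"
    using maximal_average_square[where Y = "\<lambda>j. low_part M (n j) (m j)" and J = J, OF int bound] by blast
  then show ?thesis by (intro that[of D]) auto
qed

text \<open>Block i starts at n_i + 1 and is shorter than gap n_i <= (q - 1) n_i, which is at most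
  n_j - n_i for every later j.\<close>

lemma inj_upper:
  assumes "F \<subseteq> {1..}"
  shows "inj_on (\<lambda>(j, k). int (n j) + 1 + int k) (SIGMA j:F. {k. k < M \<and> real k < gap * real (n j)})"
proof -
  have lt: "int (n i) + 1 + int k < int (n j) + 1 + int l" if "1 \<le> i" "i < j" "real k < gap * real (n i)" for i j k l
  proof -
    have "gap \<le> q - 1"
    proof -
      have "gap = (q - 1) / q" using q by (simp add: gap_def field_simps)
      also have "\<dots> \<le> (q - 1) / 1" using q by (intro divide_left_mono) auto
      finally show ?thesis by simp
    qed
    then have "gap * real (n i) \<le> (q - 1) * real (n i)" by (intro mult_right_mono) auto
    then have "real (n i) + real k < real (n j)" using growth[OF that(1,2)] that(3) by (simp add: algebra_simps)
    then show ?thesis by linarith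
  qed
  show ?thesis
  proof (rule inj_onI, clarify)
    fix i k j l
    assume h: "i \<in> F" "j \<in> F" "real k < gap * real (n i)" "real l < gap * real (n j)"
      "int (n i) + 1 + int k = int (n j) + 1 + int l"
    have "i = j"
      using lt[of i j k l] lt[of j i l k] h assms by (cases i j rule: linorder_cases) auto
    then show "i = j \<and> k = l" using h by simp
  qed
qed

text \<open>Block j starts at -n_j and ends before -n_j + gap n_j = -n_j / q, which is at most -n_i
  for every earlier i. This side dictates the form of \<open>gap\<close>.\<close>

lemma inj_lower:
  assumes "F \<subseteq> {1..}"
  shows "inj_on (\<lambda>(j, k). - int (n j) + int k) (SIGMA j:F. {k. k < M \<and> real k < gap * real (n j)})"
proof -
  have lt: "- int (n j) + int l < - int (n i) + int k" if "1 \<le> i" "i < j" "real l < gap * real (n j)" for i j k l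
  proof -
    have "real (n i) \<le> real (n j) / q" using growth[OF that(1,2)] q by (simp add: field_simps)
    also have "\<dots> = real (n j) - gap * real (n j)" by (simp add: gap_def algebra_simps)
    finally have "real (n i) + real l < real (n j)" using that(3) by linarith
    then show ?thesis by linarith
  qed
  show ?thesis
  proof (rule inj_onI, clarify)
    fix i k j l
    assume h: "i \<in> F" "j \<in> F" "real k < gap * real (n i)" "real l < gap * real (n j)"
      "- int (n i) + int k = - int (n j) + int l"
    have "i = j"
      using lt[of i j l k] lt[of j i k l] h assms by (cases i j rule: linorder_cases) auto
    then show "i = j \<and> k = l" using h by simp
  qed
qed

lemma cauchy_mean_remainder:
  assumes m: "\<bar>of_int m\<bar> \<le> 2 * real N"
  shows "cauchy_mean M m (\<lambda>x. f x - good N x) y = (\<Sum>I\<in>S. cauchy_mean M m (bad m I) y)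
    + cauchy_mean M m (small_error N m) y + (low_part M N m y + high_part M N m y)"
proof -
  have i1: "integrable \<mu> (\<lambda>x. \<Sum>I\<in>S. bad m I x)" using integrable_bad by simp
  have i2: "integrable \<mu> (small_error N m)"
    by (rule integrable_torus_bounded[where B = "6 * lam"]) (auto intro: norm_small_error_le[OF m])
  have i3: "integrable \<mu> (\<lambda>x. ek m x * bumps (big N) m x)"
    by (rule integrable_torus_bounded[where B = "3 * lam"]) (use norm_bumps_le[OF big_small(3)] in \<open>auto simp: norm_mult\<close>)
  have "(\<lambda>x. f x - good N x) = (\<lambda>x. ((\<Sum>I\<in>S. bad m I x) + small_error N m x) + ek m x * bumps (big N) m x)"
    using f_minus_good by blast
  then have "cauchy_mean M m (\<lambda>x. f x - good N x) y
    = cauchy_mean M m (\<lambda>x. \<Sum>I\<in>S. bad m I x) y + cauchy_mean M m (small_error N m) y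
      + cauchy_mean M m (\<lambda>x. ek m x * bumps (big N) m x) y"
    using i1 i2 i3 by (simp only: cauchy_mean_add Bochner_Integration.integrable_add)
  then show ?thesis using integrable_bad by (simp only: cauchy_mean_big cauchy_mean_sum)
qed

text \<open>The term 4 lam is 3 lam for the Fejer mean of \<open>good N\<close> plus lam for the
  truncation; \<open>far\<close> is counted once for each of the ends -N and N + 1. The low parts
  are subtracted on the left because they become small only after averaging.\<close>

lemma partial_sum_decomposition:
  assumes "M > 0" and N: "N > 0" and y: "y \<in> torus" "y \<notin> (\<Union>I\<in>S. near I)"
    and M: "(2 * real N + 1) * ((B + 3 * lam) / sqrt (real M)) \<le> lam"
  shows "norm (fourier_partial_sum N f y - (low_part M N (- int N) y - low_part M N (int N + 1) y))
    \<le> 4 * lam + 2 * far y + norm (fejer_defect N whole y) + norm (fejer_defect N (bumps (big N) 0) y)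
      + norm (cauchy_mean M (- int N) (small_error N (- int N)) y) + norm (high_part M N (- int N) y)
      + norm (cauchy_mean M (int N + 1) (small_error N (int N + 1)) y) + norm (high_part M N (int N + 1) y)"
proof -
  define w where "w x = f x - good N x" for x
  have w: "w \<in> borel_measurable \<mu>" unfolding w_def by measurable
  have wB: "norm (w x) \<le> B + 3 * lam" if "x \<in> torus" for x
    unfolding w_def using f_bound[OF that] norm_good_le[OF that, of N] norm_triangle_ineq4[of "f x" "good N x"] by linarith
  have fw: "f = (\<lambda>x. good N x + w x)" by (auto simp: w_def)
  have "fourier_partial_sum N f y = fourier_partial_sum N (good N) y + fourier_partial_sum N w y"
    unfolding fourier_partial_sum_ek
    by (subst fw) (simp add: fourier_coeff_add[OF integrable_good integrable_torus_bounded[OF w wB]] distrib_right sum.distrib)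
  moreover have "fourier_partial_sum N (good N) y
      = fejer_mean N (good N) y + (fejer_defect N whole y - fejer_defect N (bumps (big N) 0) y)"
  proof -
    have "good N = (\<lambda>x. whole x - bumps (big N) 0 x)" by (auto simp: good_eq)
    then have "fejer_defect N (good N) y = fejer_defect N whole y - fejer_defect N (bumps (big N) 0) y"
      using fejer_defect_diff[OF integrable_whole integrable_bumps[OF big_small(3)]] by simp
    then show ?thesis by (simp add: partial_sum_eq_fejer_defect)
  qed
  moreover have "norm (fejer_mean N (good N) y) \<le> 3 * lam"
    by (rule norm_fejer_mean_le) (auto intro: norm_good_le)
  moreover have "norm (fourier_partial_sum N w y - (cauchy_mean M (- int N) w y - cauchy_mean M (int N + 1) w y)) \<le> lam"
    using partial_sum_cauchy_mean_error[OF assms(1) w wB] M by (rule order_trans)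
  moreover have "cauchy_mean M (- int N) w y = (\<Sum>I\<in>S. cauchy_mean M (- int N) (bad (- int N) I) y)
    + cauchy_mean M (- int N) (small_error N (- int N)) y + (low_part M N (- int N) y + high_part M N (- int N) y)"
    unfolding w_def by (rule cauchy_mean_remainder) simp
  moreover have "cauchy_mean M (int N + 1) w y = (\<Sum>I\<in>S. cauchy_mean M (int N + 1) (bad (int N + 1) I) y)
    + cauchy_mean M (int N + 1) (small_error N (int N + 1)) y + (low_part M N (int N + 1) y + high_part M N (int N + 1) y)"
    unfolding w_def by (rule cauchy_mean_remainder) (use N in simp)
  moreover have "norm (\<Sum>I\<in>S. cauchy_mean M (- int N) (bad (- int N) I) y) \<le> far y"
    "norm (\<Sum>I\<in>S. cauchy_mean M (int N + 1) (bad (int N + 1) I) y) \<le> far y"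
    using norm_cauchy_mean_bad_le[OF assms(1) y] by blast+
  \<comment> \<open>The triangle inequality is proved for free variables, which stand for the long
    terms above.\<close>
  moreover have "norm (x - (a - b)) \<le> 4 * lam + 2 * far y + norm d1 + norm d2 + norm s1 + norm h1 + norm s2 + norm h2"
    if "x = g + z" "g = fm + (d1 - d2)" "norm fm \<le> 3 * lam" "norm (z - (c1 - c2)) \<le> lam"
      "c1 = b1 + s1 + (a + h1)" "c2 = b2 + s2 + (b + h2)" "norm b1 \<le> far y" "norm b2 \<le> far y"
    for x a b g z fm d1 d2 c1 c2 b1 b2 s1 s2 h1 h2 :: complex
  proof -
    have "x - (a - b) = (fm + d1 - d2) + (z - (c1 - c2)) + ((b1 + s1 + h1) - (b2 + s2 + h2))"
      using that by (simp add: algebra_simps)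
    also have "norm \<dots> \<le> norm (fm + d1 - d2) + norm (z - (c1 - c2)) + norm ((b1 + s1 + h1) - (b2 + s2 + h2))"
      by (intro order_trans[OF norm_triangle_ineq] add_mono order_refl norm_triangle_ineq)
    also have "norm (fm + d1 - d2) \<le> norm fm + norm d1 + norm d2"
      by (intro order_trans[OF norm_triangle_ineq4] add_mono order_refl norm_triangle_ineq)
    also have "norm ((b1 + s1 + h1) - (b2 + s2 + h2)) \<le> (norm b1 + norm s1 + norm h1) + (norm b2 + norm s2 + norm h2)"
      by (intro order_trans[OF norm_triangle_ineq4] add_mono order_trans[OF norm_triangle_ineq] order_refl norm_triangle_ineq)
    finally show ?thesis using that by simp
  qed
  ultimately show ?thesis by blast
qed

text \<open>Outside one exceptional set every error at every j up to J is at most lam, and so are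
  the averaged low parts.\<close>

lemma weak_bound: "maximal_bound n weak_const 14 {1..J} f lam"
proof -
  have B0: "B \<ge> 0" using f_bound[of 0] by (auto simp: torus_def intro: order_trans[OF norm_ge_zero])
  define L where "L = Max (n ` {1..J})"
  have L: "n j \<le> L" if "j \<in> {1..J}" for j unfolding L_def using that by (intro Max_ge) auto
  \<comment> \<open>Solves for the root of M that brings the truncation error below lam for all n_j
    with j up to J.\<close>
  define X where "X = (2 * real L + 1) * (B + 3 * lam) / lam"
  define M where "M = nat \<lceil>X^2\<rceil> + 1"
  have M0: "M > 0" by (simp add: M_def)
  have X0: "X \<ge> 0" unfolding X_def using B0 lam by simp
  have XM: "X \<le> sqrt (real M)"
  proof (rule real_le_rsqrt)
    show "X^2 \<le> real M" unfolding M_def by linarith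
  qed
  have Mj: "(2 * real (n j) + 1) * ((B + 3 * lam) / sqrt (real M)) \<le> lam" if "j \<in> {1..J}" for j
  proof -
    have "(2 * real (n j) + 1) * (B + 3 * lam) \<le> (2 * real L + 1) * (B + 3 * lam)"
      using L[OF that] B0 lam by (intro mult_right_mono) auto
    also have "\<dots> = X * lam" using lam by (simp add: X_def)
    also have "\<dots> \<le> sqrt (real M) * lam" using XM lam by (intro mult_right_mono) auto
    finally show ?thesis using M0 by (simp add: divide_le_eq mult.commute)
  qed
  define mu where "mu j = - int (n j)" for j
  define mv where "mv j = int (n j) + 1" for j
  \<comment> \<open>A bound on this square sum controls all j at once, while its integral is bounded
    independently of J.\<close>
  define sq where "sq h y = (\<Sum>j = 1..J. (norm (h j y :: complex))^2)" for h and y :: real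
  define e1 where "e1 j = fejer_defect (n j) whole" for j
  define e2 where "e2 j = fejer_defect (n j) (bumps (big (n j)) 0)" for j
  define e3 where "e3 j = cauchy_mean M (mu j) (small_error (n j) (mu j))" for j
  define e4 where "e4 j = cauchy_mean M (mv j) (small_error (n j) (mv j))" for j
  define e5 where "e5 j = high_part M (n j) (mu j)" for j
  define e6 where "e6 j = high_part M (n j) (mv j)" for j
  define D where "D y = sq e1 y + sq e2 y + sq e3 y + sq e4 y + sq e5 y + sq e6 y" for y
  have ij: "integrable \<mu> (\<lambda>y. (norm (e1 j y))^2)" "integrable \<mu> (\<lambda>y. (norm (e2 j y))^2)"
    "integrable \<mu> (\<lambda>y. (norm (e3 j y))^2)" "integrable \<mu> (\<lambda>y. (norm (e4 j y))^2)"
    "integrable \<mu> (\<lambda>y. (norm (e5 j y))^2)" "integrable \<mu> (\<lambda>y. (norm (e6 j y))^2)" for j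
    unfolding e1_def e2_def e3_def e4_def e5_def e6_def
    by (rule integrable_fejer_defect_square integrable_cauchy_mean_square integrable_trig_square[OF high_part_def])+
  have isq: "integrable \<mu> (sq e1)" "integrable \<mu> (sq e2)" "integrable \<mu> (sq e3)"
    "integrable \<mu> (sq e4)" "integrable \<mu> (sq e5)" "integrable \<mu> (sq e6)"
    unfolding sq_def[abs_def] using ij by (auto intro!: Bochner_Integration.integrable_sum)
  have lsq: "(LINT y|\<mu>. sq h y) = (\<Sum>j = 1..J. energy (h j))"
    if "\<And>j. integrable \<mu> (\<lambda>y. (norm (h j y))^2)" for h
    unfolding sq_def using that by (rule Bochner_Integration.integral_sum)
  have b1: "(LINT y|\<mu>. sq e1 y) \<le> 22 * ratio_sum * lam * norm1"
    unfolding lsq[OF ij(1)] e1_def by (rule sum_integral_defect_whole)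
  have b2: "(LINT y|\<mu>. sq e2 y) \<le> 144 * ratio_sum * lam * norm1"
    unfolding lsq[OF ij(2)] e2_def by (rule sum_integral_defect_bumps)
  have b3: "(LINT y|\<mu>. sq e3 y) \<le> 36 * ratio_sum * lam * norm1"
    unfolding lsq[OF ij(3)] e3_def by (rule sum_integral_small_error) (simp add: mu_def)
  have b4: "(LINT y|\<mu>. sq e4 y) \<le> 36 * ratio_sum * lam * norm1"
    unfolding lsq[OF ij(4)] e4_def
  proof (rule sum_integral_small_error)
    fix j :: nat assume "j \<ge> 1"
    then show "\<bar>of_int (mv j)\<bar> \<le> 2 * real (n j)" using pos[of j] by (simp add: mv_def)
  qed
  have b5: "(LINT y|\<mu>. sq e5 y) \<le> 144 / gap^2 * ratio_sum * lam * norm1"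
    unfolding lsq[OF ij(5)] e5_def by (rule sum_integral_high_part)
  have b6: "(LINT y|\<mu>. sq e6 y) \<le> 144 / gap^2 * ratio_sum * lam * norm1"
    unfolding lsq[OF ij(6)] e6_def by (rule sum_integral_high_part)
  have Dint: "integrable \<mu> D" unfolding D_def[abs_def] using isq by (intro Bochner_Integration.integrable_add)
  have "(LINT y|\<mu>. D y) = (LINT y|\<mu>. sq e1 y) + (LINT y|\<mu>. sq e2 y) + (LINT y|\<mu>. sq e3 y)
      + (LINT y|\<mu>. sq e4 y) + (LINT y|\<mu>. sq e5 y) + (LINT y|\<mu>. sq e6 y)"
    unfolding D_def using isq by simp
  also have "\<dots> \<le> (238 + 288 / gap^2) * ratio_sum * lam * norm1"
  proof -
    have eq: "(238 + 288 / gap^2) * ratio_sum * lam * norm1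
      = 22 * ratio_sum * lam * norm1 + 144 * ratio_sum * lam * norm1 + 36 * ratio_sum * lam * norm1 + 36 * ratio_sum * lam * norm1
        + 144 / gap^2 * ratio_sum * lam * norm1 + 144 / gap^2 * ratio_sum * lam * norm1"
      by (simp add: algebra_simps)
    show ?thesis unfolding eq by (intro add_mono b1 b2 b3 b4 b5 b6)
  qed
  finally have Dle: "(LINT y|\<mu>. D y) \<le> (238 + 288 / gap^2) * ratio_sum * lam * norm1" .
  have sq0: "sq h y \<ge> 0" for h y unfolding sq_def by (simp add: sum_nonneg)
  have D0: "D y \<ge> 0" for y unfolding D_def using sq0 by simp
  obtain Du where Du: "integrable \<mu> Du" "\<And>x. 0 \<le> Du x" "(LINT x|\<mu>. Du x) \<le> 180 * lam * norm1"
    "\<And>x N. 1 \<le> N \<Longrightarrow> N \<le> J \<Longrightarrow> (norm ((\<Sum>j = 1..N. low_part M (n j) (mu j) x) / of_nat N))^2 \<le> Du x"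
    using maximal_low_part[where m = mu and M = M and J = J] inj_lower[where M = M] unfolding mu_def by blast
  obtain Dv where Dv: "integrable \<mu> Dv" "\<And>x. 0 \<le> Dv x" "(LINT x|\<mu>. Dv x) \<le> 180 * lam * norm1"
    "\<And>x N. 1 \<le> N \<Longrightarrow> N \<le> J \<Longrightarrow> (norm ((\<Sum>j = 1..N. low_part M (n j) (mv j) x) / of_nat N))^2 \<le> Dv x"
    using maximal_low_part[where m = mv and M = M and J = J] inj_upper[where M = M] unfolding mv_def by blast
  define lev where "lev h t = {y \<in> space \<mu>. t \<le> (h y :: real)}" for h and t :: real
  have lev_sets: "lev h t \<in> sets \<mu>" if "integrable \<mu> h" for h t
  proof -
    have [measurable]: "h \<in> borel_measurable \<mu>" using that by simp
    show ?thesis unfolding lev_def by measurable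
  qed
  have lev_measure: "measure \<mu> (lev h t) \<le> c / t"
    if "integrable \<mu> h" "\<And>y. 0 \<le> h y" "t > 0" "(LINT y|\<mu>. h y) \<le> c" for h t c
  proof -
    have "measure \<mu> (lev h t) \<le> (LINT y|\<mu>. h y) / t"
      unfolding lev_def using that by (intro integral_Markov_inequality_measure[where A = "{}"]) auto
    also have "\<dots> \<le> c / t" using that by (intro divide_right_mono) auto
    finally show ?thesis .
  qed
  define E0 where "E0 = (\<Union>I\<in>S. near I)"
  \<comment> \<open>The level is lam^2 for the quadratic quantities, whose integrals are of order
    lam times the L^1 norm, and lam for \<open>far\<close>; Markov's inequality gives the order norm
    / lam in each case.\<close>
  define E where "E = E0 \<union> lev D (lam^2) \<union> lev Du (lam^2) \<union> lev Dv (lam^2) \<union> lev far lam"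
  have E0s: "E0 \<in> sets \<mu>" unfolding E0_def using fin by (intro sets.finite_UN) auto
  have Es: "E \<in> sets \<mu>"
    unfolding E_def by (intro sets.Un E0s lev_sets Dint Du Dv integrable_far)
  have mE0: "measure \<mu> E0 \<le> 12 * norm1 / lam"
  proof -
    have "measure \<mu> E0 \<le> (\<Sum>I\<in>S. measure \<mu> (near I))"
      unfolding E0_def using fin by (intro torus.finite_measure_subadditive_finite) auto
    also have "\<dots> \<le> (\<Sum>I\<in>S. 12 * len I)" using ti by (intro sum_mono measure_near_le) auto
    also have "\<dots> = 12 * (\<Sum>I\<in>S. len I)" by (simp add: sum_distrib_left)
    also have "\<dots> \<le> 12 * (norm1 / lam)"
      using sum_len_le lam by (intro mult_left_mono) (auto simp: le_divide_eq mult.commute)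
    finally show ?thesis by simp
  qed
  have l2: "lam^2 > 0" using lam by simp
  have m1: "measure \<mu> (lev D (lam^2)) \<le> (238 + 288 / gap^2) * ratio_sum * norm1 / lam"
    using lev_measure[OF Dint D0 l2 Dle] lam by (simp add: power2_eq_square)
  have m2: "measure \<mu> (lev Du (lam^2)) \<le> 180 * norm1 / lam"
    using lev_measure[OF Du(1,2) l2 Du(3)] lam by (simp add: power2_eq_square)
  have m3: "measure \<mu> (lev Dv (lam^2)) \<le> 180 * norm1 / lam"
    using lev_measure[OF Dv(1,2) l2 Dv(3)] lam by (simp add: power2_eq_square)
  have m4: "measure \<mu> (lev far lam) \<le> 96 * pi * norm1 / lam"
    by (rule lev_measure[OF integrable_far far_nonneg lam integral_far_le])
  have "measure \<mu> E \<le> measure \<mu> E0 + measure \<mu> (lev D (lam^2))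
      + measure \<mu> (lev Du (lam^2)) + measure \<mu> (lev Dv (lam^2)) + measure \<mu> (lev far lam)"
    unfolding E_def
    by (intro order_trans[OF measure_Un_le] add_mono order_refl sets.Un E0s lev_sets Dint Du Dv integrable_far)
  also have "\<dots> \<le> 12 * norm1 / lam + (238 + 288 / gap^2) * ratio_sum * norm1 / lam + 180 * norm1 / lam + 180 * norm1 / lam
      + 96 * pi * norm1 / lam"
    by (intro add_mono mE0 m1 m2 m3 m4)
  also have "\<dots> = weak_const * norm1 / lam"
    unfolding weak_const_def by (simp add: algebra_simps add_divide_distrib)
  finally have mE: "measure \<mu> E \<le> weak_const * norm1 / lam" .
  have "norm (average n f N y) \<le> 14 * lam"
    if y: "y \<in> torus" "y \<notin> E" and N: "1 \<le> N" "N \<le> J" for y N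
  proof -
    have small: "D y \<le> lam^2" "Du y \<le> lam^2" "Dv y \<le> lam^2" "far y \<le> lam" "y \<notin> (\<Union>I\<in>S. near I)"
      using y by (auto simp: E_def lev_def E0_def)
    have le: "norm (h j y) \<le> lam" if "sq h y \<le> D y" "j \<in> {1..J}" for h j
    proof (rule power2_le_imp_le)
      have "(norm (h j y))^2 \<le> sq h y" unfolding sq_def using that(2) by (intro member_le_sum) auto
      then show "(norm (h j y))^2 \<le> lam^2" using that(1) small(1) by linarith
    qed (use lam in simp)
    have sqD: "sq e1 y \<le> D y" "sq e2 y \<le> D y" "sq e3 y \<le> D y" "sq e4 y \<le> D y" "sq e5 y \<le> D y" "sq e6 y \<le> D y"
      unfolding D_def using sq0[of e1 y] sq0[of e2 y] sq0[of e3 y] sq0[of e4 y] sq0[of e5 y] sq0[of e6 y] by linarith+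
    \<comment> \<open>Here 12 = 4 + 2 + 6: twice \<open>far\<close> and six errors of size at most
      lam. The two averaged low parts later raise 12 to 14.\<close>
    have trm: "norm (fourier_partial_sum (n j) f y - (low_part M (n j) (mu j) y - low_part M (n j) (mv j) y)) \<le> 12 * lam"
      if j: "j \<in> {1..N}" for j
    proof -
      have jJ: "j \<in> {1..J}" using j N by simp
      then have "n j > 0" using pos by simp
      note dec = partial_sum_decomposition[OF M0 this y(1) small(5) Mj[OF jJ]]
      show ?thesis
        using dec small(4) le[OF sqD(1) jJ] le[OF sqD(2) jJ] le[OF sqD(3) jJ] le[OF sqD(4) jJ] le[OF sqD(5) jJ] le[OF sqD(6) jJ]
        unfolding e1_def e2_def e3_def e4_def e5_def e6_def mu_def mv_def by linarith
    qed
    have N0: "real N > 0" using N by simp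
    have u: "norm ((\<Sum>j = 1..N. low_part M (n j) (mu j) y) / of_nat N) \<le> lam"
      by (rule power2_le_imp_le[OF order_trans[OF Du(4)[OF N] small(2)] less_imp_le[OF lam]])
    have v: "norm ((\<Sum>j = 1..N. low_part M (n j) (mv j) y) / of_nat N) \<le> lam"
      by (rule power2_le_imp_le[OF order_trans[OF Dv(4)[OF N] small(3)] less_imp_le[OF lam]])
    define R where "R = (\<Sum>j = 1..N. fourier_partial_sum (n j) f y - (low_part M (n j) (mu j) y - low_part M (n j) (mv j) y))"
    have "norm R \<le> real (card {1..N}) * (12 * lam)" unfolding R_def by (rule sum_norm_bound) (rule trm)
    then have R: "norm (R / of_nat N) \<le> 12 * lam" using N0 by (simp add: norm_divide divide_le_eq mult_ac)
    have "average n f N y = R / of_nat N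
       + ((\<Sum>j = 1..N. low_part M (n j) (mu j) y) / of_nat N - (\<Sum>j = 1..N. low_part M (n j) (mv j) y) / of_nat N)"
      by (simp add: R_def average_def sum_subtractf diff_divide_distrib)
    also have "norm \<dots> \<le> 12 * lam + (lam + lam)"
      by (intro order_trans[OF norm_triangle_ineq] add_mono R order_trans[OF norm_triangle_ineq4] u v)
    finally show ?thesis by simp
  qed
  then show ?thesis using Es mE unfolding maximal_bound_def norm1_def by (intro bexI[of _ E]) auto
qed

end

lemma maximal_bound_mono:
  assumes "maximal_bound n C K J f lam" "C \<le> C'" "lam > 0"
  shows "maximal_bound n C' K J f lam"
proof -
  have "C * L1_norm f / lam \<le> C' * L1_norm f / lam"
    using assms(2,3) by (intro divide_right_mono mult_right_mono) auto
  then show ?thesis using assms(1) unfolding maximal_bound_def by (meson order_trans)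
qed

lemma (in lacunary_sequence) weak_type_continuous:
  fixes f :: "real \<Rightarrow> complex"
  assumes f: "continuous_on UNIV f" and lam: "lam > 0"
  shows "maximal_bound n (max 1 weak_const) 14 {1..J} f lam"
proof -
  define \<phi> where "\<phi> x = norm (f x)" for x
  have cont: "continuous_on A \<phi>" for A
    unfolding \<phi>_def using continuous_on_subset[OF f] by (intro continuous_intros) auto
  show ?thesis
  proof (cases "integral {-pi..pi} \<phi> \<le> lam * (2 * pi)")
    case False
    have "L1_norm f = integral {-pi..pi} \<phi>"
      using integral_torus_continuous[OF cont] by (simp add: \<phi>_def)
    \<comment> \<open>If the mean of |f| exceeds lam, the whole torus is an admissible exceptional
      set with constant 1; hence the maximum with 1 in the constant.\<close>
    then have "measure \<mu> torus \<le> 1 * L1_norm f / lam"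
      using lam False by (simp add: measure_space_torus le_divide_eq mult.commute)
    then have "maximal_bound n 1 14 {1..J} f lam" unfolding maximal_bound_def by (intro bexI[of _ torus]) auto
    then show ?thesis by (rule maximal_bound_mono) (use lam in auto)
  next
    case True
    obtain S where S: "finite S" "disjoint_family_on ivl S" "\<And>I. I \<in> S \<Longrightarrow> torus_interval I"
      "\<And>I. I \<in> S \<Longrightarrow> lam * len I \<le> integral {fst I..snd I} \<phi>"
      "\<And>I. I \<in> S \<Longrightarrow> integral {fst I..snd I} \<phi> \<le> 2 * lam * len I"
      "\<And>x. x \<in> torus \<Longrightarrow> x \<notin> (\<Union>I\<in>S. ivl I) \<Longrightarrow> \<phi> x \<le> 2 * lam"
    proof (rule calderon_zygmund[OF cont lam _ True])
      show "x \<in> {-pi..pi} \<Longrightarrow> 0 \<le> \<phi> x" for x by (simp add: \<phi>_def)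
    qed (rule that)
    have "compact (f ` {-pi..pi})" using f by (intro compact_continuous_image) (auto intro: continuous_on_subset)
    then obtain B where B: "\<And>x. x \<in> {-pi..pi} \<Longrightarrow> norm (f x) \<le> B"
      by (metis bounded_iff compact_imp_bounded imageI)
    have ind: "(LINT x|\<mu>. indicator (ivl I) x * norm (f x)) = integral {fst I..snd I} \<phi>" if "I \<in> S" for I
      using integral_torus_interval[of "fst I" "snd I" \<phi>] torus_intervalD[OF S(3)[OF that]] cont
      by (simp add: ivl_def \<phi>_def)
    interpret cz_lacunary f lam S B n q
    proof
      show "f \<in> borel_measurable \<mu>"
        using f by (intro borel_measurable_torus_continuous) (auto intro: continuous_on_subset)
      show "x \<in> torus \<Longrightarrow> norm (f x) \<le> B" for x using B by (auto simp: torus_def)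
    qed (use S ind lam in \<open>auto simp: \<phi>_def\<close>)
    show ?thesis by (rule maximal_bound_mono[OF weak_bound _ lam]) simp
  qed
qed

subsection \<open>Density of trigonometric polynomials\<close>

inductive trig_poly :: "(real \<Rightarrow> complex) \<Rightarrow> bool" where
  trig_poly_ek: "trig_poly (\<lambda>t. c * ek k t)"
| trig_poly_add: "trig_poly p \<Longrightarrow> trig_poly r \<Longrightarrow> trig_poly (\<lambda>t. p t + r t)"

lemma trig_poly_const: "trig_poly (\<lambda>t. c)"
  using trig_poly_ek[of c 0] by simp

lemma trig_poly_mult_ek: "trig_poly p \<Longrightarrow> trig_poly (\<lambda>t. c * ek k t * p t)"
proof (induction rule: trig_poly.induct)
  case (trig_poly_ek d l)
  then show ?case using trig_poly.trig_poly_ek[of "c * d" "k + l"] by (simp add: ek_add mult_ac)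
next
  case (trig_poly_add p r)
  then show ?case using trig_poly.trig_poly_add by (simp add: distrib_left)
qed

lemma trig_poly_mult: "trig_poly p \<Longrightarrow> trig_poly r \<Longrightarrow> trig_poly (\<lambda>t. p t * r t)"
proof (induction rule: trig_poly.induct)
  case (trig_poly_ek c k)
  then show ?case by (rule trig_poly_mult_ek)
next
  case (trig_poly_add p p')
  then show ?case using trig_poly.trig_poly_add by (simp add: distrib_right)
qed

lemma continuous_on_trig_poly: "trig_poly p \<Longrightarrow> continuous_on A p"
  by (induction rule: trig_poly.induct) (auto intro!: continuous_intros)

lemma integrable_trig_poly: "trig_poly p \<Longrightarrow> integrable \<mu> p"
proof (induction rule: trig_poly.induct)
  case (trig_poly_ek c k)
  show ?case by (rule integrable_torus_bounded[where B = "norm c"]) (auto simp: norm_mult)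
qed simp

lemma fourier_coeff_single: "fourier_coeff (\<lambda>t. c * ek k t) l = (if l = k then c else 0)"
proof -
  have "(LINT t|\<mu>. c * ek k t * cnj (ek l t)) = (LINT t|\<mu>. c * ek (k - l) t)"
    by (simp only: ek_diff mult.assoc)
  then show ?thesis by (simp add: fourier_coeff_ek integral_ek)
qed

lemma partial_sum_trig_poly: "trig_poly p \<Longrightarrow> \<exists>N0. \<forall>n\<ge>N0. \<forall>y. fourier_partial_sum n p y = p y"
proof (induction rule: trig_poly.induct)
  case (trig_poly_ek c k)
  have "fourier_partial_sum n (\<lambda>t. c * ek k t) y = c * ek k y" if "n \<ge> nat \<bar>k\<bar>" for n y
  proof -
    have "fourier_partial_sum n (\<lambda>t. c * ek k t) y = (\<Sum>l = - int n..int n. if l = k then c * ek k y else 0)"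
      unfolding fourier_partial_sum_ek fourier_coeff_single by (intro sum.cong) auto
    also have "\<dots> = c * ek k y" using that by (subst sum.delta) auto
    finally show ?thesis .
  qed
  then show ?case by blast
next
  case (trig_poly_add p r)
  then obtain N1 N2 where N: "\<forall>n\<ge>N1. \<forall>y. fourier_partial_sum n p y = p y" "\<forall>n\<ge>N2. \<forall>y. fourier_partial_sum n r y = r y"
    by blast
  have "fourier_partial_sum n (\<lambda>t. p t + r t) y = fourier_partial_sum n p y + fourier_partial_sum n r y" for n y
    unfolding fourier_partial_sum_ek
    using fourier_coeff_add[OF integrable_trig_poly[OF trig_poly_add.hyps(1)] integrable_trig_poly[OF trig_poly_add.hyps(2)]]
    by (simp add: distrib_right sum.distrib)
  then show ?case using N by (intro exI[of _ "max N1 N2"]) auto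
qed

text \<open>The total deviation from L stops changing after \<open>N0\<close>, so the averages are L
  + c / N.\<close>

lemma averages_eventually_const:
  fixes x :: "nat \<Rightarrow> complex"
  assumes "\<And>j. j \<ge> N0 \<Longrightarrow> x j = L"
  shows "(\<lambda>N. (\<Sum>j = 1..N. x j) / of_nat N) \<longlonglongrightarrow> L"
proof -
  define c where "c = (\<Sum>j = 1..N0. x j - L)"
  have ev: "(\<Sum>j = 1..N. x j) / of_nat N = L + c / of_nat N" if N: "N \<ge> N0" "N > 0" for N
  proof -
    have "(\<Sum>j = 1..N. x j - L) = c"
      unfolding c_def by (rule sum.mono_neutral_right) (use N assms in auto)
    then have "(\<Sum>j = 1..N. x j) = of_nat N * L + c" by (simp add: sum_subtractf diff_eq_eq add.commute)
    then show ?thesis using N by (simp add: add_divide_distrib)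
  qed
  have "(\<lambda>N. L + c / of_nat N) \<longlonglongrightarrow> L + 0"
    by (intro tendsto_add tendsto_const lim_const_over_n)
  moreover have "eventually (\<lambda>N. L + c / of_nat N = (\<Sum>j = 1..N. x j) / of_nat N) sequentially"
    using eventually_ge_at_top[of "max N0 1"] by eventually_elim (rule ev[symmetric], auto)
  ultimately show ?thesis using Lim_transform_eventually by fastforce
qed

text \<open>A real-linear functional on the unit circle is a combination of cos and sin, hence of
  e_1 and e_-1; closure under sums and products covers all polynomials.\<close>

lemma trig_poly_real_polynomial: "real_polynomial_function P \<Longrightarrow> trig_poly (\<lambda>t. of_real (P (cis t)))"
proof (induction rule: real_polynomial_function.induct)
  case (linear f)
  interpret bounded_linear f by fact
  have f: "f (cis t) = cos t * f 1 + sin t * f \<i>" for t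
  proof -
    have "cis t = cos t *\<^sub>R 1 + sin t *\<^sub>R \<i>" by (simp add: complex_eq_iff)
    then show ?thesis by (simp only: add scaleR) simp
  qed
  have cs: "complex_of_real (cos t) = (1/2) * ek 1 t + (1/2) * ek (- 1) t"
    "complex_of_real (sin t) = (- \<i>/2) * ek 1 t + (\<i>/2) * ek (- 1) t" for t
    by (simp_all add: ek_def complex_eq_iff)
  have "complex_of_real (f (cis t)) = of_real (cos t) * of_real (f 1) + of_real (sin t) * of_real (f \<i>)" for t
    unfolding f by simp
  then have "complex_of_real (f (cis t)) = (of_real (f 1) / 2 - \<i> * of_real (f \<i>) / 2) * ek 1 t
      + (of_real (f 1) / 2 + \<i> * of_real (f \<i>) / 2) * ek (- 1) t" for t
    unfolding cs by (simp add: algebra_simps)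
  then show ?case by (simp only:) (intro trig_poly.intros)
next
  case (const c)
  show ?case by (rule trig_poly_const)
next
  case (add f g)
  then show ?case using trig_poly_add by simp
next
  case (mult f g)
  then show ?case using trig_poly_mult by simp
qed

text \<open>Periodicity turns H into a function on the unit circle, where Stone--Weierstrass
  applies.\<close>

lemma trig_poly_uniform_approx:
  fixes H :: "real \<Rightarrow> complex"
  assumes cont: "continuous_on {-pi..pi} H" and per: "H (- pi) = H pi" and e: "e > 0"
  obtains p where "trig_poly p" "\<And>t. t \<in> torus \<Longrightarrow> norm (H t - p t) \<le> e"
proof -
  define F where "F z = H (Arg z)" for z
  have F: "F (cis t) = H t" if t: "t \<in> {-pi..pi}" for t
  proof (cases "t = - pi")
    case True
    have "Arg (cis pi) = pi" by (intro cis_Arg_unique) (auto simp: sgn_div_norm)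
    moreover have "cis (- pi) = cis pi" by (simp add: complex_eq_iff)
    ultimately show ?thesis using True per by (simp only: F_def)
  next
    case False
    then have "Arg (cis t) = t" using t by (intro cis_Arg_unique) (auto simp: sgn_div_norm)
    then show ?thesis by (simp add: F_def)
  qed
  have onto: "\<exists>t\<in>{-pi..pi}. z = cis t" if "norm z = 1" for z
  proof -
    have "z \<noteq> 0" using that by auto
    then have "cis (Arg z) = z" using cis_Arg[of z] that by (simp add: sgn_div_norm)
    then show ?thesis using Arg_bounded[of z] by (intro bexI[of _ "Arg z"]) auto
  qed
  \<comment> \<open>\<open>Arg\<close> jumps at -1, so continuity cannot come from composition.
    Instead, the preimage of a closed set is the image under \<open>cis\<close> of a compact
    set.\<close>
  have "continuous_on (sphere 0 1) F"
  proof (subst continuous_on_closed_vimage, simp, intro allI impI)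
    fix T :: "complex set" assume "closed T"
    then have "closed (H -` T \<inter> {-pi..pi})" using cont continuous_on_closed_vimage[of "{-pi..pi}" H] by auto
    then have "compact ({-pi..pi} \<inter> (H -` T \<inter> {-pi..pi}))" by (intro compact_Int_closed) auto
    then have "compact (cis ` ({-pi..pi} \<inter> (H -` T \<inter> {-pi..pi})))"
      unfolding cis_conv_exp by (intro compact_continuous_image continuous_intros)
    moreover have "cis ` ({-pi..pi} \<inter> (H -` T \<inter> {-pi..pi})) = F -` T \<inter> sphere 0 1"
    proof (intro equalityI subsetI)
      fix z assume "z \<in> F -` T \<inter> sphere 0 1"
      then have z: "F z \<in> T" "norm z = 1" by auto
      obtain t where "t \<in> {-pi..pi}" "z = cis t" using onto[OF z(2)] by blast
      then show "z \<in> cis ` ({-pi..pi} \<inter> (H -` T \<inter> {-pi..pi}))" using z F by auto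
    qed (use F in auto)
    ultimately show "closed (F -` T \<inter> sphere 0 1)" by (simp add: compact_imp_closed)
  qed
  then obtain g where g: "polynomial_function g" "\<And>z. z \<in> sphere 0 1 \<Longrightarrow> norm (F z - g z) < e"
    using Stone_Weierstrass_polynomial_function[of "sphere 0 1" F e] e by (auto simp: compact_sphere)
  have "real_polynomial_function (Re \<circ> g)" "real_polynomial_function (Im \<circ> g)"
    using g(1) bounded_linear_Re bounded_linear_Im unfolding polynomial_function_def by blast+
  then have "trig_poly (\<lambda>t. of_real (Re (g (cis t))))" "trig_poly (\<lambda>t. of_real (Im (g (cis t))))"
    using trig_poly_real_polynomial[of "Re \<circ> g"] trig_poly_real_polynomial[of "Im \<circ> g"] by (simp_all add: o_def)
  then have "trig_poly (\<lambda>t. of_real (Re (g (cis t))) + \<i> * of_real (Im (g (cis t))))"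
    by (intro trig_poly_add trig_poly_mult[OF trig_poly_const])
  then have tp: "trig_poly (\<lambda>t. g (cis t))" by (simp flip: complex_eq)
  show ?thesis
  proof (rule that[OF tp])
    fix t assume t: "t \<in> torus"
    show "norm (H t - g (cis t)) \<le> e" using g(2)[of "cis t"] F[of t] t by (auto simp: torus_def)
  qed
qed

section \<open>Density in L^1 by truncation and cut-off\<close>

definition clamp_norm :: "real \<Rightarrow> complex \<Rightarrow> complex" where
  "clamp_norm b z = of_real (b / max b (norm z)) * z"

lemma norm_clamp_norm_le:
  assumes "b > 0"
  shows "norm (clamp_norm b z) \<le> b" "norm (clamp_norm b z) \<le> norm z"
proof -
  have m: "max b (norm z) > 0" using assms by simp
  have eq: "norm (clamp_norm b z) = b * norm z / max b (norm z)"
    using m assms by (simp add: clamp_norm_def norm_mult abs_mult del: of_real_divide)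
  have "b * norm z \<le> b * max b (norm z)" using assms by (intro mult_left_mono) auto
  then show "norm (clamp_norm b z) \<le> b" unfolding eq using m by (simp add: divide_le_eq)
  have "b * norm z \<le> max b (norm z) * norm z" by (intro mult_right_mono) auto
  then show "norm (clamp_norm b z) \<le> norm z" unfolding eq using m by (simp add: divide_le_eq mult.commute)
qed

lemma clamp_norm_id: "b > 0 \<Longrightarrow> norm z \<le> b \<Longrightarrow> clamp_norm b z = z"
  by (simp add: clamp_norm_def max_def)

lemma continuous_on_clamp_norm: "b > 0 \<Longrightarrow> continuous_on A (clamp_norm b)"
  unfolding clamp_norm_def[abs_def] by (intro continuous_intros) auto

lemma integral_approx:
  fixes g :: "real \<Rightarrow> complex"
  assumes lim: "AE x in \<mu>. (\<lambda>i. u i x) \<longlonglongrightarrow> g x"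
    and meas: "\<And>i. u i \<in> borel_measurable \<mu>" "g \<in> borel_measurable \<mu>"
    and dom: "integrable \<mu> w" "\<And>i x. x \<in> torus \<Longrightarrow> norm (u i x) \<le> w x" "\<And>x. x \<in> torus \<Longrightarrow> norm (g x) \<le> w x" and e: "e > 0"
  obtains i where "(LINT x|\<mu>. norm (g x - u i x)) < e"
proof -
  have "(\<lambda>i. LINT x|\<mu>. norm (g x - u i x)) \<longlonglongrightarrow> (LINT x|\<mu>. 0)"
  proof (rule integral_dominated_convergence[where w = "\<lambda>x. 2 * w x"])
    show "AE x in \<mu>. (\<lambda>i. norm (g x - u i x)) \<longlonglongrightarrow> 0"
      using lim
    proof eventually_elim
      case (elim x)
      then have "(\<lambda>i. g x - u i x) \<longlonglongrightarrow> g x - g x" by (intro tendsto_diff tendsto_const)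
      then show ?case by (intro tendsto_norm_zero) simp
    qed
    show "AE x in \<mu>. norm (norm (g x - u i x)) \<le> 2 * w x" for i
    proof (rule AE_I2)
      fix x assume "x \<in> space \<mu>"
      then show "norm (norm (g x - u i x)) \<le> 2 * w x"
        using dom(2)[of x i] dom(3)[of x] norm_triangle_ineq4[of "g x" "u i x"] by simp
    qed
  qed (use meas dom in auto)
  then have "eventually (\<lambda>i. (LINT x|\<mu>. norm (g x - u i x)) < e) sequentially"
    using e by (intro order_tendstoD(2)) auto
  then show ?thesis using that eventually_happens'[OF sequentially_bot] by blast
qed

text \<open>Three approximations, each costing less than e / 3: clamp f to a bounded function,
  replace it by a continuous periodic one, and approximate that uniformly.\<close>

lemma trig_poly_L1_dense:
  assumes f: "integrable \<mu> f" and e: "e > 0"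
  obtains p where "trig_poly p" "(LINT x|\<mu>. norm (f x - p x)) < e"
proof -
  have fm [measurable]: "f \<in> borel_measurable \<mu>" using f by simp
  have cm: "(\<lambda>x. clamp_norm b (u x)) \<in> borel_measurable \<mu>" if "b > 0" "u \<in> borel_measurable \<mu>" for b u
    using borel_measurable_continuous_on[OF continuous_on_clamp_norm[OF that(1)] that(2)] .
  have "AE x in \<mu>. (\<lambda>i. clamp_norm (real (Suc i)) (f x)) \<longlonglongrightarrow> f x"
  proof (rule AE_I2)
    fix x
    obtain k where k: "norm (f x) \<le> real k" using real_arch_simple by blast
    have "eventually (\<lambda>i. f x = clamp_norm (real (Suc i)) (f x)) sequentially"
      using eventually_ge_at_top[of k] by eventually_elim (use k in \<open>auto intro!: clamp_norm_id[symmetric]\<close>)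
    then show "(\<lambda>i. clamp_norm (real (Suc i)) (f x)) \<longlonglongrightarrow> f x" by (rule tendsto_eventually[OF eventually_mono]) auto
  qed
  then obtain i where i: "(LINT x|\<mu>. norm (f x - clamp_norm (real (Suc i)) (f x))) < e / 3"
    by (rule integral_approx[where w = "\<lambda>x. norm (f x)" and e = "e / 3"])
      (use f e in \<open>auto intro!: cm norm_clamp_norm_le\<close>)
  define b where "b = real (Suc i)"
  have b: "b > 0" by (simp add: b_def)
  \<comment> \<open>\<open>measurable_on\<close> provides continuous functions converging to f off a
    null set; clamped, they converge in L^1 by dominated convergence.\<close>
  have "f measurable_on torus" using measurable_on_iff_borel_measurable[of torus f] by simp
  then obtain Z g where Z: "negligible Z" and g: "\<And>i. continuous_on UNIV (g i)"
    and lim: "\<And>x. x \<notin> Z \<Longrightarrow> (\<lambda>i. g i x) \<longlonglongrightarrow> (if x \<in> torus then f x else 0)"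
    unfolding measurable_on_def by metis
  \<comment> \<open>A cut-off vanishing at both ends of the torus makes the approximants periodic;
    it tends to 1 inside.\<close>
  define \<psi> where "\<psi> i x = min 1 (real i * (pi - \<bar>x\<bar>))" for i :: nat and x :: real
  define H where "H i x = of_real (\<psi> i x) * clamp_norm b (g i x)" for i x
  have Hc: "continuous_on A (H i)" for A i
  proof -
    have "continuous_on A (\<lambda>x. clamp_norm b (g i x))"
      by (rule continuous_on_compose2[OF continuous_on_clamp_norm[OF b, of UNIV] continuous_on_subset[OF g]]) auto
    then show ?thesis unfolding H_def \<psi>_def by (intro continuous_intros)
  qed
  have Hm: "H i \<in> borel_measurable \<mu>" for i by (intro borel_measurable_torus_continuous Hc)
  have Hb: "norm (H i x) \<le> b" if "x \<in> torus" for i x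
  proof -
    have "\<bar>\<psi> i x\<bar> \<le> 1" using that by (auto simp: \<psi>_def torus_def abs_le_iff)
    then have "norm (H i x) \<le> 1 * norm (clamp_norm b (g i x))"
      unfolding H_def norm_mult by (intro mult_right_mono) auto
    then show ?thesis using norm_clamp_norm_le(1)[OF b, of "g i x"] by simp
  qed
  have "AE x in \<mu>. (\<lambda>i. H i x) \<longlonglongrightarrow> clamp_norm b (f x)"
  proof -
    \<comment> \<open>At -pi the cut-off stays 0, so this point joins the null set.\<close>
    have "negligible (insert (- pi) Z)" using Z by simp
    then have "AE x in lebesgue. x \<notin> insert (- pi) Z" unfolding negligible_iff_null_sets by (rule AE_not_in)
    then have "AE x in \<mu>. x \<notin> insert (- pi) Z"
      by (subst AE_restrict_space_iff) (auto simp del: insert_iff)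
    then show ?thesis
    proof (rule AE_mp, intro AE_I2 impI)
      fix x assume x: "x \<in> space \<mu>" "x \<notin> insert (- pi) Z"
      then have xt: "x \<in> torus" and xp: "\<bar>x\<bar> < pi" by (auto simp: torus_def)
      have "(\<lambda>i. g i x) \<longlonglongrightarrow> f x" using lim[of x] x by simp
      then have "(\<lambda>i. clamp_norm b (g i x)) \<longlonglongrightarrow> clamp_norm b (f x)"
        by (intro continuous_on_tendsto_compose[OF continuous_on_clamp_norm[OF b, of UNIV]]) auto
      moreover have "(\<lambda>i. of_real (\<psi> i x)) \<longlonglongrightarrow> (1 :: complex)"
      proof (rule tendsto_eventually)
        obtain k :: nat where k: "1 < real k * (pi - \<bar>x\<bar>)" using reals_Archimedean3[of "pi - \<bar>x\<bar>"] xp by auto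
        show "eventually (\<lambda>i. of_real (\<psi> i x) = (1 :: complex)) sequentially"
          using eventually_ge_at_top[of k]
        proof eventually_elim
          case (elim j)
          then have "real k * (pi - \<bar>x\<bar>) \<le> real j * (pi - \<bar>x\<bar>)" using xp by (intro mult_right_mono) auto
          then show ?case using k by (simp add: \<psi>_def min_def)
        qed
      qed
      ultimately have "(\<lambda>i. of_real (\<psi> i x) * clamp_norm b (g i x)) \<longlonglongrightarrow> 1 * clamp_norm b (f x)" by (intro tendsto_mult)
      then show "(\<lambda>i. H i x) \<longlonglongrightarrow> clamp_norm b (f x)" by (simp add: H_def)
    qed
  qed
  then obtain k where k: "(LINT x|\<mu>. norm (clamp_norm b (f x) - H k x)) < e / 3"
    by (rule integral_approx[where w = "\<lambda>x. b" and e = "e / 3"])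
      (use e b Hb cm[OF b fm] Hm norm_clamp_norm_le(1)[OF b] in auto)
  have per: "H k (- pi) = H k pi" by (simp add: H_def \<psi>_def)
  \<comment> \<open>The uniform error is chosen so that its integral 2 pi e / (6 pi + 1) is below e
    / 3.\<close>
  obtain p where p: "trig_poly p" "\<And>t. t \<in> torus \<Longrightarrow> norm (H k t - p t) \<le> e / (6 * pi + 1)"
    using trig_poly_uniform_approx[OF Hc per, of "e / (6 * pi + 1)"] e by (auto simp: add_pos_pos)
  have ci: "integrable \<mu> (\<lambda>x. clamp_norm b (f x))"
    using cm[OF b fm] norm_clamp_norm_le(1)[OF b] by (intro integrable_torus_bounded[where B = b]) auto
  have Hi: "integrable \<mu> (H k)" using Hm Hb by (intro integrable_torus_bounded[where B = b]) auto
  note ints = f ci Hi integrable_trig_poly[OF p(1)]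
  have "(LINT x|\<mu>. norm (f x - p x)) \<le> (LINT x|\<mu>.
      (norm (f x - clamp_norm b (f x)) + norm (clamp_norm b (f x) - H k x)) + norm (H k x - p x))"
  proof (rule integral_mono)
    show "norm (f x - p x) \<le> (norm (f x - clamp_norm b (f x)) + norm (clamp_norm b (f x) - H k x)) + norm (H k x - p x)" for x
    proof -
      have "f x - p x = ((f x - clamp_norm b (f x)) + (clamp_norm b (f x) - H k x)) + (H k x - p x)" by simp
      then show ?thesis by (metis norm_triangle_mono norm_triangle_ineq order_refl)
    qed
  qed (use ints in auto)
  also have "\<dots> = (LINT x|\<mu>. norm (f x - clamp_norm b (f x))) + (LINT x|\<mu>. norm (clamp_norm b (f x) - H k x))
      + (LINT x|\<mu>. norm (H k x - p x))"
    using ints by simp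
  also have "(LINT x|\<mu>. norm (H k x - p x)) \<le> (LINT x|\<mu>. e / (6 * pi + 1))"
    using ints p(2) by (intro integral_mono) auto
  also have "\<dots> = 2 * pi * (e / (6 * pi + 1))" by (simp add: measure_space_torus)
  also have "\<dots> < e / 3"
  proof -
    have "6 * pi + 1 > 0" by (simp add: add_pos_pos)
    then show ?thesis using e by (simp add: divide_less_eq field_simps)
  qed
  finally have "(LINT x|\<mu>. norm (f x - p x)) < e" using i k unfolding b_def by linarith
  then show ?thesis using that p(1) by blast
qed

subsection \<open>Almost everywhere convergence\<close>

lemma norm_partial_sum_le:
  assumes "integrable \<mu> f"
  shows "norm (fourier_partial_sum n f y) \<le> (2 * real n + 1) * L1_norm f"
proof -
  have "norm (fourier_partial_sum n f y) \<le> (\<Sum>k = - int n..int n. L1_norm f / (2 * pi))"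
    unfolding fourier_partial_sum_ek
    by (intro sum_norm_le) (simp add: norm_mult norm_fourier_coeff_le[OF assms])
  also have "\<dots> = (2 * real n + 1) * (L1_norm f / (2 * pi))" by simp
  also have "\<dots> \<le> (2 * real n + 1) * L1_norm f"
  proof (intro mult_left_mono)
    have "L1_norm f / (2 * pi) \<le> L1_norm f / 1"
      using pi_ge_two by (intro divide_left_mono) auto
    then show "L1_norm f / (2 * pi) \<le> L1_norm f" by simp
  qed auto
  finally show ?thesis .
qed

lemma partial_sum_diff:
  assumes "integrable \<mu> f" "integrable \<mu> g"
  shows "fourier_partial_sum n (\<lambda>x. f x - g x) y = fourier_partial_sum n f y - fourier_partial_sum n g y"
  by (simp only: fourier_partial_sum_ek fourier_coeff_diff[OF assms] left_diff_distrib sum_subtractf)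

lemma continuous_on_partial_sum: "continuous_on A (fourier_partial_sum n f)"
  unfolding fourier_partial_sum_ek[abs_def] by (intro continuous_intros)

text \<open>The points where P fails lie in the intersection of sets of measure at most 1 / (i +
  1).\<close>

lemma AE_by_small_sets:
  assumes "finite_measure M"
    and small: "\<And>e. e > 0 \<Longrightarrow> \<exists>F\<in>sets M. measure M F \<le> e \<and> (\<forall>x\<in>space M - F. P x)"
  shows "AE x in M. P x"
proof -
  interpret finite_measure M by fact
  have "\<exists>F. \<forall>i. F i \<in> sets M \<and> measure M (F i) \<le> 1 / real (Suc i) \<and> (\<forall>x\<in>space M - F i. P x)"
  proof (rule choice, rule allI)
    fix i
    show "\<exists>F. F \<in> sets M \<and> measure M F \<le> 1 / real (Suc i) \<and> (\<forall>x\<in>space M - F. P x)"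
      using small[of "1 / real (Suc i)"] by auto
  qed
  then obtain F where F: "\<And>i. F i \<in> sets M" "\<And>i. measure M (F i) \<le> 1 / real (Suc i)"
    "\<And>i x. x \<in> space M - F i \<Longrightarrow> P x" by blast
  define Z where "Z = (\<Inter>i. F i)"
  have Z: "Z \<in> sets M" unfolding Z_def using F(1) by auto
  have "measure M Z \<le> 1 / real (Suc i)" for i
    using finite_measure_mono[of Z "F i"] F(1,2)[of i] unfolding Z_def by (auto intro: order_trans)
  then have "measure M Z \<le> 0"
    using LIMSEQ_le_const[OF LIMSEQ_Suc[OF lim_1_over_n], of "measure M Z"] by auto
  then have "emeasure M Z = 0" by (simp add: emeasure_eq_measure measure_le_0_iff)
  then have "Z \<in> null_sets M" using Z by auto
  moreover have "{x \<in> space M. \<not> P x} \<subseteq> Z" using F(3) unfolding Z_def by blast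
  ultimately show ?thesis by (rule AE_I')
qed

text \<open>For fixed J only finitely many partial sums occur and each is continuous in the L^1
  norm, so a trigonometric polynomial close to f carries the bound over, with 15 in place of 14.
  Then J tends to infinity.\<close>

lemma (in lacunary_sequence) weak_type:
  fixes f :: "real \<Rightarrow> complex"
  assumes f: "integrable \<mu> f" and lam: "lam > 0"
  shows "maximal_bound n (max 1 weak_const) 15 {1..} f lam"
proof -
  define C where "C = max 1 weak_const"
  have C: "C \<ge> 0" by (simp add: C_def)
  \<comment> \<open>The level sets themselves increase with J; the exceptional sets supplied for
    different J need not be nested.\<close>
  define A where "A J = (\<Union>N\<in>{1..J}. {y \<in> space \<mu>. 15 * lam < norm (average n f N y)})" for J
  have [measurable]: "average n f N \<in> borel_measurable \<mu>" for N
    unfolding average_def[abs_def]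
    by (intro borel_measurable_divide borel_measurable_sum borel_measurable_torus_continuous continuous_on_partial_sum) auto
  have As: "A J \<in> sets \<mu>" for J unfolding A_def by measurable
  have Am: "measure \<mu> (A J) \<le> C * L1_norm f / lam" for J
  proof (rule field_le_epsilon)
    fix e :: real assume e: "e > 0"
    define L where "L = Max (n ` {1..J})"
    have L: "n j \<le> L" if "j \<in> {1..J}" for j unfolding L_def using that by (intro Max_ge) auto
    \<comment> \<open>The first entry makes each S_(n_j)(f - p) at most lam everywhere; the second
      keeps the excess in the measure bound below e.\<close>
    define d where "d = min (lam / (2 * real L + 1)) (e * lam / (C + 1))"
    have d0: "d > 0" unfolding d_def using lam e C by simp
    obtain p where p: "trig_poly p" "(LINT x|\<mu>. norm (f x - p x)) < d"
      using trig_poly_L1_dense[OF f d0] by blast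
    have pint: "integrable \<mu> p" by (rule integrable_trig_poly) fact
    have fp: "integrable \<mu> (\<lambda>x. f x - p x)" using f pint by simp
    obtain E where E: "E \<in> sets \<mu>" "measure \<mu> E \<le> C * L1_norm p / lam"
      "\<And>y N. y \<in> torus - E \<Longrightarrow> N \<in> {1..J} \<Longrightarrow> norm (average n p N y) \<le> 14 * lam"
      using weak_type_continuous[OF continuous_on_trig_poly[OF p(1)] lam, of J]
        unfolding maximal_bound_def C_def by blast
    have "A J \<subseteq> E"
    proof
      fix y assume "y \<in> A J"
      then obtain N where N: "N \<in> {1..J}" "y \<in> torus" "15 * lam < norm (average n f N y)" by (auto simp: A_def)
      have N0: "real N > 0" using N by simp
      have "norm (fourier_partial_sum (n j) (\<lambda>x. f x - p x) y) \<le> lam" if j: "j \<in> {1..N}" for j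
      proof -
        have "norm (fourier_partial_sum (n j) (\<lambda>x. f x - p x) y) \<le> (2 * real (n j) + 1) * (LINT x|\<mu>. norm (f x - p x))"
          by (rule norm_partial_sum_le[OF fp])
        also have "\<dots> \<le> (2 * real L + 1) * (lam / (2 * real L + 1))"
          using L[of j] j N p(2) by (intro mult_mono) (auto simp: d_def)
        also have "\<dots> = lam" by (simp add: add_pos_nonneg less_imp_neq[symmetric])
        finally show ?thesis .
      qed
      then have "norm (\<Sum>j = 1..N. fourier_partial_sum (n j) (\<lambda>x. f x - p x) y) \<le> real (card {1..N}) * lam"
        by (rule sum_norm_bound)
      then have "norm (average n (\<lambda>x. f x - p x) N y) \<le> lam"
        unfolding average_def using N0 by (simp add: norm_divide divide_le_eq mult.commute)
      moreover have "average n (\<lambda>x. f x - p x) N y = average n f N y - average n p N y"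
        unfolding average_def by (simp add: partial_sum_diff[OF f pint] sum_subtractf diff_divide_distrib)
      ultimately have "norm (average n p N y) > 14 * lam"
        using N(3) norm_triangle_ineq2[of "average n f N y" "average n p N y"] by simp
      then show "y \<in> E" using E(3)[of y N] N by force
    qed
    then have "measure \<mu> (A J) \<le> measure \<mu> E"
      using E(1) by (intro torus.finite_measure_mono) auto
    also note E(2)
    also have "C * L1_norm p / lam \<le> C * (L1_norm f + e * lam / (C + 1)) / lam"
    proof (intro divide_right_mono mult_left_mono)
      have "L1_norm p \<le> (LINT x|\<mu>. norm (f x) + norm (f x - p x))"
      proof (rule integral_mono)
        show "norm (p x) \<le> norm (f x) + norm (f x - p x)" for x
          using norm_triangle_ineq4[of "f x" "f x - p x"] by simp
      qed (use f fp pint in auto)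
      also have "\<dots> = L1_norm f + (LINT x|\<mu>. norm (f x - p x))"
        using f fp by simp
      finally show "L1_norm p \<le> L1_norm f + e * lam / (C + 1)"
        using p(2) by (simp add: d_def)
    qed (use C lam in auto)
    also have "\<dots> = C * L1_norm f / lam + (C / (C + 1)) * e"
      using lam C by (simp add: field_simps)
    also have "(C / (C + 1)) * e \<le> 1 * e" using C e by (intro mult_right_mono) auto
    finally show "measure \<mu> (A J) \<le> C * L1_norm f / lam + e" by simp
  qed
  have "(\<lambda>J. measure \<mu> (A J)) \<longlonglongrightarrow> measure \<mu> (\<Union>J. A J)"
  proof (rule torus.finite_Lim_measure_incseq)
    show "range A \<subseteq> sets \<mu>" using As by blast
    show "incseq A" unfolding incseq_def A_def by fastforce
  qed
  then have "measure \<mu> (\<Union>J. A J) \<le> C * L1_norm f / lam"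
    using Am by (intro LIMSEQ_le_const2) auto
  moreover have "norm (average n f N y) \<le> 15 * lam" if "y \<in> torus - (\<Union>J. A J)" "N \<ge> 1" for y N
    using that by (fastforce simp: A_def not_less)
  ultimately show ?thesis using As unfolding maximal_bound_def C_def by (intro bexI[of _ "\<Union>J. A J"]) auto
qed

text \<open>The Banach principle: the averages converge for trigonometric polynomials, and the weak
  type bound makes the contribution of the remainder f - p small outside a set of small
  measure.\<close>

theorem corollary1p2:
  fixes n :: "nat \<Rightarrow> nat" and f :: "real \<Rightarrow> complex"
  assumes "\<And>j. j \<ge> 1 \<Longrightarrow> n j > 0"
    and "lacunary n"
    and "integrable (lebesgue_on torus) f"
  shows "AE y in lebesgue_on torus.
    (\<lambda>N. 1 / of_nat N * (\<Sum>j = 1..N. fourier_partial_sum (n j) f y)) \<longlonglongrightarrow> f y"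
proof -
  note pos = assms(1) and f = assms(3)
  obtain q where q: "q > 1" and step: "\<And>j. j \<ge> 1 \<Longrightarrow> real (n (j + 1)) \<ge> q * real (n j)"
    using assms(2) unfolding lacunary_def by blast
  interpret lacunary_sequence n q using q step pos by unfold_locales
  define C where "C = max 1 weak_const"
  have C: "C \<ge> 0" by (simp add: C_def)
  \<comment> \<open>Growth to infinity makes S_(n_j) p equal to p for all large j.\<close>
  have nj: "j \<le> n j" if "j \<ge> 1" for j
    using that
  proof (induction j rule: dec_induct)
    case base
    then show ?case using pos[of 1] by simp
  next
    case (step j)
    have "1 * real (n j) < q * real (n j)" using q pos[of j] step by (intro mult_strict_right_mono) auto
    also have "\<dots> \<le> real (n (Suc j))" using growth[of j "Suc j"] step by simp
    finally show ?case using step by simp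
  qed
  \<comment> \<open>Here 17 = 15 + 1 + 1: the maximal bound for g = f - p, the averages of p, and
    the size of g itself.\<close>
  have close: "AE y in \<mu>. \<forall>\<^sub>F N in sequentially. norm (average n f N y - f y) \<le> 17 * lam" if lam: "lam > 0" for lam
  proof (rule AE_by_small_sets)
    show "finite_measure \<mu>" by unfold_locales
    fix e :: real assume e: "e > 0"
    \<comment> \<open>The set from the maximal bound contributes C and the level set of g
      contributes 1 to the factor C + 1.\<close>
    define d where "d = e * lam / (C + 1)"
    have d: "d > 0" using e lam C by (simp add: d_def)
    obtain p where p: "trig_poly p" "(LINT x|\<mu>. norm (f x - p x)) < d"
      using trig_poly_L1_dense[OF f d] by blast
    define g where "g x = f x - p x" for x
    have pint: "integrable \<mu> p" by (rule integrable_trig_poly) fact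
    have g: "integrable \<mu> g" unfolding g_def using f pint by simp
    obtain E where E: "E \<in> sets \<mu>" "measure \<mu> E \<le> C * L1_norm g / lam"
      "\<And>y N. y \<in> torus - E \<Longrightarrow> N \<ge> 1 \<Longrightarrow> norm (average n g N y) \<le> 15 * lam"
      using weak_type[OF g lam] unfolding maximal_bound_def C_def by auto
    have gm [measurable]: "g \<in> borel_measurable \<mu>" using g by simp
    define G where "G = {y \<in> space \<mu>. lam \<le> norm (g y)}"
    have G: "G \<in> sets \<mu>" unfolding G_def by measurable
    have "measure \<mu> G \<le> L1_norm g / lam"
      unfolding G_def using g lam by (intro integral_Markov_inequality_measure[where A = "{}"]) auto
    then have "measure \<mu> (E \<union> G) \<le> C * L1_norm g / lam + L1_norm g / lam"
      using measure_Un_le[OF E(1) G] E(2) by linarith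
    also have "\<dots> = (C + 1) * L1_norm g / lam" by (simp add: add_divide_distrib distrib_right)
    also have "\<dots> \<le> (C + 1) * d / lam"
      using p(2) C lam unfolding g_def by (intro divide_right_mono mult_left_mono) auto
    also have "\<dots> = e" using C lam by (simp add: d_def)
    finally have "measure \<mu> (E \<union> G) \<le> e" .
    moreover have "\<forall>\<^sub>F N in sequentially. norm (average n f N y - f y) \<le> 17 * lam" if y: "y \<in> space \<mu> - (E \<union> G)" for y
    proof -
      obtain N0 where N0: "\<And>m. m \<ge> N0 \<Longrightarrow> fourier_partial_sum m p y = p y"
        using partial_sum_trig_poly[OF p(1)] by blast
      have "(\<lambda>N. average n p N y) \<longlonglongrightarrow> p y"
        unfolding average_def
      proof (rule averages_eventually_const)
        fix j assume "j \<ge> max 1 N0"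
        then show "fourier_partial_sum (n j) p y = p y" using nj[of j] by (intro N0) auto
      qed
      then have "\<forall>\<^sub>F N in sequentially. dist (average n p N y) (p y) < lam" using lam by (rule tendstoD)
      then show ?thesis
        using eventually_ge_at_top[of 1]
      proof eventually_elim
        case (elim N)
        have "average n g N y = average n f N y - average n p N y"
          unfolding average_def g_def by (simp add: partial_sum_diff[OF f pint] sum_subtractf diff_divide_distrib)
        then have "average n f N y - f y = average n g N y + (average n p N y - p y) - g y" by (simp add: g_def)
        also have "norm \<dots> \<le> norm (average n g N y) + norm (average n p N y - p y) + norm (g y)"
          by (intro order_trans[OF norm_triangle_ineq4] add_mono norm_triangle_ineq order_refl)
        also have "\<dots> \<le> 15 * lam + lam + lam"
          using elim E(3)[of y N] y by (intro add_mono) (auto simp: dist_norm G_def)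
        finally show ?case by simp
      qed
    qed
    ultimately show "\<exists>F\<in>sets \<mu>. measure \<mu> F \<le> e \<and>
        (\<forall>y\<in>space \<mu> - F. \<forall>\<^sub>F N in sequentially. norm (average n f N y - f y) \<le> 17 * lam)"
      using E(1) G by blast
  qed
  \<comment> \<open>Countably many heights suffice, so the null sets can be united.\<close>
  have "AE y in \<mu>. \<forall>i. \<forall>\<^sub>F N in sequentially. norm (average n f N y - f y) \<le> 17 * (1 / real (Suc i))"
    unfolding AE_all_countable by (intro allI close) simp
  then show ?thesis
  proof eventually_elim
    case (elim y)
    have "(\<lambda>N. average n f N y) \<longlonglongrightarrow> f y"
    proof (rule tendstoI)
      fix e :: real assume "e > 0"
      then obtain i where i: "17 / e < real (Suc i)" using reals_Archimedean2 less_trans of_nat_less_iff by (metis lessI)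
      then have "17 * (1 / real (Suc i)) < e" using \<open>e > 0\<close> by (simp add: field_simps)
      with elim[rule_format, of i] show "\<forall>\<^sub>F N in sequentially. dist (average n f N y) (f y) < e"
        by (auto simp: dist_norm elim!: eventually_mono)
    qed
    then show ?case by (simp add: average_def)
  qed
qed

end
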